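(* Let $(\Lambda,d)$ be a compactly aligned topological $k$-graph, with boundary-path space $\partial\Lambda$ and boundary-path groupoid $\mathcal{G}_\Lambda$. Then $\mathcal{G}_\Lambda$ is essentially free if and only if the following condition holds: for every nonempty open set $V\subset\Lambda^0$ there exists an aperiodic boundary path $x\in\partial\Lambda$ with $r(x)\in V$.
   Context: Conventions: $\mathbb{N}=\{0,1,2,\dots\}$; on $(\mathbb{N}\cup\{\infty\})^k$, $\le$ is the coordinatewise order and $\vee,\wedge$ are coordinatewise max and min. Topological $k$-graph ($k\in\mathbb{N}$): a pair $(\Lambda,d)$ of a small category $\Lambda$ (range = codomain map $r$, source = domain map $s$; $\lambda\mu$ is defined when $s(\lambda)=r(\mu)$) and a functor $d:\Lambda\to\mathbb{N}^k$ such that: (1) the object and morphism sets are second-countable locally compact Hausdorff spaces; (2) $r,s$ are continuous and $s$ is a local homeomorphism; (3) composition, from the set of composable pairs with the relative product topology, is continuous and open; (4) $d$ is continuous, $\mathbb{N}^k$ being discrete; (5) if $d(\lambda)=m+n$ there is a unique composable pair $(\xi,\eta)$ with $\lambda=\xi\eta$, $d(\xi)=m$, $d(\eta)=n$. $\Lambda$ also denotes the morphism set, objects are identified with identity morphisms, $\Lambda^m:=d^{-1}(\{m\})$ (so $\Lambda^0$ is the object set), and $UV:=\{\lambda\mu:\lambda\in U,\mu\in V,s(\lambda)=r(\mu)\}$ for $U,V\subset\Lambda$. Compactly aligned: for all $p,q\in\mathbb{N}^k$ and compact $U\subset\Lambda^p$, $V\subset\Lambda^q$, the set $U\vee V:=U\Lambda^{(p\vee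 q)-p}\cap V\Lambda^{(p\vee q)-q}$ is compact. Path space: for $m\in(\mathbb{N}\cup\{\infty\})^k$ let $\Omega_{k,m}$ be the discrete topological $k$-graph with objects $\{p\in\mathbb{N}^k:p\le m\}$, morphisms $\{(p,q)\in\mathbb{N}^k\times\mathbb{N}^k:p\le q\le m\}$, $r(p,q)=p$, $s(p,q)=q$, $(n,p)(p,q)=(n,q)$, $d(p,q)=q-p$. $X_\Lambda$ is the set of all degree-preserving (continuous) functors $x:\Omega_{k,m}\to\Lambda$, $m\in(\mathbb{N}\cup\{\infty\})^k$; put $d(x)=m$, $r(x)=x(0)$. For $m\in\mathbb{N}^k$, $m\le d(x)$, $\sigma^mx\in X_\Lambda$ has degree $d(x)-m$ and $(\sigma^mx)(0,p)=x(m,m+p)$; for $\lambda\in\Lambda$ with $s(\lambda)=r(x)$, $\lambda x\in X_\Lambda$ has degree $d(\lambda)+d(x)$, $(\lambda x)(0,d(\lambda))=\lambda$ and $\sigma^{d(\lambda)}(\lambda x)=x$. Path groupoid $G_\Lambda$: let $\Lambda*_s\Lambda:=\{(\lambda,\mu)\in\Lambda\times\Lambda:s(\lambda)=s(\mu)\}$ and $U*_sV:=(U\times V)\cap(\Lambda*_s\Lambda)$. $G_\Lambda$ has object set $X_\Lambda$ and morphisms $(\lambda x,d(\lambda)-d(\mu),\mu x)\in X_\Lambda\times\mathbb{Z}^k\times X_\Lambda$ with $(\lambda,\mu)\in\Lambda*_s\Lambda$, $x\in X_\Lambda$, $r(x)=s(\lambda)$; $r(x,m,y)=x$, $s(x,m,y)=y$,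 $(x,m,y)(y,n,z)=(x,m+n,z)$, $(x,m,y)^{-1}=(y,-m,x)$; the unit $x$ is identified with $(x,0,x)$. For $F\subset\Lambda*_s\Lambda$, $m\in\mathbb{Z}^k$, let $Z(F,m):=\{(\lambda x,d(\lambda)-d(\mu),\mu x)\in G_\Lambda:(\lambda,\mu)\in F,\ d(\lambda)-d(\mu)=m\}$. The topology on $G_\Lambda$ has as basis the sets $Z(U*_sV,m)\cap Z(F,m)^c$ with $m\in\mathbb{Z}^k$, $U,V\subset\Lambda$ open, $F\subset\Lambda*_s\Lambda$ compact; $G_\Lambda^{(0)}=X_\Lambda$ has the relative topology. Boundary paths: $\Lambda^{\min}(\lambda,\mu):=\{(\alpha,\beta):\lambda\alpha=\mu\beta,\ d(\lambda\alpha)=d(\lambda)\vee d(\mu)\}$. For $V\subset\Lambda^0$, a set $E\subset V\Lambda$ is exhaustive for $V$ if for every $\lambda\in V\Lambda$ there is $\mu\in E$ with $\Lambda^{\min}(\lambda,\mu)\neq\emptyset$. For $v\in\Lambda^0$, $v\mathcal{CE}(\Lambda)$ is the set of compact $E\subset\Lambda$ such that $r(E)$ is a neighbourhood of $v$ and $E$ is exhaustive for $r(E)$. $x\in X_\Lambda$ is a boundary path if for all $m\in\mathbb{N}^k$ with $m\le d(x)$ and all $E\in x(m)\mathcal{CE}(\Lambda)$ there is $\lambda\in E$ with $x(m,m+d(\lambda))=\lambda$. $\partial\Lambda$ is the set of boundary paths; it is a closed invariant subset of $G_\Lambda^{(0)}$, and the boundary-path groupoid is the reduction $\mathcal{G}_\Lambda:=G_\Lambda|_{\partial\Lambda}$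 (elements of $G_\Lambda$ with range and source in $\partial\Lambda$) with the relative topology. A boundary path $x$ is aperiodic if for all $p,q\in\mathbb{N}^k$ with $p,q\le d(x)$, $p\ne q$ implies $\sigma^px\ne\sigma^qx$. A topological groupoid $\Gamma$ is essentially free if the set of units $x$ with trivial isotropy ($x\Gamma x=\{x\}$) is dense in $\Gamma^{(0)}$. *)

theory Defs
  imports "HOL-Analysis.Analysis" "HOL-Library.Function_Algebras"
begin

section \<open>Degrees\<close>

text \<open>
  Elements of \<open>\<nat>\<^sup>k\<close>, \<open>(\<nat> \<union> {\<infinity>})\<^sup>k\<close> and \<open>\<int>\<^sup>k\<close> are functions on \<^typ>\<open>nat\<close> that vanish
  from \<open>k\<close> on, so that \<open>k = 0\<close> is allowed. The order, \<open>\<squnion>\<close>/\<open>\<sqinter>\<close> and the arithmetic are the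
  pointwise ones on functions.
\<close>

definition Nk :: "nat \<Rightarrow> (nat \<Rightarrow> nat) set" where
  "Nk k = {p. \<forall>i\<ge>k. p i = 0}"

definition NInfk :: "nat \<Rightarrow> (nat \<Rightarrow> enat) set" where
  "NInfk k = {m. \<forall>i\<ge>k. m i = 0}"

definition Zk :: "nat \<Rightarrow> (nat \<Rightarrow> int) set" where
  "Zk k = {m. \<forall>i\<ge>k. m i = 0}"

definition edeg :: "(nat \<Rightarrow> nat) \<Rightarrow> nat \<Rightarrow> enat" where
  "edeg p = (\<lambda>i. enat (p i))"

definition zdeg :: "(nat \<Rightarrow> nat) \<Rightarrow> nat \<Rightarrow> int" where
  "zdeg p = (\<lambda>i. int (p i))"


section \<open>Topological \<open>k\<close>-graphs\<close>

text \<open>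
  Objects are identified with their identity morphisms, so the object set is a subset of the
  morphism set. The object space nevertheless carries a topology of its own, because the axioms
  below do not presuppose that it is the relative topology from the morphism space. (They imply
  it: the source map restricts to an injective local homeomorphism on the clopen set of morphisms
  of degree \<open>0\<close>.)
\<close>

record 'a tkgraph =
  mor_top :: "'a topology"
  obj_top :: "'a topology"
  rng :: "'a \<Rightarrow> 'a"
  src :: "'a \<Rightarrow> 'a"
  cmp :: "'a \<Rightarrow> 'a \<Rightarrow> 'a"
  deg :: "'a \<Rightarrow> nat \<Rightarrow> nat"

definition mor :: "'a tkgraph \<Rightarrow> 'a set" where
  "mor \<Lambda> = topspace (mor_top \<Lambda>)"

definition obj :: "'a tkgraph \<Rightarrow> 'a set" where
  "obj \<Lambda> = topspace (obj_top \<Lambda>)"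

definition composable :: "'a tkgraph \<Rightarrow> ('a \<times> 'a) set" where
  "composable \<Lambda> = {(\<mu>, \<nu>). \<mu> \<in> mor \<Lambda> \<and> \<nu> \<in> mor \<Lambda> \<and> src \<Lambda> \<mu> = rng \<Lambda> \<nu>}"

locale small_category =
  fixes \<Lambda> :: "'a tkgraph"
  assumes obj_subset: "obj \<Lambda> \<subseteq> mor \<Lambda>"
    and rng_obj: "\<mu> \<in> mor \<Lambda> \<Longrightarrow> rng \<Lambda> \<mu> \<in> obj \<Lambda>"
    and src_obj: "\<mu> \<in> mor \<Lambda> \<Longrightarrow> src \<Lambda> \<mu> \<in> obj \<Lambda>"
    and rng_id: "v \<in> obj \<Lambda> \<Longrightarrow> rng \<Lambda> v = v"
    and src_id: "v \<in> obj \<Lambda> \<Longrightarrow> src \<Lambda> v = v"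
    and cmp_mor: "(\<mu>, \<nu>) \<in> composable \<Lambda> \<Longrightarrow> cmp \<Lambda> \<mu> \<nu> \<in> mor \<Lambda>"
    and rng_cmp: "(\<mu>, \<nu>) \<in> composable \<Lambda> \<Longrightarrow> rng \<Lambda> (cmp \<Lambda> \<mu> \<nu>) = rng \<Lambda> \<mu>"
    and src_cmp: "(\<mu>, \<nu>) \<in> composable \<Lambda> \<Longrightarrow> src \<Lambda> (cmp \<Lambda> \<mu> \<nu>) = src \<Lambda> \<nu>"
    and id_left: "\<mu> \<in> mor \<Lambda> \<Longrightarrow> cmp \<Lambda> (rng \<Lambda> \<mu>) \<mu> = \<mu>"
    and id_right: "\<mu> \<in> mor \<Lambda> \<Longrightarrow> cmp \<Lambda> \<mu> (src \<Lambda> \<mu>) = \<mu>"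
    and cmp_assoc: "\<lbrakk>(\<mu>, \<nu>) \<in> composable \<Lambda>; (\<nu>, \<xi>) \<in> composable \<Lambda>\<rbrakk>
      \<Longrightarrow> cmp \<Lambda> (cmp \<Lambda> \<mu> \<nu>) \<xi> = cmp \<Lambda> \<mu> (cmp \<Lambda> \<nu> \<xi>)"

definition local_homeomorphism :: "'a topology \<Rightarrow> 'b topology \<Rightarrow> ('a \<Rightarrow> 'b) \<Rightarrow> bool" where
  "local_homeomorphism X Y f \<longleftrightarrow>
    (\<forall>x\<in>topspace X. \<exists>U. openin X U \<and> x \<in> U \<and> openin Y (f ` U) \<and>
       homeomorphic_map (subtopology X U) (subtopology Y (f ` U)) f)"

locale topological_k_graph = small_category \<Lambda> for k :: nat and \<Lambda> :: "'a tkgraph" +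
  assumes deg_in: "\<mu> \<in> mor \<Lambda> \<Longrightarrow> deg \<Lambda> \<mu> \<in> Nk k"
    and deg_id: "v \<in> obj \<Lambda> \<Longrightarrow> deg \<Lambda> v = 0"
    and deg_cmp: "(\<mu>, \<nu>) \<in> composable \<Lambda> \<Longrightarrow> deg \<Lambda> (cmp \<Lambda> \<mu> \<nu>) = deg \<Lambda> \<mu> + deg \<Lambda> \<nu>"
    and second_countable_obj: "second_countable (obj_top \<Lambda>)"
    and locally_compact_obj: "locally_compact_space (obj_top \<Lambda>)"
    and Hausdorff_obj: "Hausdorff_space (obj_top \<Lambda>)"
    and second_countable_mor: "second_countable (mor_top \<Lambda>)"
    and locally_compact_mor: "locally_compact_space (mor_top \<Lambda>)"
    and Hausdorff_mor: "Hausdorff_space (mor_top \<Lambda>)"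
    and continuous_rng: "continuous_map (mor_top \<Lambda>) (obj_top \<Lambda>) (rng \<Lambda>)"
    and continuous_src: "continuous_map (mor_top \<Lambda>) (obj_top \<Lambda>) (src \<Lambda>)"
    and local_homeo_src: "local_homeomorphism (mor_top \<Lambda>) (obj_top \<Lambda>) (src \<Lambda>)"
    and continuous_cmp:
      "continuous_map (subtopology (prod_topology (mor_top \<Lambda>) (mor_top \<Lambda>)) (composable \<Lambda>))
         (mor_top \<Lambda>) (\<lambda>(\<mu>, \<nu>). cmp \<Lambda> \<mu> \<nu>)"
    and open_cmp:
      "open_map (subtopology (prod_topology (mor_top \<Lambda>) (mor_top \<Lambda>)) (composable \<Lambda>))
         (mor_top \<Lambda>) (\<lambda>(\<mu>, \<nu>). cmp \<Lambda> \<mu> \<nu>)"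
    and continuous_deg: "continuous_map (mor_top \<Lambda>) (discrete_topology (Nk k)) (deg \<Lambda>)"
    and unique_factorization:
      "\<lbrakk>\<mu> \<in> mor \<Lambda>; m \<in> Nk k; n \<in> Nk k; deg \<Lambda> \<mu> = m + n\<rbrakk>
       \<Longrightarrow> \<exists>!(\<xi>, \<eta>). (\<xi>, \<eta>) \<in> composable \<Lambda> \<and> \<mu> = cmp \<Lambda> \<xi> \<eta> \<and> deg \<Lambda> \<xi> = m \<and> deg \<Lambda> \<eta> = n"

definition mor_of_deg :: "'a tkgraph \<Rightarrow> (nat \<Rightarrow> nat) \<Rightarrow> 'a set" where
  "mor_of_deg \<Lambda> m = {\<mu> \<in> mor \<Lambda>. deg \<Lambda> \<mu> = m}"

definition set_cmp :: "'a tkgraph \<Rightarrow> 'a set \<Rightarrow> 'a set \<Rightarrow> 'a set" where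
  "set_cmp \<Lambda> U V = {cmp \<Lambda> \<mu> \<nu> | \<mu> \<nu>. \<mu> \<in> U \<and> \<nu> \<in> V \<and> (\<mu>, \<nu>) \<in> composable \<Lambda>}"

definition compactly_aligned :: "nat \<Rightarrow> 'a tkgraph \<Rightarrow> bool" where
  "compactly_aligned k \<Lambda> \<longleftrightarrow>
    (\<forall>p\<in>Nk k. \<forall>q\<in>Nk k. \<forall>U V.
       U \<subseteq> mor_of_deg \<Lambda> p \<and> V \<subseteq> mor_of_deg \<Lambda> q \<and>
       compactin (mor_top \<Lambda>) U \<and> compactin (mor_top \<Lambda>) V \<longrightarrow>
       compactin (mor_top \<Lambda>)
         (set_cmp \<Lambda> U (mor_of_deg \<Lambda> (sup p q - p)) \<inter> set_cmp \<Lambda> V (mor_of_deg \<Lambda> (sup p q - q))))"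


section \<open>The path space\<close>

text \<open>The object \<open>p\<close> of \<open>\<Omega>\<^bsub>k,m\<^esub>\<close> is represented by its identity morphism \<open>(p, p)\<close>.\<close>

definition Omega :: "nat \<Rightarrow> (nat \<Rightarrow> enat) \<Rightarrow> ((nat \<Rightarrow> nat) \<times> (nat \<Rightarrow> nat)) tkgraph" where
  "Omega k m =
    \<lparr>mor_top = discrete_topology {(p, q). p \<in> Nk k \<and> q \<in> Nk k \<and> p \<le> q \<and> edeg q \<le> m},
     obj_top = discrete_topology {(p, p) | p. p \<in> Nk k \<and> edeg p \<le> m},
     rng = (\<lambda>(p, q). (p, p)),
     src = (\<lambda>(p, q). (q, q)),
     cmp = (\<lambda>(n, p) (p', q). (n, q)),
     deg = (\<lambda>(p, q). q - p)\<rparr>"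

definition graph_functor :: "'a tkgraph \<Rightarrow> 'b tkgraph \<Rightarrow> ('a \<Rightarrow> 'b) \<Rightarrow> bool" where
  "graph_functor \<Gamma> \<Lambda> f \<longleftrightarrow>
    continuous_map (mor_top \<Gamma>) (mor_top \<Lambda>) f \<and>
    continuous_map (obj_top \<Gamma>) (obj_top \<Lambda>) f \<and>
    (\<forall>\<mu>\<in>mor \<Gamma>. rng \<Lambda> (f \<mu>) = f (rng \<Gamma> \<mu>) \<and> src \<Lambda> (f \<mu>) = f (src \<Gamma> \<mu>) \<and>
       deg \<Lambda> (f \<mu>) = deg \<Gamma> \<mu>) \<and>
    (\<forall>(\<mu>, \<nu>)\<in>composable \<Gamma>. f (cmp \<Gamma> \<mu> \<nu>) = cmp \<Lambda> (f \<mu>) (f \<nu>))"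

text \<open>
  A path is stored together with its degree. The underlying map is \<^const>\<open>undefined\<close> outside the
  morphisms of \<open>\<Omega>\<^bsub>k,m\<^esub>\<close>, so that equality of paths is equality of functors.
\<close>

type_synonym 'a kpath = "(nat \<Rightarrow> enat) \<times> ((nat \<Rightarrow> nat) \<times> (nat \<Rightarrow> nat) \<Rightarrow> 'a)"

definition path_space :: "nat \<Rightarrow> 'a tkgraph \<Rightarrow> 'a kpath set" where
  "path_space k \<Lambda> =
    {(m, x). m \<in> NInfk k \<and> x \<in> extensional (mor (Omega k m)) \<and> graph_functor (Omega k m) \<Lambda> x}"

definition pdeg :: "'a kpath \<Rightarrow> nat \<Rightarrow> enat" where
  "pdeg x = fst x"

definition seg :: "'a kpath \<Rightarrow> (nat \<Rightarrow> nat) \<Rightarrow> (nat \<Rightarrow> nat) \<Rightarrow> 'a" where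
  "seg x p q = snd x (p, q)"

definition prng :: "'a kpath \<Rightarrow> 'a" where
  "prng x = seg x 0 0"

definition shift :: "nat \<Rightarrow> (nat \<Rightarrow> nat) \<Rightarrow> 'a kpath \<Rightarrow> 'a kpath" where
  "shift k m x =
    (pdeg x - edeg m,
     restrict (\<lambda>(p, q). seg x (m + p) (m + q)) (mor (Omega k (pdeg x - edeg m))))"

definition prepend :: "nat \<Rightarrow> 'a tkgraph \<Rightarrow> 'a \<Rightarrow> 'a kpath \<Rightarrow> 'a kpath" where
  "prepend k \<Lambda> \<mu> x =
    (THE y. y \<in> path_space k \<Lambda> \<and> pdeg y = edeg (deg \<Lambda> \<mu>) + pdeg x \<and>
       seg y 0 (deg \<Lambda> \<mu>) = \<mu> \<and> shift k (deg \<Lambda> \<mu>) y = x)"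


section \<open>Topological groupoids\<close>

text \<open>Units are identified with identity arrows; the arrow set is the carrier of the topology.\<close>

record 'g tgroupoid =
  arr_top :: "'g topology"
  arr_rng :: "'g \<Rightarrow> 'g"
  arr_src :: "'g \<Rightarrow> 'g"
  arr_mult :: "'g \<Rightarrow> 'g \<Rightarrow> 'g"
  arr_inv :: "'g \<Rightarrow> 'g"

definition arrows :: "'g tgroupoid \<Rightarrow> 'g set" where
  "arrows \<Gamma> = topspace (arr_top \<Gamma>)"

definition units :: "'g tgroupoid \<Rightarrow> 'g set" where
  "units \<Gamma> = arr_rng \<Gamma> ` arrows \<Gamma>"

definition unit_top :: "'g tgroupoid \<Rightarrow> 'g topology" where
  "unit_top \<Gamma> = subtopology (arr_top \<Gamma>) (units \<Gamma>)"

definition isotropy :: "'g tgroupoid \<Rightarrow> 'g \<Rightarrow> 'g set" where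
  "isotropy \<Gamma> u = {g \<in> arrows \<Gamma>. arr_rng \<Gamma> g = u \<and> arr_src \<Gamma> g = u}"

definition reduction :: "'g tgroupoid \<Rightarrow> 'g set \<Rightarrow> 'g tgroupoid" where
  "reduction \<Gamma> A =
    \<Gamma>\<lparr>arr_top :=
       subtopology (arr_top \<Gamma>) {g \<in> arrows \<Gamma>. arr_rng \<Gamma> g \<in> A \<and> arr_src \<Gamma> g \<in> A}\<rparr>"

definition essentially_free :: "'g tgroupoid \<Rightarrow> bool" where
  "essentially_free \<Gamma> \<longleftrightarrow>
    unit_top \<Gamma> closure_of {u \<in> units \<Gamma>. isotropy \<Gamma> u = {u}} = units \<Gamma>"


section \<open>The path groupoid\<close>

type_synonym 'a karrow = "'a kpath \<times> (nat \<Rightarrow> int) \<times> 'a kpath"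

definition src_pairs :: "'a tkgraph \<Rightarrow> ('a \<times> 'a) set" where
  "src_pairs \<Lambda> = {(\<mu>, \<nu>). \<mu> \<in> mor \<Lambda> \<and> \<nu> \<in> mor \<Lambda> \<and> src \<Lambda> \<mu> = src \<Lambda> \<nu>}"

definition path_arrows :: "nat \<Rightarrow> 'a tkgraph \<Rightarrow> 'a karrow set" where
  "path_arrows k \<Lambda> =
    {(prepend k \<Lambda> \<mu> x, zdeg (deg \<Lambda> \<mu>) - zdeg (deg \<Lambda> \<nu>), prepend k \<Lambda> \<nu> x) | \<mu> \<nu> x.
       (\<mu>, \<nu>) \<in> src_pairs \<Lambda> \<and> x \<in> path_space k \<Lambda> \<and> prng x = src \<Lambda> \<mu>}"

definition Zset :: "nat \<Rightarrow> 'a tkgraph \<Rightarrow> ('a \<times> 'a) set \<Rightarrow> (nat \<Rightarrow> int) \<Rightarrow> 'a karrow set" where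
  "Zset k \<Lambda> F m =
    {(prepend k \<Lambda> \<mu> x, zdeg (deg \<Lambda> \<mu>) - zdeg (deg \<Lambda> \<nu>), prepend k \<Lambda> \<nu> x) | \<mu> \<nu> x.
       (\<mu>, \<nu>) \<in> src_pairs \<Lambda> \<and> x \<in> path_space k \<Lambda> \<and> prng x = src \<Lambda> \<mu> \<and>
       (\<mu>, \<nu>) \<in> F \<and> zdeg (deg \<Lambda> \<mu>) - zdeg (deg \<Lambda> \<nu>) = m}"

definition path_groupoid_basis :: "nat \<Rightarrow> 'a tkgraph \<Rightarrow> 'a karrow set set" where
  "path_groupoid_basis k \<Lambda> =
    {Zset k \<Lambda> ((U \<times> V) \<inter> src_pairs \<Lambda>) m \<inter> (path_arrows k \<Lambda> - Zset k \<Lambda> F m) | U V F m.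
       m \<in> Zk k \<and> openin (mor_top \<Lambda>) U \<and> openin (mor_top \<Lambda>) V \<and>
       F \<subseteq> src_pairs \<Lambda> \<and> compactin (prod_topology (mor_top \<Lambda>) (mor_top \<Lambda>)) F}"

text \<open>
  \<^const>\<open>topology_generated_by\<close> takes its argument as a subbasis; for a family that is a basis of
  some topology, the result is that topology.
\<close>

definition path_groupoid :: "nat \<Rightarrow> 'a tkgraph \<Rightarrow> 'a karrow tgroupoid" where
  "path_groupoid k \<Lambda> =
    \<lparr>arr_top = topology_generated_by (path_groupoid_basis k \<Lambda>),
     arr_rng = (\<lambda>(x, m, y). (x, 0, x)),
     arr_src = (\<lambda>(x, m, y). (y, 0, y)),
     arr_mult = (\<lambda>(x, m, y) (y', n, z). (x, m + n, z)),
     arr_inv = (\<lambda>(x, m, y). (y, - m, x))\<rparr>"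

lemma (in topological_k_graph) arrows_path_groupoid:
  "arrows (path_groupoid k \<Lambda>) = path_arrows k \<Lambda>"
proof
  show "arrows (path_groupoid k \<Lambda>) \<subseteq> path_arrows k \<Lambda>"
    unfolding arrows_def path_groupoid_def path_groupoid_basis_def
    by auto
  show "path_arrows k \<Lambda> \<subseteq> arrows (path_groupoid k \<Lambda>)"
  proof
    fix g assume g: "g \<in> path_arrows k \<Lambda>"
    then obtain \<mu> \<nu> x where gx: "g = (prepend k \<Lambda> \<mu> x, zdeg (deg \<Lambda> \<mu>) - zdeg (deg \<Lambda> \<nu>), prepend k \<Lambda> \<nu> x)"
      "(\<mu>, \<nu>) \<in> src_pairs \<Lambda>" "x \<in> path_space k \<Lambda>" "prng x = src \<Lambda> \<mu>"
      unfolding path_arrows_def by blast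
    let ?m = "zdeg (deg \<Lambda> \<mu>) - zdeg (deg \<Lambda> \<nu>)"
    have m: "?m \<in> Zk k"
      using gx(2) deg_in unfolding src_pairs_def Zk_def Nk_def zdeg_def by auto
    have "(\<mu>, \<nu>) \<in> (mor \<Lambda> \<times> mor \<Lambda>) \<inter> src_pairs \<Lambda>"
      using gx(2) unfolding src_pairs_def by auto
    with gx have "g \<in> Zset k \<Lambda> ((mor \<Lambda> \<times> mor \<Lambda>) \<inter> src_pairs \<Lambda>) ?m"
      unfolding Zset_def by blast
    moreover have "Zset k \<Lambda> {} ?m = {}"
      unfolding Zset_def by blast
    ultimately have gZ: "g \<in> Zset k \<Lambda> ((mor \<Lambda> \<times> mor \<Lambda>) \<inter> src_pairs \<Lambda>) ?m \<inter> (path_arrows k \<Lambda> - Zset k \<Lambda> {} ?m)"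
      using g by blast
    have "Zset k \<Lambda> ((mor \<Lambda> \<times> mor \<Lambda>) \<inter> src_pairs \<Lambda>) ?m \<inter> (path_arrows k \<Lambda> - Zset k \<Lambda> {} ?m)
        \<in> path_groupoid_basis k \<Lambda>"
      unfolding path_groupoid_basis_def mem_Collect_eq
      by (rule exI[of _ "mor \<Lambda>"], rule exI[of _ "mor \<Lambda>"], rule exI[of _ "{}"], rule exI[of _ ?m])
         (simp add: m mor_def)
    from UnionI[OF this gZ] show "g \<in> arrows (path_groupoid k \<Lambda>)"
      unfolding arrows_def path_groupoid_def by simp
  qed
qed


section \<open>Boundary paths\<close>

definition min_ext :: "'a tkgraph \<Rightarrow> 'a \<Rightarrow> 'a \<Rightarrow> ('a \<times> 'a) set" where
  "min_ext \<Lambda> \<mu> \<nu> =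
    {(\<alpha>, \<beta>). (\<mu>, \<alpha>) \<in> composable \<Lambda> \<and> (\<nu>, \<beta>) \<in> composable \<Lambda> \<and>
       cmp \<Lambda> \<mu> \<alpha> = cmp \<Lambda> \<nu> \<beta> \<and> deg \<Lambda> (cmp \<Lambda> \<mu> \<alpha>) = sup (deg \<Lambda> \<mu>) (deg \<Lambda> \<nu>)}"

definition exhaustive :: "'a tkgraph \<Rightarrow> 'a set \<Rightarrow> 'a set \<Rightarrow> bool" where
  "exhaustive \<Lambda> V E \<longleftrightarrow>
    E \<subseteq> set_cmp \<Lambda> V (mor \<Lambda>) \<and>
    (\<forall>\<mu>\<in>set_cmp \<Lambda> V (mor \<Lambda>). \<exists>\<nu>\<in>E. min_ext \<Lambda> \<mu> \<nu> \<noteq> {})"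

definition CE :: "'a tkgraph \<Rightarrow> 'a \<Rightarrow> 'a set set" where
  "CE \<Lambda> v =
    {E. compactin (mor_top \<Lambda>) E \<and>
       (\<exists>W. openin (obj_top \<Lambda>) W \<and> v \<in> W \<and> W \<subseteq> rng \<Lambda> ` E) \<and>
       exhaustive \<Lambda> (rng \<Lambda> ` E) E}"

definition boundary_paths :: "nat \<Rightarrow> 'a tkgraph \<Rightarrow> 'a kpath set" where
  "boundary_paths k \<Lambda> =
    {x \<in> path_space k \<Lambda>.
       \<forall>m\<in>Nk k. edeg m \<le> pdeg x \<longrightarrow>
         (\<forall>E\<in>CE \<Lambda> (seg x m m).
            \<exists>\<mu>\<in>E. edeg (m + deg \<Lambda> \<mu>) \<le> pdeg x \<and> seg x m (m + deg \<Lambda> \<mu>) = \<mu>)}"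

definition boundary_path_groupoid :: "nat \<Rightarrow> 'a tkgraph \<Rightarrow> 'a karrow tgroupoid" where
  "boundary_path_groupoid k \<Lambda> =
    reduction (path_groupoid k \<Lambda>) {(x, 0, x) | x. x \<in> boundary_paths k \<Lambda>}"

definition aperiodic :: "nat \<Rightarrow> 'a kpath \<Rightarrow> bool" where
  "aperiodic k x \<longleftrightarrow>
    (\<forall>p\<in>Nk k. \<forall>q\<in>Nk k. edeg p \<le> pdeg x \<and> edeg q \<le> pdeg x \<and> p \<noteq> q \<longrightarrow>
       shift k p x \<noteq> shift k q x)"

end

theory Submission
  imports Defs
begin

text \<open>
  The isotropy at a unit \<open>x\<close> is trivial iff \<open>x\<close> is aperiodic, and the unit space carries the topology
  with basis \<open>{x. some \<mu> \<in> U is an initial segment of x, no \<phi> \<in> F is}\<close> for \<open>U\<close> open and \<open>F\<close> compact.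
  Essential freeness therefore gives the condition once every vertex is the range of a boundary path;
  any path without proper extension is one, by compactness of sets of minimal common extensions.
  Conversely, if such a basic set contains a boundary path, then compact alignment and the boundary
  condition yield an open set of morphisms all of whose elements have an initial segment in \<open>U\<close> and no
  common extension with \<open>F\<close>. Prepending one of them to an aperiodic boundary path stays in the basic
  set and preserves being aperiodic and being a boundary path.
\<close>

section \<open>Degrees\<close>

text \<open>The obstacle is that the condition speaks only of vertices, while a basic open set of
  units also excludes every path that runs through a compact set \<open>F\<close>. The link between
  the two is \<open>tails p K F\<close>: what remains of the minimal common extensions of
  \<open>K\<close> and \<open>F\<close> once the segment in \<open>K\<close> is removed. These sets
  are compact by compact alignment, and they are used in both directions. If \<open>F\<close> is
  exhaustive, its tails are exhaustive further along a path, so being a boundary path survives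
  prepending. If a boundary path avoids \<open>F\<close>, the tails cannot be exhaustive, and a
  witness of that failure is a morphism incompatible with \<open>F\<close>. In both cases a tail
  that starts the shifted path might belong to some other segment of the compact neighbourhood
  \<open>K\<close>; \<open>K\<close> is therefore taken so small that the source map is injective on
  it. For maximal paths the difficulty is coherence: a path may have infinitely many initial
  segments, and their common extensions with an exhaustive set must be chosen compatibly, which
  requires an inverse limit of compact sets and not just one compact set.\<close>

lemma Nk_diff: "p \<in> Nk k \<Longrightarrow> p - q \<in> Nk k"
  by (auto simp: Nk_def)

lemma Nk_le: "p \<le> q \<Longrightarrow> q \<in> Nk k \<Longrightarrow> p \<in> Nk k"
  by (auto simp: Nk_def le_fun_def) (metis le_zero_eq)

lemma fun_diff_add [simp]: "(p :: nat \<Rightarrow> nat) + q - p = q"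
  by (auto simp: fun_eq_iff)

lemma fun_add_diff [simp]: "(p :: nat \<Rightarrow> nat) \<le> q \<Longrightarrow> p + (q - p) = q"
  by (auto simp: fun_eq_iff le_fun_def)

lemma fun_le_add [simp]: "(p :: nat \<Rightarrow> nat) \<le> p + q" "(0 :: nat \<Rightarrow> nat) \<le> q"
  by (auto simp: le_fun_def)

lemma fun_add_le_iff [simp]: "(p :: nat \<Rightarrow> nat) + q \<le> p + r \<longleftrightarrow> q \<le> r"
  by (auto simp: le_fun_def)

lemma edeg_zero [simp]: "edeg 0 = 0"
  by (auto simp: edeg_def zero_enat_def)

lemma edeg_le_iff [simp]: "edeg p \<le> edeg q \<longleftrightarrow> p \<le> q"
  by (auto simp: edeg_def le_fun_def)

lemma fun_zero_le [simp]: "0 \<le> (d :: nat \<Rightarrow> enat)"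
  by (auto simp: le_fun_def)

lemma edeg_sup_le: "edeg p \<le> d \<Longrightarrow> edeg q \<le> d \<Longrightarrow> edeg (sup p q) \<le> d"
  unfolding edeg_def le_fun_def by (metis sup_apply sup_nat_def max_def)

lemma edeg_le_trans: "p \<le> q \<Longrightarrow> edeg q \<le> d \<Longrightarrow> edeg p \<le> d"
  by (meson edeg_le_iff order_trans)

lemma edeg_le_diff_iff:
  assumes "edeg m \<le> d"
  shows "edeg p \<le> d - edeg m \<longleftrightarrow> edeg (m + p) \<le> d"
proof -
  have "enat (p i) \<le> d i - enat (m i) \<longleftrightarrow> enat (m i + p i) \<le> d i" for i
    using le_funD[OF assms, of i] by (cases "d i") (auto simp: edeg_def)
  then show ?thesis
    by (simp add: edeg_def le_fun_def)
qed

lemma edeg_diff_add: "d - edeg (m + n) = d - edeg m - edeg n"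
proof -
  have "d i - enat (m i + n i) = d i - enat (m i) - enat (n i)" for i
    by (cases "d i") auto
  then show ?thesis
    by (auto simp: edeg_def fun_eq_iff)
qed

lemma edeg_add_diff:
  assumes "edeg m \<le> d"
  shows "edeg m + (d - edeg m) = d"
proof -
  have "enat (m i) + (d i - enat (m i)) = d i" for i
    using le_funD[OF assms, of i] by (cases "d i") (auto simp: edeg_def)
  then show ?thesis
    by (auto simp: edeg_def fun_eq_iff)
qed

lemma edeg_diff_self_add [simp]: "edeg m + d - edeg m = d"
proof -
  have "enat (m i) + d i - enat (m i) = d i" for i
    by (cases "d i") auto
  then show ?thesis
    by (auto simp: edeg_def fun_eq_iff)
qed

lemma edeg_le_add [simp]: "edeg m \<le> edeg m + d"
  by (auto simp: le_fun_def)

lemma NInfk_edeg_le: "edeg p \<le> d \<Longrightarrow> d \<in> NInfk k \<Longrightarrow> p \<in> Nk k"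
  unfolding NInfk_def Nk_def edeg_def le_fun_def zero_enat_def
  by clarsimp (metis enat_ord_simps(1) le_zero_eq)

lemma NInfk_diff: "d \<in> NInfk k \<Longrightarrow> d - edeg m \<in> NInfk k"
  by (auto simp: NInfk_def)

lemma NInfk_edeg_add: "m \<in> Nk k \<Longrightarrow> d \<in> NInfk k \<Longrightarrow> edeg m + d \<in> NInfk k"
  by (auto simp: NInfk_def Nk_def edeg_def zero_enat_def)

lemma zdeg_eq_iff: "zdeg p - zdeg q = 0 \<longleftrightarrow> p = q"
  by (auto simp: zdeg_def fun_eq_iff)

text \<open>By truncated subtraction, \<open>sup q l - l\<close> is the part of \<open>q\<close>
  beyond \<open>l\<close>. In a path obtained by prepending a morphism of degree \<open>l\<close>,
  it tells how far the original path must be read in order to reach \<open>q\<close>.\<close>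

lemma edeg_sup_diff_le:
  assumes "edeg q \<le> edeg l + d"
  shows "edeg (sup q l - l) \<le> d"
proof -
  have "enat (sup (q i) (l i) - l i) \<le> d i" for i
    using le_funD[OF assms, of i] by (cases "d i") (auto simp: edeg_def sup_nat_def)
  then show ?thesis
    by (auto simp: edeg_def le_fun_def)
qed

lemma edeg_add_le_trans: "p \<le> q \<Longrightarrow> edeg (m + q) \<le> d \<Longrightarrow> edeg (m + p) \<le> d"
  by (rule edeg_le_trans[of "m + p" "m + q"]) simp_all


section \<open>Inverse limits of compact sets\<close>

text \<open>Tychonoff: in the compact product of the \<open>C i\<close> each coherence equation cuts
  out a closed set because \<open>X\<close> is Hausdorff, and finitely many equations are solved by
  pushing one point down from an upper bound of the indices involved.\<close>

lemma inverse_limit_nonempty: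
  assumes Haus: "Hausdorff_space X"
    and directed: "\<And>F. finite F \<Longrightarrow> F \<subseteq> I \<Longrightarrow> \<exists>u\<in>I. \<forall>i\<in>F. le i u"
    and cpt: "\<And>i. i \<in> I \<Longrightarrow> compactin X (C i)"
    and ne: "\<And>i. i \<in> I \<Longrightarrow> C i \<noteq> {}"
    and maps: "\<And>i j c. i \<in> I \<Longrightarrow> j \<in> I \<Longrightarrow> le i j \<Longrightarrow> c \<in> C j \<Longrightarrow> f i j c \<in> C i"
    and cont: "\<And>i j. i \<in> I \<Longrightarrow> j \<in> I \<Longrightarrow> le i j \<Longrightarrow> continuous_map (subtopology X (C j)) X (f i j)"
    and comp: "\<And>i j u c. i \<in> I \<Longrightarrow> j \<in> I \<Longrightarrow> u \<in> I \<Longrightarrow> le i j \<Longrightarrow> le j u \<Longrightarrow> le i u \<Longrightarrow> c \<in> C u \<Longrightarrow>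
      f i j (f j u c) = f i u c"
  obtains \<theta> where "\<And>i. i \<in> I \<Longrightarrow> \<theta> i \<in> C i"
    "\<And>i j. i \<in> I \<Longrightarrow> j \<in> I \<Longrightarrow> le i j \<Longrightarrow> f i j (\<theta> j) = \<theta> i"
proof -
  let ?P = "product_topology (\<lambda>i. subtopology X (C i)) I"
  have sub: "C i \<subseteq> topspace X" if "i \<in> I" for i
    using cpt[OF that] compactin_subset_topspace by blast
  then have top: "topspace ?P = (\<Pi>\<^sub>E i\<in>I. C i)"
    by (auto simp: PiE_iff Int_absorb1)
  define J where "J = {(i, j). i \<in> I \<and> j \<in> I \<and> le i j}"
  define D where "D w = {\<theta> \<in> topspace ?P. f (fst w) (snd w) (\<theta> (snd w)) = \<theta> (fst w)}" for w
  have cP: "compact_space ?P"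
    using cpt by (simp add: compact_space_product_topology compact_space_subtopology)
  have cl: "closedin ?P A" if A: "A \<in> insert (topspace ?P) (D ` J)" for A
  proof (cases "A = topspace ?P")
    case False
    then obtain i j where "(i, j) \<in> J" and A: "A = D (i, j)"
      using A by auto
    then have ij: "i \<in> I" "j \<in> I" "le i j"
      by (auto simp: J_def)
    have "continuous_map ?P (subtopology X (C l)) (\<lambda>\<theta>. \<theta> l)" if "l \<in> I" for l
      using that by (rule continuous_map_product_projection)
    then have "continuous_map ?P X (\<lambda>\<theta>. f i j (\<theta> j))" "continuous_map ?P X (\<lambda>\<theta>. \<theta> i)"
      using continuous_map_compose[OF _ cont[OF ij], of ?P "\<lambda>\<theta>. \<theta> j"] ij
      by (auto simp: o_def continuous_map_in_subtopology)
    then show ?thesis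
      unfolding A D_def fst_conv snd_conv by (rule closedin_continuous_maps_eq[OF Haus])
  next
    case True
    then show ?thesis
      by (simp only: closedin_topspace)
  qed
  have fip: "\<Inter>\<F> \<noteq> {}" if \<F>: "finite \<F>" "\<F> \<subseteq> insert (topspace ?P) (D ` J)" for \<F>
  proof -
    have "finite (\<F> - {topspace ?P})" "\<F> - {topspace ?P} \<subseteq> D ` J"
      using \<F> by auto
    then obtain F where F: "F \<subseteq> J" "finite F" "\<F> - {topspace ?P} = D ` F"
      by (meson finite_subset_image)
    have "finite (fst ` F \<union> snd ` F)" "fst ` F \<union> snd ` F \<subseteq> I"
      using F by (auto simp: J_def)
    then obtain u where u: "u \<in> I" "\<forall>i\<in>fst ` F \<union> snd ` F. le i u"
      using directed by meson
    obtain c where c: "c \<in> C u"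
      using ne u by blast
    \<comment> \<open>The equations in \<open>F\<close> involve only indices below \<open>u\<close>;
      at the others any point of \<open>C i\<close> serves.\<close>
    define \<theta> where "\<theta> = (\<lambda>i\<in>I. if le i u then f i u c else (SOME c. c \<in> C i))"
    have "\<theta> i \<in> C i" if "i \<in> I" for i
      using that maps[OF that u(1) _ c] ne[OF that] by (auto simp: \<theta>_def some_in_eq)
    then have \<theta>: "\<theta> \<in> topspace ?P"
      unfolding top by (auto simp: \<theta>_def)
    moreover have "\<theta> \<in> D w" if "w \<in> F" for w
    proof -
      obtain i j where w: "w = (i, j)" by fastforce
      then have "i \<in> fst ` F" "j \<in> snd ` F" "(i, j) \<in> J"
        using that F(1) by (auto intro: rev_image_eqI)
      then have "i \<in> I" "j \<in> I" "le i j" "le i u" "le j u"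
        using u(2) by (auto simp: J_def)
      then show ?thesis
        unfolding D_def w using comp[of i j u c] c u \<theta> by (simp add: \<theta>_def)
    qed
    ultimately have "\<theta> \<in> A" if "A \<in> \<F>" for A
      using that F(3) by (cases "A = topspace ?P") blast+
    then show ?thesis
      by blast
  qed
  \<comment> \<open>The whole space belongs to the family so that the common point lies in the
    product even if \<open>J\<close> is empty.\<close>
  have "\<Inter>(insert (topspace ?P) (D ` J)) \<noteq> {}"
    by (rule cP[unfolded compact_space_fip, rule_format]) (use cl fip in blast)
  then obtain \<theta> where "\<theta> \<in> topspace ?P" "\<And>w. w \<in> J \<Longrightarrow> \<theta> \<in> D w"
    by auto
  then show thesis
    by (intro that[of \<theta>]) (auto simp: top J_def D_def)
qed


section \<open>Morphisms of \<open>\<Omega>\<^bsub>k,m\<^esub>\<close>\<close>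

lemma mor_Omega: "mor (Omega k d) = {(p, q). p \<in> Nk k \<and> q \<in> Nk k \<and> p \<le> q \<and> edeg q \<le> d}"
  by (simp add: mor_def Omega_def)

lemma Omega_simps [simp]:
  "rng (Omega k d) (p, q) = (p, p)" "src (Omega k d) (p, q) = (q, q)" "deg (Omega k d) (p, q) = q - p"
  "cmp (Omega k d) (p, q) (q', r) = (p, r)"
  by (simp_all add: Omega_def)

lemma mor_Omega_iff: "d \<in> NInfk k \<Longrightarrow> (p, q) \<in> mor (Omega k d) \<longleftrightarrow> p \<le> q \<and> edeg q \<le> d"
  by (auto simp: mor_Omega intro: NInfk_edeg_le edeg_le_trans)


section \<open>Factorisations\<close>

context topological_k_graph
begin

definition pre :: "'a \<Rightarrow> 'a \<Rightarrow> bool" (infix "\<preceq>" 50) where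
  "\<mu> \<preceq> \<theta> \<longleftrightarrow> (\<exists>\<nu>. (\<mu>, \<nu>) \<in> composable \<Lambda> \<and> \<theta> = cmp \<Lambda> \<mu> \<nu>)"

text \<open>For a morphism \<open>\<theta>\<close> and \<open>p \<le> deg \<Lambda> \<theta>\<close>
  unique factorization leaves no choice: \<open>ini \<theta> p\<close> and
  \<open>fin \<theta> p\<close> are the segments usually written \<theta>(0,p) and
  \<theta>(p,d(\<theta>)). Prescribing the first degree suffices, since additivity fixes the
  second.\<close>

definition factors :: "'a \<Rightarrow> (nat \<Rightarrow> nat) \<Rightarrow> 'a \<times> 'a" where
  "factors \<theta> p = (SOME w. w \<in> composable \<Lambda> \<and> \<theta> = cmp \<Lambda> (fst w) (snd w) \<and> deg \<Lambda> (fst w) = p)"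

definition ini :: "'a \<Rightarrow> (nat \<Rightarrow> nat) \<Rightarrow> 'a" where
  "ini \<theta> p = fst (factors \<theta> p)"

definition fin :: "'a \<Rightarrow> (nat \<Rightarrow> nat) \<Rightarrow> 'a" where
  "fin \<theta> p = snd (factors \<theta> p)"

lemma composableD:
  "(\<mu>, \<nu>) \<in> composable \<Lambda> \<Longrightarrow> \<mu> \<in> mor \<Lambda>" "(\<mu>, \<nu>) \<in> composable \<Lambda> \<Longrightarrow> \<nu> \<in> mor \<Lambda>"
  "(\<mu>, \<nu>) \<in> composable \<Lambda> \<Longrightarrow> src \<Lambda> \<mu> = rng \<Lambda> \<nu>"
  by (auto simp: composable_def)

lemma composableI: "\<mu> \<in> mor \<Lambda> \<Longrightarrow> \<nu> \<in> mor \<Lambda> \<Longrightarrow> src \<Lambda> \<mu> = rng \<Lambda> \<nu> \<Longrightarrow> (\<mu>, \<nu>) \<in> composable \<Lambda>"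
  by (auto simp: composable_def)

lemma factors_exist:
  assumes "\<theta> \<in> mor \<Lambda>" "p \<le> deg \<Lambda> \<theta>"
  shows "\<exists>w. w \<in> composable \<Lambda> \<and> \<theta> = cmp \<Lambda> (fst w) (snd w) \<and> deg \<Lambda> (fst w) = p"
proof -
  have "p \<in> Nk k" "deg \<Lambda> \<theta> - p \<in> Nk k"
    using assms deg_in Nk_le Nk_diff by blast+
  from ex1_implies_ex[OF unique_factorization[OF assms(1) this]] obtain \<xi> \<eta>
    where "(\<xi>, \<eta>) \<in> composable \<Lambda>" "\<theta> = cmp \<Lambda> \<xi> \<eta>" "deg \<Lambda> \<xi> = p"
    using assms(2) by auto
  then show ?thesis
    by (intro exI[of _ "(\<xi>, \<eta>)"]) simp
qed

lemma factors_cmp: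
  assumes "(\<mu>, \<nu>) \<in> composable \<Lambda>"
  shows "factors (cmp \<Lambda> \<mu> \<nu>) (deg \<Lambda> \<mu>) = (\<mu>, \<nu>)"
proof -
  let ?P = "\<lambda>w. w \<in> composable \<Lambda> \<and> cmp \<Lambda> \<mu> \<nu> = cmp \<Lambda> (fst w) (snd w) \<and> deg \<Lambda> (fst w) = deg \<Lambda> \<mu>"
  have "?P w \<Longrightarrow> w = (\<mu>, \<nu>)" for w
  proof -
    assume w: "?P w"
    obtain \<alpha> \<beta> where [simp]: "w = (\<alpha>, \<beta>)" by fastforce
    have "deg \<Lambda> \<alpha> + deg \<Lambda> \<beta> = deg \<Lambda> \<mu> + deg \<Lambda> \<nu>"
      using w assms deg_cmp by (metis \<open>w = (\<alpha>, \<beta>)\<close> fst_conv snd_conv)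
    then have \<beta>: "deg \<Lambda> \<beta> = deg \<Lambda> \<nu>"
      using w by simp
    have "\<exists>!(\<xi>, \<eta>). (\<xi>, \<eta>) \<in> composable \<Lambda> \<and> cmp \<Lambda> \<mu> \<nu> = cmp \<Lambda> \<xi> \<eta> \<and> deg \<Lambda> \<xi> = deg \<Lambda> \<mu> \<and>
        deg \<Lambda> \<eta> = deg \<Lambda> \<nu>"
      using assms deg_in by (intro unique_factorization) (auto simp: deg_cmp cmp_mor dest: composableD)
    then show ?thesis
      using w \<beta> assms unfolding case_prod_unfold by (metis (no_types, lifting) \<open>w = (\<alpha>, \<beta>)\<close> fst_conv snd_conv)
  qed
  then show ?thesis
    unfolding factors_def using assms by (intro some_equality) auto
qed

lemma ini_cmp [simp]: "(\<mu>, \<nu>) \<in> composable \<Lambda> \<Longrightarrow> ini (cmp \<Lambda> \<mu> \<nu>) (deg \<Lambda> \<mu>) = \<mu>"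
  and fin_cmp [simp]: "(\<mu>, \<nu>) \<in> composable \<Lambda> \<Longrightarrow> fin (cmp \<Lambda> \<mu> \<nu>) (deg \<Lambda> \<mu>) = \<nu>"
  by (auto simp: ini_def fin_def factors_cmp)

lemma
  assumes "\<theta> \<in> mor \<Lambda>" "p \<le> deg \<Lambda> \<theta>"
  shows ini_fin_composable: "(ini \<theta> p, fin \<theta> p) \<in> composable \<Lambda>"
    and cmp_ini_fin: "cmp \<Lambda> (ini \<theta> p) (fin \<theta> p) = \<theta>"
    and deg_ini: "deg \<Lambda> (ini \<theta> p) = p"
    and ini_mor: "ini \<theta> p \<in> mor \<Lambda>"
    and fin_mor: "fin \<theta> p \<in> mor \<Lambda>"
    and deg_fin: "deg \<Lambda> (fin \<theta> p) = deg \<Lambda> \<theta> - p"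
    and src_fin: "src \<Lambda> (fin \<theta> p) = src \<Lambda> \<theta>"
proof -
  from someI_ex[OF factors_exist[OF assms]]
  have *: "(ini \<theta> p, fin \<theta> p) \<in> composable \<Lambda>" "\<theta> = cmp \<Lambda> (ini \<theta> p) (fin \<theta> p)" "deg \<Lambda> (ini \<theta> p) = p"
    unfolding ini_def fin_def factors_def[symmetric] by auto
  then show "(ini \<theta> p, fin \<theta> p) \<in> composable \<Lambda>" "cmp \<Lambda> (ini \<theta> p) (fin \<theta> p) = \<theta>"
    "deg \<Lambda> (ini \<theta> p) = p" "ini \<theta> p \<in> mor \<Lambda>" "fin \<theta> p \<in> mor \<Lambda>"
    by (auto dest: composableD)
  have "deg \<Lambda> \<theta> = p + deg \<Lambda> (fin \<theta> p)"
    using *(1,3) deg_cmp[OF *(1)] *(2)[symmetric] by simp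
  then show "deg \<Lambda> (fin \<theta> p) = deg \<Lambda> \<theta> - p"
    by simp
  show "src \<Lambda> (fin \<theta> p) = src \<Lambda> \<theta>"
    using src_cmp[OF *(1)] *(2)[symmetric] by simp
qed

lemma cmp_cancel_left:
  assumes "(\<kappa>, \<mu>) \<in> composable \<Lambda>" "(\<kappa>, \<nu>) \<in> composable \<Lambda>" "cmp \<Lambda> \<kappa> \<mu> = cmp \<Lambda> \<kappa> \<nu>"
  shows "\<mu> = \<nu>"
  using assms by (metis fin_cmp)

lemma pre_mor: "\<mu> \<preceq> \<theta> \<Longrightarrow> \<mu> \<in> mor \<Lambda>" "\<mu> \<preceq> \<theta> \<Longrightarrow> \<theta> \<in> mor \<Lambda>"
  by (auto simp: pre_def cmp_mor dest: composableD)

lemma pre_rng: "\<mu> \<preceq> \<theta> \<Longrightarrow> rng \<Lambda> \<mu> = rng \<Lambda> \<theta>"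
  by (auto simp: pre_def rng_cmp)

lemma pre_deg: "\<mu> \<preceq> \<theta> \<Longrightarrow> deg \<Lambda> \<mu> \<le> deg \<Lambda> \<theta>"
  by (auto simp: pre_def deg_cmp)

lemma pre_cmp: "(\<mu>, \<nu>) \<in> composable \<Lambda> \<Longrightarrow> \<mu> \<preceq> cmp \<Lambda> \<mu> \<nu>"
  by (auto simp: pre_def)

lemma ini_pre: "\<theta> \<in> mor \<Lambda> \<Longrightarrow> p \<le> deg \<Lambda> \<theta> \<Longrightarrow> ini \<theta> p \<preceq> \<theta>"
  unfolding pre_def using ini_fin_composable cmp_ini_fin by metis

lemma pre_ini: "\<mu> \<preceq> \<theta> \<Longrightarrow> ini \<theta> (deg \<Lambda> \<mu>) = \<mu>"
  by (auto simp: pre_def)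

lemma pre_refl: "\<mu> \<in> mor \<Lambda> \<Longrightarrow> \<mu> \<preceq> \<mu>"
  unfolding pre_def by (metis composableI id_right obj_subset rng_id src_obj subsetD)

lemma rng_pre: "\<mu> \<in> mor \<Lambda> \<Longrightarrow> rng \<Lambda> \<mu> \<preceq> \<mu>"
  unfolding pre_def by (metis composableI id_left obj_subset src_id rng_obj subsetD)

lemma cmp_composable:
  "(\<mu>, \<nu>) \<in> composable \<Lambda> \<Longrightarrow> (\<nu>, \<xi>) \<in> composable \<Lambda> \<Longrightarrow> (cmp \<Lambda> \<mu> \<nu>, \<xi>) \<in> composable \<Lambda>"
  "(\<mu>, \<nu>) \<in> composable \<Lambda> \<Longrightarrow> (\<nu>, \<xi>) \<in> composable \<Lambda> \<Longrightarrow> (\<mu>, cmp \<Lambda> \<nu> \<xi>) \<in> composable \<Lambda>"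
  "(\<mu>, \<nu>) \<in> composable \<Lambda> \<Longrightarrow> (cmp \<Lambda> \<mu> \<nu>, \<xi>) \<in> composable \<Lambda> \<Longrightarrow> (\<nu>, \<xi>) \<in> composable \<Lambda>"
  "(\<nu>, \<xi>) \<in> composable \<Lambda> \<Longrightarrow> (\<mu>, cmp \<Lambda> \<nu> \<xi>) \<in> composable \<Lambda> \<Longrightarrow> (\<mu>, \<nu>) \<in> composable \<Lambda>"
  using cmp_mor rng_cmp src_cmp by (auto simp: composable_def)

lemma pre_trans:
  assumes "\<mu> \<preceq> \<nu>" "\<nu> \<preceq> \<theta>"
  shows "\<mu> \<preceq> \<theta>"
proof -
  obtain \<alpha> \<beta> where "(\<mu>, \<alpha>) \<in> composable \<Lambda>" "\<nu> = cmp \<Lambda> \<mu> \<alpha>" "(\<nu>, \<beta>) \<in> composable \<Lambda>" "\<theta> = cmp \<Lambda> \<nu> \<beta>"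
    using assms unfolding pre_def by blast
  then show ?thesis
    unfolding pre_def by (metis cmp_assoc cmp_composable(2,3))
qed

lemma ini_ini: "\<theta> \<in> mor \<Lambda> \<Longrightarrow> p \<le> q \<Longrightarrow> q \<le> deg \<Lambda> \<theta> \<Longrightarrow> ini (ini \<theta> q) p = ini \<theta> p"
  using pre_ini[OF pre_trans[OF ini_pre ini_pre], of \<theta> q p] ini_mor deg_ini by simp

text \<open>Both are cuts of \<open>\<theta>\<close>, and cutting \<open>\<theta>\<close> first at
  the larger and then at the smaller degree gives the smaller cut. So initial segments of one
  morphism compare exactly as their degrees do.\<close>

lemma pre_linear: "\<mu> \<preceq> \<theta> \<Longrightarrow> \<nu> \<preceq> \<theta> \<Longrightarrow> deg \<Lambda> \<mu> \<le> deg \<Lambda> \<nu> \<Longrightarrow> \<mu> \<preceq> \<nu>"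
  by (metis ini_ini ini_pre pre_deg pre_ini pre_mor)

lemma pre_eq: "\<mu> \<preceq> \<theta> \<Longrightarrow> \<nu> \<preceq> \<theta> \<Longrightarrow> deg \<Lambda> \<mu> = deg \<Lambda> \<nu> \<Longrightarrow> \<mu> = \<nu>"
  by (metis pre_ini)

lemma pre_cmp_iff:
  assumes "(\<kappa>, \<mu>) \<in> composable \<Lambda>" "(\<kappa>, \<nu>) \<in> composable \<Lambda>"
  shows "cmp \<Lambda> \<kappa> \<mu> \<preceq> cmp \<Lambda> \<kappa> \<nu> \<longleftrightarrow> \<mu> \<preceq> \<nu>"
proof
  assume "cmp \<Lambda> \<kappa> \<mu> \<preceq> cmp \<Lambda> \<kappa> \<nu>"
  then obtain \<alpha> where \<alpha>: "(cmp \<Lambda> \<kappa> \<mu>, \<alpha>) \<in> composable \<Lambda>" "cmp \<Lambda> \<kappa> \<nu> = cmp \<Lambda> (cmp \<Lambda> \<kappa> \<mu>) \<alpha>"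
    unfolding pre_def by blast
  then show "\<mu> \<preceq> \<nu>"
    unfolding pre_def
    by (metis assms cmp_assoc cmp_cancel_left cmp_composable(2,3))
next
  assume "\<mu> \<preceq> \<nu>"
  then show "cmp \<Lambda> \<kappa> \<mu> \<preceq> cmp \<Lambda> \<kappa> \<nu>"
    unfolding pre_def by (metis assms(1) cmp_assoc cmp_composable(1))
qed

text \<open>Any common extension can be cut at the join of the two degrees. Exhaustiveness thereby
  becomes a statement about \<open>\<preceq>\<close> alone.\<close>

lemma min_ext_nonempty_iff:
  "min_ext \<Lambda> \<mu> \<nu> \<noteq> {} \<longleftrightarrow> (\<exists>\<theta>. \<mu> \<preceq> \<theta> \<and> \<nu> \<preceq> \<theta>)"
proof
  assume "min_ext \<Lambda> \<mu> \<nu> \<noteq> {}"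
  then show "\<exists>\<theta>. \<mu> \<preceq> \<theta> \<and> \<nu> \<preceq> \<theta>"
    unfolding min_ext_def pre_def by fastforce
next
  assume "\<exists>\<theta>. \<mu> \<preceq> \<theta> \<and> \<nu> \<preceq> \<theta>"
  then obtain \<theta> where \<theta>: "\<mu> \<preceq> \<theta>" "\<nu> \<preceq> \<theta>" by blast
  let ?\<theta> = "ini \<theta> (sup (deg \<Lambda> \<mu>) (deg \<Lambda> \<nu>))"
  have s: "sup (deg \<Lambda> \<mu>) (deg \<Lambda> \<nu>) \<le> deg \<Lambda> \<theta>"
    using \<theta> pre_deg by simp
  then have "\<mu> \<preceq> ?\<theta>" "\<nu> \<preceq> ?\<theta>" "deg \<Lambda> ?\<theta> = sup (deg \<Lambda> \<mu>) (deg \<Lambda> \<nu>)"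
    using \<theta> pre_mor[OF \<theta>(1)] by (auto intro!: pre_linear[of _ \<theta>] ini_pre simp: deg_ini)
  then obtain \<alpha> \<beta> where "(\<alpha>, \<beta>) \<in> min_ext \<Lambda> \<mu> \<nu>"
    unfolding min_ext_def pre_def by (smt (verit) case_prodI mem_Collect_eq)
  then show "min_ext \<Lambda> \<mu> \<nu> \<noteq> {}"
    by blast
qed


section \<open>Topology of the morphism space\<close>

lemma topspace_mor [simp]: "topspace (mor_top \<Lambda>) = mor \<Lambda>"
  and topspace_obj [simp]: "topspace (obj_top \<Lambda>) = obj \<Lambda>"
  by (auto simp: mor_def obj_def)

lemma openin_deg: "openin (mor_top \<Lambda>) {\<theta> \<in> mor \<Lambda>. P (deg \<Lambda> \<theta>)}"
proof -
  have "openin (mor_top \<Lambda>) {\<theta> \<in> topspace (mor_top \<Lambda>). deg \<Lambda> \<theta> \<in> {p \<in> Nk k. P p}}"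
    by (intro openin_continuous_map_preimage[OF continuous_deg]) auto
  moreover have "{\<theta> \<in> topspace (mor_top \<Lambda>). deg \<Lambda> \<theta> \<in> {p \<in> Nk k. P p}} = {\<theta> \<in> mor \<Lambda>. P (deg \<Lambda> \<theta>)}"
    using deg_in by auto
  ultimately show ?thesis
    by simp
qed

lemma openin_mor_of_deg: "openin (mor_top \<Lambda>) (mor_of_deg \<Lambda> p)"
  unfolding mor_of_deg_def using openin_deg[of "\<lambda>q. q = p"] .

lemma closedin_mor_of_deg: "closedin (mor_top \<Lambda>) (mor_of_deg \<Lambda> p)"
proof -
  have "mor \<Lambda> - mor_of_deg \<Lambda> p = {\<theta> \<in> mor \<Lambda>. deg \<Lambda> \<theta> \<noteq> p}"
    by (auto simp: mor_of_deg_def)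
  then show ?thesis
    using openin_deg[of "\<lambda>q. q \<noteq> p"] by (auto simp: closedin_def mor_of_deg_def)
qed

lemma compactin_mor_of_deg_Int:
  "compactin (mor_top \<Lambda>) E \<Longrightarrow> compactin (mor_top \<Lambda>) (E \<inter> mor_of_deg \<Lambda> p)"
  by (simp add: closedin_mor_of_deg compact_Int_closedin)

text \<open>Degrees form a discrete space. This reduces compact sets of mixed degrees to finitely
  many pieces of a single degree, the only ones that compact alignment speaks about.\<close>

lemma finite_deg_image:
  assumes "compactin (mor_top \<Lambda>) E"
  shows "finite (deg \<Lambda> ` E)"
  using image_compactin[OF assms continuous_deg] by (simp add: compactin_discrete_topology)

lemma openin_cmp_image:
  assumes "openin (mor_top \<Lambda>) U" "openin (mor_top \<Lambda>) V"
  shows "openin (mor_top \<Lambda>) (set_cmp \<Lambda> U V)"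
proof -
  have "openin (subtopology (prod_topology (mor_top \<Lambda>) (mor_top \<Lambda>)) (composable \<Lambda>)) (composable \<Lambda> \<inter> U \<times> V)"
    using assms by (auto intro!: openin_subtopology_Int2 simp: openin_prod_Times_iff)
  then have "openin (mor_top \<Lambda>) ((\<lambda>(\<mu>, \<nu>). cmp \<Lambda> \<mu> \<nu>) ` (composable \<Lambda> \<inter> U \<times> V))"
    using open_cmp by (auto simp: open_map_def)
  moreover have "(\<lambda>(\<mu>, \<nu>). cmp \<Lambda> \<mu> \<nu>) ` (composable \<Lambda> \<inter> U \<times> V) = set_cmp \<Lambda> U V"
    by (force simp: set_cmp_def)
  ultimately show ?thesis
    by simp
qed

lemma set_cmp_mor: "U \<subseteq> mor \<Lambda> \<Longrightarrow> set_cmp \<Lambda> U (mor \<Lambda>) = {\<theta>. \<exists>\<mu>\<in>U. \<mu> \<preceq> \<theta>}"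
  by (auto simp: set_cmp_def pre_def dest: composableD)

lemma openin_extensions:
  assumes "openin (mor_top \<Lambda>) U"
  shows "openin (mor_top \<Lambda>) {\<theta>. \<exists>\<mu>\<in>U. \<mu> \<preceq> \<theta>}"
  using openin_cmp_image[OF assms, of "mor \<Lambda>"] set_cmp_mor[of U] openin_subset[OF assms]
  by (metis openin_topspace topspace_mor)

text \<open>Continuity of factorization comes from openness of composition: the morphisms with first
  factor in \<open>U\<close> and second in \<open>V\<close> are the products of \<open>U\<close>
  restricted to degree \<open>p\<close> with \<open>V\<close>, an open set.\<close>

lemma
  shows continuous_ini:
      "continuous_map (subtopology (mor_top \<Lambda>) {\<theta> \<in> mor \<Lambda>. p \<le> deg \<Lambda> \<theta>}) (mor_top \<Lambda>) (\<lambda>\<theta>. ini \<theta> p)"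
      (is ?ini)
    and continuous_fin:
      "continuous_map (subtopology (mor_top \<Lambda>) {\<theta> \<in> mor \<Lambda>. p \<le> deg \<Lambda> \<theta>}) (mor_top \<Lambda>) (\<lambda>\<theta>. fin \<theta> p)"
      (is ?fin)
proof -
  let ?D = "{\<theta> \<in> mor \<Lambda>. p \<le> deg \<Lambda> \<theta>}"
  have top: "topspace (subtopology (mor_top \<Lambda>) ?D) = ?D"
    by auto
  have eq: "set_cmp \<Lambda> (U \<inter> mor_of_deg \<Lambda> p) V = {\<theta> \<in> ?D. ini \<theta> p \<in> U \<and> fin \<theta> p \<in> V}"
    if "U \<subseteq> mor \<Lambda>" "V \<subseteq> mor \<Lambda>" for U V
  proof (intro equalityI subsetI)
    fix \<theta> assume "\<theta> \<in> {\<theta> \<in> ?D. ini \<theta> p \<in> U \<and> fin \<theta> p \<in> V}"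
    then have "\<theta> = cmp \<Lambda> (ini \<theta> p) (fin \<theta> p)" "ini \<theta> p \<in> U \<inter> mor_of_deg \<Lambda> p" "fin \<theta> p \<in> V"
      "(ini \<theta> p, fin \<theta> p) \<in> composable \<Lambda>"
      by (auto simp: cmp_ini_fin ini_fin_composable deg_ini ini_mor mor_of_deg_def)
    then show "\<theta> \<in> set_cmp \<Lambda> (U \<inter> mor_of_deg \<Lambda> p) V"
      unfolding set_cmp_def by blast
  next
    fix \<theta> assume "\<theta> \<in> set_cmp \<Lambda> (U \<inter> mor_of_deg \<Lambda> p) V"
    then obtain \<mu> \<nu> where "(\<mu>, \<nu>) \<in> composable \<Lambda>" "\<theta> = cmp \<Lambda> \<mu> \<nu>" "\<mu> \<in> U" "\<nu> \<in> V" "deg \<Lambda> \<mu> = p"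
      by (auto simp: set_cmp_def mor_of_deg_def)
    then show "\<theta> \<in> {\<theta> \<in> ?D. ini \<theta> p \<in> U \<and> fin \<theta> p \<in> V}"
      by (auto simp: cmp_mor deg_cmp)
  qed
  have open': "openin (subtopology (mor_top \<Lambda>) ?D) {\<theta> \<in> ?D. ini \<theta> p \<in> U \<and> fin \<theta> p \<in> V}"
    if "openin (mor_top \<Lambda>) U" "openin (mor_top \<Lambda>) V" for U V
  proof -
    have UV: "U \<subseteq> mor \<Lambda>" "V \<subseteq> mor \<Lambda>"
      using that openin_subset by fastforce+
    have "openin (mor_top \<Lambda>) {\<theta> \<in> ?D. ini \<theta> p \<in> U \<and> fin \<theta> p \<in> V}"
      unfolding eq[OF UV, symmetric] using that openin_mor_of_deg by (intro openin_cmp_image openin_Int)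
    moreover have "openin (mor_top \<Lambda>) ?D"
      by (rule openin_deg)
    ultimately show ?thesis
      by (auto simp: openin_open_subtopology)
  qed
  have mor': "openin (mor_top \<Lambda>) (mor \<Lambda>)"
    by (metis openin_topspace topspace_mor)
  show ?ini
    unfolding continuous_map top
  proof (intro conjI allI impI)
    fix U assume "openin (mor_top \<Lambda>) U"
    then show "openin (subtopology (mor_top \<Lambda>) ?D) {\<theta> \<in> ?D. ini \<theta> p \<in> U}"
      using open'[OF _ mor', of U] fin_mor by (simp add: conj_commute cong: conj_cong)
  qed (auto simp: ini_mor)
  show ?fin
    unfolding continuous_map top
  proof (intro conjI allI impI)
    fix U assume "openin (mor_top \<Lambda>) U"
    then show "openin (subtopology (mor_top \<Lambda>) ?D) {\<theta> \<in> ?D. fin \<theta> p \<in> U}"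
      using open'[OF mor', of U] ini_mor by (simp cong: conj_cong)
  qed (auto simp: fin_mor)
qed

lemma
  assumes "compactin (mor_top \<Lambda>) E" "\<And>\<theta>. \<theta> \<in> E \<Longrightarrow> p \<le> deg \<Lambda> \<theta>"
  shows compactin_ini_image: "compactin (mor_top \<Lambda>) ((\<lambda>\<theta>. ini \<theta> p) ` E)"
    and compactin_fin_image: "compactin (mor_top \<Lambda>) ((\<lambda>\<theta>. fin \<theta> p) ` E)"
proof -
  have "compactin (subtopology (mor_top \<Lambda>) {\<theta> \<in> mor \<Lambda>. p \<le> deg \<Lambda> \<theta>}) E"
    using assms compactin_subset_topspace by (fastforce simp: compactin_subtopology)
  then show "compactin (mor_top \<Lambda>) ((\<lambda>\<theta>. ini \<theta> p) ` E)" "compactin (mor_top \<Lambda>) ((\<lambda>\<theta>. fin \<theta> p) ` E)"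
    using image_compactin continuous_ini continuous_fin by blast+
qed

text \<open>The composable pairs are closed because the object space is Hausdorff, so those with
  first entry \<open>\<kappa>\<close> and second entry in \<open>E\<close> form a compact set, and
  composition is continuous on it.\<close>

lemma compactin_cmp_image:
  assumes "\<kappa> \<in> mor \<Lambda>" "compactin (mor_top \<Lambda>) E"
  shows "compactin (mor_top \<Lambda>) (set_cmp \<Lambda> {\<kappa>} E)"
proof -
  let ?T = "prod_topology (mor_top \<Lambda>) (mor_top \<Lambda>)"
  have E: "E \<subseteq> mor \<Lambda>"
    using assms(2) compactin_subset_topspace by fastforce
  have "closedin ?T {w \<in> topspace ?T. (src \<Lambda> \<circ> fst) w = (rng \<Lambda> \<circ> snd) w}"
    by (intro closedin_continuous_maps_eq[OF Hausdorff_obj]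
        continuous_map_compose[OF continuous_map_fst continuous_src]
        continuous_map_compose[OF continuous_map_snd continuous_rng])
  moreover have "{w \<in> topspace ?T. (src \<Lambda> \<circ> fst) w = (rng \<Lambda> \<circ> snd) w} = composable \<Lambda>"
    by (auto simp: composable_def)
  moreover have "compactin ?T ({\<kappa>} \<times> E)"
    using assms by (simp add: compactin_Times)
  ultimately have "compactin (subtopology ?T (composable \<Lambda>)) (composable \<Lambda> \<inter> {\<kappa>} \<times> E)"
    by (simp add: closed_Int_compactin compactin_subtopology)
  from image_compactin[OF this continuous_cmp] show ?thesis
    by (rule back_subst[of "compactin _"]) (force simp: set_cmp_def)
qed

lemma compact_neighbourhood:
  assumes "openin (mor_top \<Lambda>) U" "\<mu> \<in> U"
  obtains N K where "openin (mor_top \<Lambda>) N" "compactin (mor_top \<Lambda>) K" "\<mu> \<in> N" "N \<subseteq> K" "K \<subseteq> U"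
  using locally_compact_mor locally_compact_space_neighbourhood_base[of "mor_top \<Lambda>"] Hausdorff_mor assms
  unfolding neighbourhood_base_of by blast

lemma compact_neighbourhood_obj:
  assumes "openin (obj_top \<Lambda>) U" "v \<in> U"
  obtains N K where "openin (obj_top \<Lambda>) N" "compactin (obj_top \<Lambda>) K" "v \<in> N" "N \<subseteq> K" "K \<subseteq> U"
  using locally_compact_obj locally_compact_space_neighbourhood_base[of "obj_top \<Lambda>"] Hausdorff_obj assms
  unfolding neighbourhood_base_of by blast

text \<open>Inside such a neighbourhood a morphism can be recovered from its source, that is, from
  the vertex at which a path continues after it.\<close>

lemma src_locally_injective:
  assumes "\<mu> \<in> mor \<Lambda>"
  obtains U where "openin (mor_top \<Lambda>) U" "\<mu> \<in> U" "inj_on (src \<Lambda>) U"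
    "\<And>N. openin (mor_top \<Lambda>) N \<Longrightarrow> N \<subseteq> U \<Longrightarrow> openin (obj_top \<Lambda>) (src \<Lambda> ` N)"
proof -
  obtain U where U: "openin (mor_top \<Lambda>) U" "\<mu> \<in> U" "openin (obj_top \<Lambda>) (src \<Lambda> ` U)"
    "homeomorphic_map (subtopology (mor_top \<Lambda>) U) (subtopology (obj_top \<Lambda>) (src \<Lambda> ` U)) (src \<Lambda>)"
    using local_homeo_src assms unfolding local_homeomorphism_def by auto
  have "U \<subseteq> mor \<Lambda>"
    using openin_subset[OF U(1)] by simp
  then have "inj_on (src \<Lambda>) U"
    using homeomorphic_imp_injective_map[OF U(4)] by (simp add: Int_absorb1)
  moreover have "openin (obj_top \<Lambda>) (src \<Lambda> ` N)" if N: "openin (mor_top \<Lambda>) N" "N \<subseteq> U" for N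
  proof -
    have "openin (subtopology (mor_top \<Lambda>) U) N"
      using N U(1) by (simp add: openin_open_subtopology)
    then have "openin (subtopology (obj_top \<Lambda>) (src \<Lambda> ` U)) (src \<Lambda> ` N)"
      using homeomorphic_imp_open_map[OF U(4)] by (simp add: open_map_def)
    then show ?thesis
      using U(3) by (simp add: openin_open_subtopology)
  qed
  ultimately show thesis
    using that U by blast
qed

lemma open_src:
  assumes "openin (mor_top \<Lambda>) U"
  shows "openin (obj_top \<Lambda>) (src \<Lambda> ` U)"
proof (subst openin_subopen, intro ballI)
  fix v assume "v \<in> src \<Lambda> ` U"
  then obtain \<mu> where \<mu>: "\<mu> \<in> U" "v = src \<Lambda> \<mu>"
    by blast
  have "\<mu> \<in> mor \<Lambda>"
    using \<mu> openin_subset[OF assms] by auto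
  then obtain N where N: "openin (mor_top \<Lambda>) N" "\<mu> \<in> N"
    "\<And>M. openin (mor_top \<Lambda>) M \<Longrightarrow> M \<subseteq> N \<Longrightarrow> openin (obj_top \<Lambda>) (src \<Lambda> ` M)"
    using src_locally_injective[OF \<open>\<mu> \<in> mor \<Lambda>\<close>] by metis
  then show "\<exists>T. openin (obj_top \<Lambda>) T \<and> v \<in> T \<and> T \<subseteq> src \<Lambda> ` U"
    using assms \<mu> by (intro exI[of _ "src \<Lambda> ` (N \<inter> U)"]) auto
qed

lemma openin_rng_preimage:
  "openin (obj_top \<Lambda>) V \<Longrightarrow> openin (mor_top \<Lambda>) {\<mu> \<in> mor \<Lambda>. rng \<Lambda> \<mu> \<in> V}"
  using openin_continuous_map_preimage[OF continuous_rng] by simp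


section \<open>Minimal common extensions\<close>

text \<open>When \<open>K\<close> and \<open>F\<close> have one degree each, this is the set
  \<open>K \<or> F\<close> of compact alignment; here degrees may vary within both sets.\<close>

definition mce :: "'a set \<Rightarrow> 'a set \<Rightarrow> 'a set" where
  "mce K F = {\<theta>. \<exists>\<kappa>\<in>K. \<exists>\<phi>\<in>F. \<kappa> \<preceq> \<theta> \<and> \<phi> \<preceq> \<theta> \<and> deg \<Lambda> \<theta> = sup (deg \<Lambda> \<kappa>) (deg \<Lambda> \<phi>)}"

lemma ini_in_mce:
  assumes "\<kappa> \<in> K" "\<phi> \<in> F" "\<kappa> \<preceq> \<theta>" "\<phi> \<preceq> \<theta>"
  obtains \<xi> where "\<xi> \<in> mce K F" "\<kappa> \<preceq> \<xi>" "\<phi> \<preceq> \<xi>" "\<xi> \<preceq> \<theta>"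
proof -
  let ?p = "sup (deg \<Lambda> \<kappa>) (deg \<Lambda> \<phi>)"
  have \<theta>: "\<theta> \<in> mor \<Lambda>" "?p \<le> deg \<Lambda> \<theta>"
    using assms pre_mor pre_deg by (auto intro: le_supI)
  then have "ini \<theta> ?p \<preceq> \<theta>" "deg \<Lambda> (ini \<theta> ?p) = ?p"
    by (simp_all add: ini_pre deg_ini)
  moreover have "\<kappa> \<preceq> ini \<theta> ?p" "\<phi> \<preceq> ini \<theta> ?p"
    using calculation assms by (auto intro: pre_linear)
  ultimately show thesis
    using that assms unfolding mce_def by blast
qed

text \<open>\<open>F\<close> has finitely many degrees, so the set is a finite union of the sets
  \<open>M q\<close>, each compact by compact alignment.\<close>

lemma compactin_mce:
  assumes "compactly_aligned k \<Lambda>" "p \<in> Nk k" "K \<subseteq> mor_of_deg \<Lambda> p"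
    and "compactin (mor_top \<Lambda>) K" "compactin (mor_top \<Lambda>) F"
  shows "compactin (mor_top \<Lambda>) (mce K F)"
proof -
  define M where "M q = set_cmp \<Lambda> K (mor_of_deg \<Lambda> (sup p q - p)) \<inter>
    set_cmp \<Lambda> (F \<inter> mor_of_deg \<Lambda> q) (mor_of_deg \<Lambda> (sup p q - q))" for q
  have F: "F \<subseteq> mor \<Lambda>"
    using assms(5) compactin_subset_topspace by fastforce
  have cmp': "\<theta> \<in> set_cmp \<Lambda> A (mor_of_deg \<Lambda> (s - q)) \<longleftrightarrow> (\<exists>\<kappa>\<in>A. \<kappa> \<preceq> \<theta> \<and> deg \<Lambda> \<theta> = s)"
    if "A \<subseteq> mor_of_deg \<Lambda> q" "q \<le> s" for \<theta> A q s
  proof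
    assume "\<theta> \<in> set_cmp \<Lambda> A (mor_of_deg \<Lambda> (s - q))"
    then show "\<exists>\<kappa>\<in>A. \<kappa> \<preceq> \<theta> \<and> deg \<Lambda> \<theta> = s"
      using that by (force simp: set_cmp_def mor_of_deg_def pre_def deg_cmp)
  next
    assume "\<exists>\<kappa>\<in>A. \<kappa> \<preceq> \<theta> \<and> deg \<Lambda> \<theta> = s"
    then obtain \<kappa> \<nu> where \<kappa>: "\<kappa> \<in> A" "(\<kappa>, \<nu>) \<in> composable \<Lambda>" "\<theta> = cmp \<Lambda> \<kappa> \<nu>" "deg \<Lambda> \<theta> = s"
      by (auto simp: pre_def)
    moreover have "deg \<Lambda> \<kappa> = q"
      using \<kappa> that by (auto simp: mor_of_deg_def)
    ultimately have "deg \<Lambda> \<nu> = s - q"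
      using deg_cmp[of \<kappa> \<nu>] by auto
    then have "\<nu> \<in> mor_of_deg \<Lambda> (s - q)"
      using \<kappa>(2) composableD(2) by (simp add: mor_of_deg_def)
    then show "\<theta> \<in> set_cmp \<Lambda> A (mor_of_deg \<Lambda> (s - q))"
      using \<kappa> unfolding set_cmp_def by blast
  qed
  have mem: "\<theta> \<in> M q \<longleftrightarrow> (\<exists>\<kappa>\<in>K. \<exists>\<phi>\<in>F. \<kappa> \<preceq> \<theta> \<and> \<phi> \<preceq> \<theta> \<and> deg \<Lambda> \<phi> = q \<and> deg \<Lambda> \<theta> = sup p q)" for \<theta> q
    unfolding M_def Int_iff cmp'[OF assms(3) sup_ge1] cmp'[OF Int_lower2 sup_ge2]
    using F by (auto simp: mor_of_deg_def)
  have "mce K F = (\<Union>q\<in>deg \<Lambda> ` F. M q)"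
    using assms(3) by (force simp: mce_def mem mor_of_deg_def)
  moreover have "compactin (mor_top \<Lambda>) (M q)" if "q \<in> deg \<Lambda> ` F" for q
  proof -
    have "q \<in> Nk k"
      using that F deg_in by auto
    then show ?thesis
      using assms unfolding M_def compactly_aligned_def
      by (metis (no_types, lifting) compactin_mor_of_deg_Int inf_le2)
  qed
  moreover have "finite (M ` deg \<Lambda> ` F)"
    using finite_deg_image[OF assms(5)] by blast
  ultimately show ?thesis
    using compactin_Union[of "M ` deg \<Lambda> ` F"] by (metis (no_types, lifting) imageE)
qed


section \<open>Paths and their initial segments\<close>

text \<open>The topologies on the domain are discrete, so continuity amounts to landing in the right
  set, and a functor is described by its segments \<open>seg x p q\<close> alone.\<close>

lemma path_space_iff:
  "x \<in> path_space k \<Lambda> \<longleftrightarrow> pdeg x \<in> NInfk k \<and> snd x \<in> extensional (mor (Omega k (pdeg x))) \<and>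
    (\<forall>p q. p \<le> q \<and> edeg q \<le> pdeg x \<longrightarrow> seg x p q \<in> mor \<Lambda> \<and> deg \<Lambda> (seg x p q) = q - p \<and>
       rng \<Lambda> (seg x p q) = seg x p p \<and> src \<Lambda> (seg x p q) = seg x q q) \<and>
    (\<forall>p q r. p \<le> q \<and> q \<le> r \<and> edeg r \<le> pdeg x \<longrightarrow> seg x p r = cmp \<Lambda> (seg x p q) (seg x q r))"
    (is "_ \<longleftrightarrow> ?d \<and> ?e \<and> ?s \<and> ?c")
proof -
  let ?O = "Omega k (pdeg x)"
  have obj: "obj ?O = {(p, p) | p. p \<in> Nk k \<and> edeg p \<le> pdeg x}"
    and tops: "mor_top ?O = discrete_topology (mor ?O)" "obj_top ?O = discrete_topology (obj ?O)"
    by (auto simp: obj_def Omega_def mor_def)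
  have "graph_functor ?O \<Lambda> (snd x) \<longleftrightarrow> ?s \<and> ?c" if d: ?d
  proof -
    note iff = mor_Omega_iff[OF d]
    have comp: "((p, q), (q', r)) \<in> composable ?O \<longleftrightarrow> p \<le> q \<and> q' = q \<and> q \<le> r \<and> edeg r \<le> pdeg x" for p q q' r
      by (auto simp: composable_def iff intro: edeg_le_trans)
    have c: "(\<forall>(\<mu>, \<nu>)\<in>composable ?O. snd x (cmp ?O \<mu> \<nu>) = cmp \<Lambda> (snd x \<mu>) (snd x \<nu>)) \<longleftrightarrow> ?c"
    proof (intro iffI allI impI ballI)
      fix p q r
      assume *: "\<forall>(\<mu>, \<nu>)\<in>composable ?O. snd x (cmp ?O \<mu> \<nu>) = cmp \<Lambda> (snd x \<mu>) (snd x \<nu>)"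
        "p \<le> q \<and> q \<le> r \<and> edeg r \<le> pdeg x"
      then have "((p, q), (q, r)) \<in> composable ?O"
        by (simp add: comp)
      with *(1) show "seg x p r = cmp \<Lambda> (seg x p q) (seg x q r)"
        by (fastforce simp: seg_def)
    next
      fix w assume ?c and w: "w \<in> composable ?O"
      moreover obtain p q q' r where "w = ((p, q), (q', r))"
        by (metis surj_pair)
      ultimately show "case w of (\<mu>, \<nu>) \<Rightarrow> snd x (cmp ?O \<mu> \<nu>) = cmp \<Lambda> (snd x \<mu>) (snd x \<nu>)"
        by (simp add: comp seg_def)
    qed
    have "(snd x \<in> mor ?O \<rightarrow> mor \<Lambda> \<and> snd x \<in> obj ?O \<rightarrow> obj \<Lambda> \<and>
      (\<forall>\<mu>\<in>mor ?O. rng \<Lambda> (snd x \<mu>) = snd x (rng ?O \<mu>) \<and> src \<Lambda> (snd x \<mu>) = snd x (src ?O \<mu>) \<and>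
       deg \<Lambda> (snd x \<mu>) = deg ?O \<mu>)) \<longleftrightarrow> ?s" (is "?l \<longleftrightarrow> _")
    proof
      assume ?l
      then show ?s
        using iff by (fastforce simp: seg_def)
    next
      assume s: ?s
      \<comment> \<open>The segment from \<open>p\<close> to \<open>p\<close> equals its own range
        and is therefore an object.\<close>
      have "snd x (p, p) \<in> obj \<Lambda>" if "edeg p \<le> pdeg x" for p
        using s[rule_format, of p p] that rng_obj[of "seg x p p"] by (simp add: seg_def)
      then have "snd x \<in> obj ?O \<rightarrow> obj \<Lambda>"
        unfolding obj by auto
      moreover have "snd x \<in> mor ?O \<rightarrow> mor \<Lambda>"
        using s iff by (auto simp: seg_def)
      moreover have "rng \<Lambda> (snd x \<mu>) = snd x (rng ?O \<mu>) \<and> src \<Lambda> (snd x \<mu>) = snd x (src ?O \<mu>) \<and>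
         deg \<Lambda> (snd x \<mu>) = deg ?O \<mu>" if "\<mu> \<in> mor ?O" for \<mu>
        using that s iff by (cases \<mu>) (simp add: seg_def)
      ultimately show ?l
        by blast
    qed
    then show ?thesis
      using c by (auto simp: graph_functor_def tops)
  qed
  then show ?thesis
    by (cases x) (auto simp: path_space_def pdeg_def)
qed

lemma pdeg_NInfk: "x \<in> path_space k \<Lambda> \<Longrightarrow> pdeg x \<in> NInfk k"
  by (simp add: path_space_iff)

lemma
  assumes "x \<in> path_space k \<Lambda>" "p \<le> q" "edeg q \<le> pdeg x"
  shows seg_mor: "seg x p q \<in> mor \<Lambda>"
    and deg_seg: "deg \<Lambda> (seg x p q) = q - p"
    and rng_seg: "rng \<Lambda> (seg x p q) = seg x p p"
    and src_seg: "src \<Lambda> (seg x p q) = seg x q q"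
  using assms by (simp_all add: path_space_iff)

lemma
  assumes "x \<in> path_space k \<Lambda>" "p \<le> q" "q \<le> r" "edeg r \<le> pdeg x"
  shows seg_cmp: "cmp \<Lambda> (seg x p q) (seg x q r) = seg x p r"
    and seg_composable: "(seg x p q, seg x q r) \<in> composable \<Lambda>"
proof -
  have "edeg q \<le> pdeg x"
    using assms edeg_le_trans by blast
  then show "cmp \<Lambda> (seg x p q) (seg x q r) = seg x p r" "(seg x p q, seg x q r) \<in> composable \<Lambda>"
    using assms by (auto simp: path_space_iff intro!: composableI)
qed

lemma deg_seg0: "x \<in> path_space k \<Lambda> \<Longrightarrow> edeg q \<le> pdeg x \<Longrightarrow> deg \<Lambda> (seg x 0 q) = q"
  using deg_seg[of x 0 q] by (simp add: fun_eq_iff)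

lemma seg0_mor: "x \<in> path_space k \<Lambda> \<Longrightarrow> edeg q \<le> pdeg x \<Longrightarrow> seg x 0 q \<in> mor \<Lambda>"
  using seg_mor[of x 0 q] by simp

lemma seg0_pre: "x \<in> path_space k \<Lambda> \<Longrightarrow> p \<le> q \<Longrightarrow> edeg q \<le> pdeg x \<Longrightarrow> seg x 0 p \<preceq> seg x 0 q"
  using seg_cmp[of x 0 p q] seg_composable[of x 0 p q] by (metis fun_le_add(2) pre_def)

lemma seg_eq_fin:
  assumes "x \<in> path_space k \<Lambda>" "p \<le> q" "edeg q \<le> pdeg x"
  shows "seg x p q = fin (seg x 0 q) p"
proof -
  have "edeg p \<le> pdeg x"
    using assms edeg_le_trans by blast
  then show ?thesis
    using fin_cmp[OF seg_composable[OF assms(1) fun_le_add(2) assms(2,3)]]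
    by (simp only: seg_cmp[OF assms(1) fun_le_add(2) assms(2,3)] deg_seg0[OF assms(1)])
qed

text \<open>The segment from \<open>p\<close> to \<open>q\<close> is the tail of the one from
  \<open>0\<close> to \<open>q\<close>, so initial segments determine everything on the domain;
  extensionality settles the rest.\<close>

lemma path_eqI:
  assumes "x \<in> path_space k \<Lambda>" "y \<in> path_space k \<Lambda>" "pdeg x = pdeg y"
    and "\<And>q. edeg q \<le> pdeg x \<Longrightarrow> seg x 0 q = seg y 0 q"
  shows "x = y"
proof -
  have "snd x w = snd y w" if w0: "w \<in> mor (Omega k (pdeg x))" for w
  proof -
    obtain p q where w: "w = (p, q)" "p \<le> q" "edeg q \<le> pdeg x"
      using w0 unfolding mor_Omega by blast
    then have "seg x p q = seg y p q"
      using seg_eq_fin[OF assms(1), of p q] seg_eq_fin[OF assms(2), of p q] assms(3,4) by metis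
    then show ?thesis
      by (simp add: w(1) seg_def)
  qed
  moreover have "snd x \<in> extensional (mor (Omega k (pdeg x)))" "snd y \<in> extensional (mor (Omega k (pdeg x)))"
    using assms(1-3) by (auto simp: path_space_iff)
  ultimately have "snd x = snd y"
    by (meson extensionalityI)
  then show ?thesis
    using assms(3) by (simp add: pdeg_def prod_eq_iff)
qed

lemma fin_eqI: "(\<mu>, \<nu>) \<in> composable \<Lambda> \<Longrightarrow> cmp \<Lambda> \<mu> \<nu> = \<theta> \<Longrightarrow> deg \<Lambda> \<mu> = p \<Longrightarrow> fin \<theta> p = \<nu>"
  by auto

lemma fin_deg: "\<theta> \<in> mor \<Lambda> \<Longrightarrow> fin \<theta> (deg \<Lambda> \<theta>) = src \<Lambda> \<theta>"
  by (intro fin_eqI[of \<theta>] composableI id_right) (use obj_subset src_obj rng_id in auto)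

lemma fin_zero: "\<theta> \<in> mor \<Lambda> \<Longrightarrow> fin \<theta> 0 = \<theta>"
  by (intro fin_eqI[of "rng \<Lambda> \<theta>"] composableI id_left) (use obj_subset rng_obj src_id deg_id in auto)

lemma cmp_pre_fin: "\<mu> \<preceq> \<theta> \<Longrightarrow> cmp \<Lambda> \<mu> (fin \<theta> (deg \<Lambda> \<mu>)) = \<theta>"
  and pre_fin_composable: "\<mu> \<preceq> \<theta> \<Longrightarrow> (\<mu>, fin \<theta> (deg \<Lambda> \<mu>)) \<in> composable \<Lambda>"
  by (auto simp: pre_def)

text \<open>The segment from \<open>p\<close> to \<open>q\<close> is forced to be
  \<open>fin (h q) p\<close>, and uniqueness of factorization makes these tails compose
  correctly.\<close>

lemma path_of_initial_segments:
  assumes d: "d \<in> NInfk k"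
    and h: "\<And>q. edeg q \<le> d \<Longrightarrow> h q \<in> mor \<Lambda>" "\<And>q. edeg q \<le> d \<Longrightarrow> deg \<Lambda> (h q) = q"
    and pre: "\<And>p q. p \<le> q \<Longrightarrow> edeg q \<le> d \<Longrightarrow> h p \<preceq> h q"
  obtains x where "x \<in> path_space k \<Lambda>" "pdeg x = d" "\<And>q. edeg q \<le> d \<Longrightarrow> seg x 0 q = h q"
proof -
  define x :: "'a kpath" where "x = (d, restrict (\<lambda>(p, q). fin (h q) p) (mor (Omega k d)))"
  have seg: "seg x p q = fin (h q) p" if "p \<le> q" "edeg q \<le> d" for p q
    using that by (simp add: x_def seg_def mor_Omega_iff[OF d])
  have cmp_h: "cmp \<Lambda> (h p) (fin (h q) p) = h q" "(h p, fin (h q) p) \<in> composable \<Lambda>" if "p \<le> q" "edeg q \<le> d" for p q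
    using cmp_pre_fin[OF pre[OF that]] pre_fin_composable[OF pre[OF that]] h(2)[of p] edeg_le_trans[OF that]
    by simp_all
  have "x \<in> path_space k \<Lambda>"
    unfolding path_space_iff
  proof (intro conjI allI impI)
    show "pdeg x \<in> NInfk k" "snd x \<in> extensional (mor (Omega k (pdeg x)))"
      using d by (auto simp: x_def pdeg_def)
  next
    fix p q assume "p \<le> q \<and> edeg q \<le> pdeg x"
    then have pq: "p \<le> q" "edeg q \<le> d" "edeg p \<le> d"
      using edeg_le_trans by (auto simp: x_def pdeg_def)
    have ends: "seg x r r = src \<Lambda> (h r)" if "edeg r \<le> d" for r
      using fin_deg[OF h(1)[OF that]] h(2)[OF that] that by (simp add: seg)
    show "seg x p q \<in> mor \<Lambda>" "deg \<Lambda> (seg x p q) = q - p" "src \<Lambda> (seg x p q) = seg x q q"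
      using pq h by (simp_all add: seg[OF pq(1,2)] ends fin_mor deg_fin src_fin)
    show "rng \<Lambda> (seg x p q) = seg x p p"
      using composableD(3)[OF cmp_h(2)[OF pq(1,2)]] pq by (simp add: seg[OF pq(1,2)] ends)
  next
    fix p q r assume "p \<le> q \<and> q \<le> r \<and> edeg r \<le> pdeg x"
    then have pq: "p \<le> q" "q \<le> r" "edeg r \<le> d" "edeg q \<le> d" "p \<le> r" "edeg p \<le> d"
      using edeg_le_trans order_trans by (auto simp: x_def pdeg_def)
    have c: "(fin (h q) p, fin (h r) q) \<in> composable \<Lambda>"
      using cmp_composable(3)[OF cmp_h(2)[OF pq(1,4)], of "fin (h r) q"] cmp_h[OF pq(1,4)] cmp_h[OF pq(2,3)]
      by simp
    then have "fin (h r) p = cmp \<Lambda> (fin (h q) p) (fin (h r) q)"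
      using cmp_assoc[OF cmp_h(2)[OF pq(1,4)] c] cmp_h[OF pq(1,4)] cmp_h[OF pq(2,3)] h(2)[OF pq(6)]
        cmp_composable(2)[OF cmp_h(2)[OF pq(1,4)] c]
      by (intro fin_eqI[of "h p"]) simp_all
    then show "seg x p r = cmp \<Lambda> (seg x p q) (seg x q r)"
      using pq by (simp add: seg)
  qed
  moreover have "pdeg x = d"
    by (simp add: x_def pdeg_def)
  moreover have "seg x 0 q = h q" if "edeg q \<le> d" for q
    using that h by (simp add: seg fin_zero)
  ultimately show thesis
    using that by blast
qed

section \<open>Shifts of paths\<close>

lemma pdeg_shift [simp]: "pdeg (shift k m x) = pdeg x - edeg m"
  by (simp add: shift_def pdeg_def)

lemma seg_shift:
  assumes "x \<in> path_space k \<Lambda>" "edeg m \<le> pdeg x" "p \<le> q" "edeg (m + q) \<le> pdeg x"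
  shows "seg (shift k m x) p q = seg x (m + p) (m + q)"
  using assms NInfk_diff[OF pdeg_NInfk[OF assms(1)]]
  by (simp add: seg_def shift_def mor_Omega_iff edeg_le_diff_iff)

lemma shift_path:
  assumes "x \<in> path_space k \<Lambda>" "edeg m \<le> pdeg x"
  shows "shift k m x \<in> path_space k \<Lambda>"
  unfolding path_space_iff pdeg_shift
proof (intro conjI allI impI)
  show "pdeg x - edeg m \<in> NInfk k"
    using assms by (simp add: NInfk_diff pdeg_NInfk)
  show "snd (shift k m x) \<in> extensional (mor (Omega k (pdeg x - edeg m)))"
    by (simp add: shift_def)
next
  fix p q assume "p \<le> q \<and> edeg q \<le> pdeg x - edeg m"
  then have pq: "p \<le> q" "edeg (m + q) \<le> pdeg x" "edeg (m + p) \<le> pdeg x" "m + p \<le> m + q"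
    using edeg_le_diff_iff[OF assms(2)] edeg_add_le_trans order_trans by auto
  note [simp] = seg_shift[OF assms]
  show "seg (shift k m x) p q \<in> mor \<Lambda>" "deg \<Lambda> (seg (shift k m x) p q) = q - p"
    "rng \<Lambda> (seg (shift k m x) p q) = seg (shift k m x) p p"
    "src \<Lambda> (seg (shift k m x) p q) = seg (shift k m x) q q"
    using pq seg_mor[OF assms(1) pq(4,2)] deg_seg[OF assms(1) pq(4,2)] rng_seg[OF assms(1) pq(4,2)]
      src_seg[OF assms(1) pq(4,2)] by (auto simp: fun_eq_iff)
next
  fix p q r assume "p \<le> q \<and> q \<le> r \<and> edeg r \<le> pdeg x - edeg m"
  then have pq: "p \<le> q" "q \<le> r" "edeg (m + r) \<le> pdeg x" "edeg (m + q) \<le> pdeg x" "p \<le> r"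
    "m + p \<le> m + q" "m + q \<le> m + r"
    using edeg_le_diff_iff[OF assms(2)] edeg_add_le_trans order_trans by auto
  then show "seg (shift k m x) p r = cmp \<Lambda> (seg (shift k m x) p q) (seg (shift k m x) q r)"
    using seg_cmp[OF assms(1) pq(6,7,3)] by (simp add: seg_shift[OF assms])
qed

lemma shift_shift:
  assumes "x \<in> path_space k \<Lambda>" "edeg (m + n) \<le> pdeg x"
  shows "shift k n (shift k m x) = shift k (m + n) x"
proof -
  have m: "edeg m \<le> pdeg x"
    using assms(2) by (rule edeg_le_trans[rotated]) simp
  then have n: "edeg n \<le> pdeg (shift k m x)"
    using assms(2) by (simp add: edeg_le_diff_iff)
  show ?thesis
  proof (rule path_eqI)
    show "shift k n (shift k m x) \<in> path_space k \<Lambda>" "shift k (m + n) x \<in> path_space k \<Lambda>"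
      using assms m n by (auto intro: shift_path)
    show "pdeg (shift k n (shift k m x)) = pdeg (shift k (m + n) x)"
      by (simp add: edeg_diff_add)
    fix q assume "edeg q \<le> pdeg (shift k n (shift k m x))"
    then have q: "edeg (n + q) \<le> pdeg x - edeg m" "edeg (m + (n + q)) \<le> pdeg x"
      using n m by (auto simp: edeg_le_diff_iff)
    have "edeg (m + n) \<le> pdeg x" "edeg (m + n + q) \<le> pdeg x"
      using assms q(2) by (auto simp: add.assoc)
    then show "seg (shift k n (shift k m x)) 0 q = seg (shift k (m + n) x) 0 q"
      using q m n assms by (simp add: seg_shift shift_path add.assoc)
  qed
qed

lemma prng_shift:
  assumes "x \<in> path_space k \<Lambda>" "edeg m \<le> pdeg x"
  shows "prng (shift k m x) = src \<Lambda> (seg x 0 m)"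
  using assms src_seg[of x 0 m] by (simp add: prng_def seg_shift)

text \<open>The degree bound is essential: outside its domain a path takes the value
  \<open>undefined\<close>, which might happen to be a morphism.\<close>

definition starts :: "'a kpath \<Rightarrow> 'a \<Rightarrow> bool" where
  "starts x \<mu> \<longleftrightarrow> edeg (deg \<Lambda> \<mu>) \<le> pdeg x \<and> seg x 0 (deg \<Lambda> \<mu>) = \<mu>"

lemma starts_seg: "x \<in> path_space k \<Lambda> \<Longrightarrow> edeg p \<le> pdeg x \<Longrightarrow> starts x (seg x 0 p)"
  by (simp add: starts_def deg_seg0)

lemma starts_mor: "x \<in> path_space k \<Lambda> \<Longrightarrow> starts x \<mu> \<Longrightarrow> \<mu> \<in> mor \<Lambda>"
  using seg0_mor by (fastforce simp: starts_def)

lemma starts_rng: "x \<in> path_space k \<Lambda> \<Longrightarrow> starts x \<mu> \<Longrightarrow> rng \<Lambda> \<mu> = prng x"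
  using rng_seg[of x 0 "deg \<Lambda> \<mu>"] by (simp add: starts_def prng_def)

lemma starts_prng:
  assumes "x \<in> path_space k \<Lambda>"
  shows "starts x (prng x)" "prng x \<in> obj \<Lambda>"
proof -
  show "prng x \<in> obj \<Lambda>"
    using rng_seg[OF assms, of 0 0] rng_obj[OF seg_mor[OF assms, of 0 0]] by (simp add: prng_def)
  then show "starts x (prng x)"
    by (simp add: starts_def deg_id prng_def)
qed

lemma starts_linear:
  "x \<in> path_space k \<Lambda> \<Longrightarrow> starts x \<mu> \<Longrightarrow> starts x \<nu> \<Longrightarrow> deg \<Lambda> \<mu> \<le> deg \<Lambda> \<nu> \<Longrightarrow> \<mu> \<preceq> \<nu>"
  using seg0_pre unfolding starts_def by metis

lemma starts_pre:
  assumes "x \<in> path_space k \<Lambda>" "starts x \<nu>" "\<mu> \<preceq> \<nu>"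
  shows "starts x \<mu>"
proof -
  have d: "edeg (deg \<Lambda> \<nu>) \<le> pdeg x" "edeg (deg \<Lambda> \<mu>) \<le> pdeg x"
    using assms pre_deg edeg_le_trans unfolding starts_def by blast+
  then have "seg x 0 (deg \<Lambda> \<mu>) \<preceq> \<nu>"
    using assms seg0_pre[OF assms(1) pre_deg[OF assms(3)] d(1)] by (simp add: starts_def)
  then show ?thesis
    using pre_eq[OF _ assms(3)] d by (simp add: starts_def deg_seg0[OF assms(1)])
qed

lemma starts_directed:
  assumes "x \<in> path_space k \<Lambda>" "starts x \<mu>" "starts x \<nu>"
  obtains \<theta> where "starts x \<theta>" "\<mu> \<preceq> \<theta>" "\<nu> \<preceq> \<theta>"
proof
  let ?p = "sup (deg \<Lambda> \<mu>) (deg \<Lambda> \<nu>)"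
  have p: "edeg ?p \<le> pdeg x"
    using assms edeg_sup_le by (simp add: starts_def)
  then show s: "starts x (seg x 0 ?p)"
    using assms starts_seg by blast
  show "\<mu> \<preceq> seg x 0 ?p" "\<nu> \<preceq> seg x 0 ?p"
    using assms p s by (auto intro!: starts_linear simp: deg_seg0)
qed

lemma starts_src:
  "x \<in> path_space k \<Lambda> \<Longrightarrow> starts x \<mu> \<Longrightarrow> prng (shift k (deg \<Lambda> \<mu>) x) = src \<Lambda> \<mu>"
  using prng_shift[of x "deg \<Lambda> \<mu>"] by (simp add: starts_def)

lemma starts_cmp_iff:
  assumes "x \<in> path_space k \<Lambda>" "starts x \<kappa>" "(\<kappa>, \<nu>) \<in> composable \<Lambda>"
  shows "starts x (cmp \<Lambda> \<kappa> \<nu>) \<longleftrightarrow> starts (shift k (deg \<Lambda> \<kappa>) x) \<nu>"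
proof -
  let ?l = "deg \<Lambda> \<kappa>" and ?n = "deg \<Lambda> \<nu>"
  have l: "edeg ?l \<le> pdeg x"
    using assms by (simp add: starts_def)
  have "seg x 0 (?l + ?n) = cmp \<Lambda> \<kappa> \<nu> \<longleftrightarrow> seg x ?l (?l + ?n) = \<nu>" if "edeg (?l + ?n) \<le> pdeg x"
  proof -
    have "cmp \<Lambda> \<kappa> (seg x ?l (?l + ?n)) = seg x 0 (?l + ?n)" "(\<kappa>, seg x ?l (?l + ?n)) \<in> composable \<Lambda>"
      using seg_cmp[OF assms(1), of 0 ?l "?l + ?n"] seg_composable[OF assms(1), of 0 ?l "?l + ?n"] assms(2) that
      by (simp_all add: starts_def)
    then show ?thesis
      using cmp_cancel_left assms(3) by metis
  qed
  then show ?thesis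
    using assms l by (auto simp: starts_def deg_cmp edeg_le_diff_iff seg_shift)
qed

text \<open>This is the uniqueness half of prepending: a path is recovered from one initial segment
  and the remaining shift.\<close>

lemma path_eq_if_shift_eq:
  assumes "x \<in> path_space k \<Lambda>" "y \<in> path_space k \<Lambda>" "starts x \<mu>" "starts y \<mu>"
    and "shift k (deg \<Lambda> \<mu>) x = shift k (deg \<Lambda> \<mu>) y"
  shows "x = y"
proof (rule path_eqI[OF assms(1,2)])
  let ?l = "deg \<Lambda> \<mu>"
  have l: "edeg ?l \<le> pdeg x" "edeg ?l \<le> pdeg y"
    using assms by (auto simp: starts_def)
  then show d: "pdeg x = pdeg y"
    using arg_cong[OF assms(5), of pdeg] edeg_add_diff by (metis pdeg_shift)
  fix q assume q: "edeg q \<le> pdeg x"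
  \<comment> \<open>\<open>q\<close> need not lie above \<open>?l\<close>. The paths are compared at
    \<open>sup q ?l\<close>, where the segment is \<open>\<mu>\<close> followed by a segment of the
    shift, and then cut back to \<open>q\<close>.\<close>
  have s: "edeg (sup q ?l) \<le> pdeg x"
    using q l edeg_sup_le by blast
  have eq: "seg z 0 (sup q ?l) = cmp \<Lambda> \<mu> (seg (shift k ?l z) 0 (sup q ?l - ?l))"
    if "z \<in> path_space k \<Lambda>" "starts z \<mu>" "edeg (sup q ?l) \<le> pdeg z" for z
    using seg_cmp[OF that(1), of 0 ?l "sup q ?l"] that by (simp add: starts_def seg_shift)
  have "seg x 0 (sup q ?l) = seg y 0 (sup q ?l)"
    using eq[of x] eq[of y] assms s d by simp
  then show "seg x 0 q = seg y 0 q"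
    using pre_ini[OF seg0_pre[OF assms(1), of q "sup q ?l"]] pre_ini[OF seg0_pre[OF assms(2), of q "sup q ?l"]]
      s q d deg_seg0[OF assms(1) q] deg_seg0[OF assms(2), of q] by simp
qed

text \<open>Existence and uniqueness of the path described in \<open>prepend\<close>, without which
  the definite description would carry no information.\<close>

lemma
  assumes \<mu>: "\<mu> \<in> mor \<Lambda>" and x: "x \<in> path_space k \<Lambda>" "prng x = src \<Lambda> \<mu>"
  shows prepend_path: "prepend k \<Lambda> \<mu> x \<in> path_space k \<Lambda>"
    and starts_prepend: "starts (prepend k \<Lambda> \<mu> x) \<mu>"
    and shift_prepend: "shift k (deg \<Lambda> \<mu>) (prepend k \<Lambda> \<mu> x) = x"
    and pdeg_prepend: "pdeg (prepend k \<Lambda> \<mu> x) = edeg (deg \<Lambda> \<mu>) + pdeg x"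
proof -
  let ?l = "deg \<Lambda> \<mu>"
  let ?P = "\<lambda>y. y \<in> path_space k \<Lambda> \<and> pdeg y = edeg ?l + pdeg x \<and> seg y 0 ?l = \<mu> \<and> shift k ?l y = x"
  define d where "d = edeg ?l + pdeg x"
  have d: "d \<in> NInfk k"
    using \<mu> x deg_in by (simp add: d_def NInfk_edeg_add pdeg_NInfk)
  \<comment> \<open>A degree \<open>q\<close> not above \<open>?l\<close> cannot be reached by
    composing with \<open>\<mu>\<close>. So \<open>c q\<close> overshoots to
    \<open>sup q ?l\<close>, and the initial segment of degree \<open>q\<close> is obtained by
    cutting it.\<close>
  define c where "c q = cmp \<Lambda> \<mu> (seg x 0 (sup q ?l - ?l))" for q
  have c: "(\<mu>, seg x 0 (sup q ?l - ?l)) \<in> composable \<Lambda>" "c q \<in> mor \<Lambda>" "deg \<Lambda> (c q) = sup q ?l"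
    if "edeg q \<le> d" for q
  proof -
    have *: "edeg (sup q ?l - ?l) \<le> pdeg x"
      using that unfolding d_def by (rule edeg_sup_diff_le)
    show "(\<mu>, seg x 0 (sup q ?l - ?l)) \<in> composable \<Lambda>"
      using * rng_seg[OF x(1) _ *, of 0] \<mu> x by (auto intro!: composableI seg0_mor simp: prng_def)
    then show "c q \<in> mor \<Lambda>" "deg \<Lambda> (c q) = sup q ?l"
      using * x by (simp_all add: c_def cmp_mor deg_cmp deg_seg0)
  qed
  have c_pre: "c p \<preceq> c q" if "p \<le> q" "edeg q \<le> d" for p q
  proof -
    have "edeg (sup q ?l - ?l) \<le> pdeg x"
      using that unfolding d_def by (intro edeg_sup_diff_le)
    moreover have "sup p ?l - ?l \<le> sup q ?l - ?l"
      using that(1) by (auto simp: le_fun_def intro!: diff_le_mono sup.mono)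
    ultimately show ?thesis
      unfolding c_def using that c(1) edeg_le_trans[OF that] by (intro pre_cmp_iff[THEN iffD2] seg0_pre x) auto
  qed
  obtain y where y: "y \<in> path_space k \<Lambda>" "pdeg y = d" "\<And>q. edeg q \<le> d \<Longrightarrow> seg y 0 q = ini (c q) q"
  proof (rule path_of_initial_segments[OF d, of "\<lambda>q. ini (c q) q"])
    show "ini (c q) q \<in> mor \<Lambda>" "deg \<Lambda> (ini (c q) q) = q" if "edeg q \<le> d" for q
      using c[OF that] by (simp_all add: ini_mor deg_ini)
    show "ini (c p) p \<preceq> ini (c q) q" if "p \<le> q" "edeg q \<le> d" for p q
    proof -
      have p: "edeg p \<le> d"
        using edeg_le_trans[OF that] .
      have ini': "ini (c r) r \<preceq> c r" "deg \<Lambda> (ini (c r) r) = r" if "edeg r \<le> d" for r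
        using c[OF that] by (simp_all add: ini_pre deg_ini)
      show ?thesis
        using pre_linear[OF pre_trans[OF ini'(1)[OF p] c_pre[OF that]] ini'(1)[OF that(2)]]
          ini'(2)[OF p] ini'(2)[OF that(2)] that(1) by simp
    qed
  qed blast
  have le: "edeg ?l \<le> d"
    by (simp add: d_def)
  have "seg y 0 ?l = \<mu>"
    using y(3)[OF le] ini_cmp[OF c(1)[OF le]] by (simp add: c_def)
  moreover have "shift k ?l y = x"
  proof (rule path_eqI)
    show "shift k ?l y \<in> path_space k \<Lambda>" "x \<in> path_space k \<Lambda>"
      using y x le by (auto simp: shift_path)
    show "pdeg (shift k ?l y) = pdeg x"
      unfolding pdeg_shift y(2) d_def by simp
    fix n assume "edeg n \<le> pdeg (shift k ?l y)"
    then have n: "edeg (?l + n) \<le> d"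
      using y le by (simp add: edeg_le_diff_iff)
    have sup: "sup (?l + n) ?l = ?l + n"
      by (simp add: sup_absorb1)
    have "ini (c (?l + n)) (?l + n) = c (?l + n)"
      using pre_ini[OF pre_refl, of "c (?l + n)"] c[OF n] sup by simp
    then have "seg y 0 (?l + n) = cmp \<Lambda> \<mu> (seg x 0 n)"
      using y(3)[OF n] sup by (simp add: c_def)
    moreover have "cmp \<Lambda> \<mu> (seg y ?l (?l + n)) = seg y 0 (?l + n)" "(\<mu>, seg y ?l (?l + n)) \<in> composable \<Lambda>"
      using seg_cmp[OF y(1), of 0 ?l "?l + n"] seg_composable[OF y(1), of 0 ?l "?l + n"] n y(2)
        \<open>seg y 0 ?l = \<mu>\<close> by simp_all
    moreover have "(\<mu>, seg x 0 n) \<in> composable \<Lambda>"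
      using c(1)[OF n] sup by simp
    ultimately have "seg y ?l (?l + n) = seg x 0 n"
      using cmp_cancel_left by metis
    then show "seg (shift k ?l y) 0 n = seg x 0 n"
      using y n le by (simp add: seg_shift)
  qed
  ultimately have ex: "?P y"
    using y by (simp add: d_def)
  moreover have "z = y" if "?P z" for z
  proof (rule path_eq_if_shift_eq[of z y \<mu>])
    show "starts z \<mu>" "starts y \<mu>"
      using that ex by (simp_all add: starts_def)
  qed (use that ex in simp_all)
  ultimately have "\<exists>!y. ?P y"
    by blast
  from theI'[OF this] have "?P (prepend k \<Lambda> \<mu> x)"
    unfolding prepend_def .
  then show "prepend k \<Lambda> \<mu> x \<in> path_space k \<Lambda>" "starts (prepend k \<Lambda> \<mu> x) \<mu>"
    "shift k (deg \<Lambda> \<mu>) (prepend k \<Lambda> \<mu> x) = x" "pdeg (prepend k \<Lambda> \<mu> x) = edeg (deg \<Lambda> \<mu>) + pdeg x"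
    by (auto simp: starts_def)
qed

lemma prepend_shift:
  assumes "x \<in> path_space k \<Lambda>" "starts x \<mu>"
  shows "prepend k \<Lambda> \<mu> (shift k (deg \<Lambda> \<mu>) x) = x"
proof -
  have "\<mu> \<in> mor \<Lambda>" "shift k (deg \<Lambda> \<mu>) x \<in> path_space k \<Lambda>" "prng (shift k (deg \<Lambda> \<mu>) x) = src \<Lambda> \<mu>"
    using assms starts_mor starts_src by (auto intro: shift_path simp: starts_def)
  note * = prepend_path[OF this] starts_prepend[OF this] shift_prepend[OF this]
  show ?thesis
    using path_eq_if_shift_eq[OF *(1) assms(1) *(2) assms(2) *(3)] .
qed

text \<open>A coincidence of two shifts survives further shifting, so it can be moved past
  \<open>\<mu>\<close>, where it becomes a coincidence of shifts of \<open>x\<close>.\<close>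

lemma aperiodic_prepend:
  assumes \<mu>: "\<mu> \<in> mor \<Lambda>" and x: "x \<in> path_space k \<Lambda>" "prng x = src \<Lambda> \<mu>" "aperiodic k x"
  shows "aperiodic k (prepend k \<Lambda> \<mu> x)"
  unfolding aperiodic_def
proof (intro ballI impI notI)
  let ?l = "deg \<Lambda> \<mu>" and ?y = "prepend k \<Lambda> \<mu> x"
  note y = prepend_path[OF \<mu> x(1,2)] shift_prepend[OF \<mu> x(1,2)] pdeg_prepend[OF \<mu> x(1,2)]
  fix p q assume "p \<in> Nk k" "q \<in> Nk k" "edeg p \<le> pdeg ?y \<and> edeg q \<le> pdeg ?y \<and> p \<noteq> q"
    and eq: "shift k p ?y = shift k q ?y"
  then have pq: "edeg p \<le> pdeg ?y" "edeg q \<le> pdeg ?y" "p \<noteq> q"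
    by auto
  text \<open>In a direction of finite degree \<open>p\<close> and \<open>q\<close> agree, so both can be raised above \<open>deg \<mu>\<close> by
    the same amount.\<close>
  define n where "n i = (if p i = q i then ?l i - p i else ?l i)" for i
  \<comment> \<open>Equal shifts have equal degrees. Subtracting different numbers from a finite
    degree bounding both gives different results, so the degree is infinite wherever
    \<open>p\<close> and \<open>q\<close> differ.\<close>
  have dd: "pdeg ?y - edeg p = pdeg ?y - edeg q"
    using arg_cong[OF eq, of pdeg] by simp
  have inf: "pdeg ?y i = \<infinity>" if "p i \<noteq> q i" for i
    using fun_cong[OF dd, of i] le_funD[OF pq(1), of i] le_funD[OF pq(2), of i] that
    by (cases "pdeg ?y i") (simp_all add: edeg_def)
  have "edeg ?l \<le> pdeg ?y"
    using y by simp
  then have "enat (p i + n i) \<le> pdeg ?y i" "enat (q i + n i) \<le> pdeg ?y i" for i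
    using le_funD[of "edeg ?l" "pdeg ?y" i] le_funD[OF pq(1), of i] le_funD[OF pq(2), of i] inf[of i]
    by (cases "pdeg ?y i"; auto simp: n_def edeg_def)+
  then have n: "edeg (p + n) \<le> pdeg ?y" "edeg (q + n) \<le> pdeg ?y"
    by (auto simp: edeg_def le_fun_def)
  have l: "?l \<le> p + n" "?l \<le> q + n"
    by (auto simp: n_def le_fun_def)
  have red: "shift k (r + n - ?l) x = shift k n (shift k r ?y)" "edeg (r + n - ?l) \<le> pdeg x"
    if "edeg (r + n) \<le> pdeg ?y" "?l \<le> r + n" for r
  proof -
    have "shift k (r + n - ?l) (shift k ?l ?y) = shift k (r + n) ?y"
      using shift_shift[OF y(1), of ?l "r + n - ?l"] that by simp
    then show "shift k (r + n - ?l) x = shift k n (shift k r ?y)"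
      using shift_shift[OF y(1) that(1)] y(2) by simp
    show "edeg (r + n - ?l) \<le> pdeg x"
      using edeg_le_diff_iff[of ?l "pdeg ?y" "r + n - ?l"] that y(3) by simp
  qed
  have "p + n - ?l \<noteq> q + n - ?l"
    using l pq(3) by (metis add_right_cancel fun_add_diff)
  moreover have "p + n - ?l \<in> Nk k" "q + n - ?l \<in> Nk k"
    using red(2)[OF n(1) l(1)] red(2)[OF n(2) l(2)] pdeg_NInfk[OF x(1)] NInfk_edeg_le by blast+
  ultimately show False
    using x(3) red[OF n(1) l(1)] red[OF n(2) l(2)] eq unfolding aperiodic_def by metis
qed


section \<open>Boundary paths\<close>

text \<open>The boundary condition at position \<open>0\<close> only. A boundary path is one whose
  shifts all satisfy it, and in this form the condition can be carried from one position to
  another.\<close>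

definition meets_CE :: "'a kpath \<Rightarrow> bool" where
  "meets_CE x \<longleftrightarrow> (\<forall>E\<in>CE \<Lambda> (prng x). \<exists>\<mu>\<in>E. starts x \<mu>)"

lemma boundary_paths_iff:
  "x \<in> boundary_paths k \<Lambda> \<longleftrightarrow>
    x \<in> path_space k \<Lambda> \<and> (\<forall>m. edeg m \<le> pdeg x \<longrightarrow> meets_CE (shift k m x))"
proof -
  have "meets_CE (shift k m x) \<longleftrightarrow>
    (\<forall>E\<in>CE \<Lambda> (seg x m m). \<exists>\<mu>\<in>E. edeg (m + deg \<Lambda> \<mu>) \<le> pdeg x \<and> seg x m (m + deg \<Lambda> \<mu>) = \<mu>)"
    if "x \<in> path_space k \<Lambda>" "edeg m \<le> pdeg x" for m
  proof -
    have "prng (shift k m x) = seg x m m"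
      using that by (simp add: prng_def seg_shift)
    moreover have "starts (shift k m x) \<mu> \<longleftrightarrow> edeg (m + deg \<Lambda> \<mu>) \<le> pdeg x \<and> seg x m (m + deg \<Lambda> \<mu>) = \<mu>" for \<mu>
      using that seg_shift[OF that, of 0 "deg \<Lambda> \<mu>"] by (auto simp: starts_def edeg_le_diff_iff)
    ultimately show ?thesis
      by (simp add: meets_CE_def)
  qed
  moreover have "m \<in> Nk k" if "x \<in> path_space k \<Lambda>" "edeg m \<le> pdeg x" for m
    using that NInfk_edeg_le pdeg_NInfk by blast
  ultimately show ?thesis
    unfolding boundary_paths_def by blast
qed

lemma CE_I:
  assumes "compactin (mor_top \<Lambda>) E" "openin (obj_top \<Lambda>) W" "v \<in> W" "W \<subseteq> rng \<Lambda> ` E"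
    and "\<And>\<mu>. \<mu> \<in> mor \<Lambda> \<Longrightarrow> rng \<Lambda> \<mu> \<in> rng \<Lambda> ` E \<Longrightarrow> \<exists>\<eta>\<in>E. \<exists>\<theta>. \<mu> \<preceq> \<theta> \<and> \<eta> \<preceq> \<theta>"
  shows "E \<in> CE \<Lambda> v"
proof -
  have E: "E \<subseteq> mor \<Lambda>"
    using assms(1) compactin_subset_topspace by fastforce
  have "rng \<Lambda> ` E \<subseteq> mor \<Lambda>"
    using E rng_obj obj_subset by auto
  note sc = set_cmp_mor[OF this]
  have "E \<subseteq> set_cmp \<Lambda> (rng \<Lambda> ` E) (mor \<Lambda>)"
    unfolding sc using E rng_pre by blast
  moreover have "min_ext \<Lambda> \<mu> \<nu> \<noteq> {} \<longleftrightarrow> (\<exists>\<theta>. \<mu> \<preceq> \<theta> \<and> \<nu> \<preceq> \<theta>)" for \<mu> \<nu>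
    by (rule min_ext_nonempty_iff)
  moreover have "\<exists>\<nu>\<in>E. \<exists>\<theta>. \<mu> \<preceq> \<theta> \<and> \<nu> \<preceq> \<theta>" if "\<mu> \<in> set_cmp \<Lambda> (rng \<Lambda> ` E) (mor \<Lambda>)" for \<mu>
  proof -
    obtain v where v: "v \<in> rng \<Lambda> ` E" "v \<preceq> \<mu>"
      using \<open>\<mu> \<in> set_cmp \<Lambda> (rng \<Lambda> ` E) (mor \<Lambda>)\<close> unfolding sc by blast
    moreover have "rng \<Lambda> v = v"
      using v(1) E rng_obj rng_id by blast
    ultimately show ?thesis
      using assms(5)[of \<mu>] pre_mor[OF v(2)] pre_rng[OF v(2)] by metis
  qed
  ultimately have "exhaustive \<Lambda> (rng \<Lambda> ` E) E"
    unfolding exhaustive_def by blast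
  then show ?thesis
    using assms(1-4) unfolding CE_def by blast
qed

lemma CE_D:
  assumes "E \<in> CE \<Lambda> v"
  shows "compactin (mor_top \<Lambda>) E"
    and "\<exists>W. openin (obj_top \<Lambda>) W \<and> v \<in> W \<and> W \<subseteq> rng \<Lambda> ` E"
    and "\<And>\<mu>. \<mu> \<in> mor \<Lambda> \<Longrightarrow> rng \<Lambda> \<mu> \<in> rng \<Lambda> ` E \<Longrightarrow> \<exists>\<eta>\<in>E. \<exists>\<theta>. \<mu> \<preceq> \<theta> \<and> \<eta> \<preceq> \<theta>"
proof -
  show "compactin (mor_top \<Lambda>) E" "\<exists>W. openin (obj_top \<Lambda>) W \<and> v \<in> W \<and> W \<subseteq> rng \<Lambda> ` E"
    using assms by (auto simp: CE_def)
  have "E \<subseteq> mor \<Lambda>"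
    using assms compactin_subset_topspace by (fastforce simp: CE_def)
  then have "rng \<Lambda> ` E \<subseteq> mor \<Lambda>"
    using rng_obj obj_subset by auto
  fix \<mu> assume "\<mu> \<in> mor \<Lambda>" "rng \<Lambda> \<mu> \<in> rng \<Lambda> ` E"
  then have "\<mu> \<in> set_cmp \<Lambda> (rng \<Lambda> ` E) (mor \<Lambda>)"
    unfolding set_cmp_mor[OF \<open>rng \<Lambda> ` E \<subseteq> mor \<Lambda>\<close>] using rng_pre by blast
  then have "\<exists>\<eta>\<in>E. min_ext \<Lambda> \<mu> \<eta> \<noteq> {}"
    using assms unfolding CE_def exhaustive_def by blast
  then show "\<exists>\<eta>\<in>E. \<exists>\<theta>. \<mu> \<preceq> \<theta> \<and> \<eta> \<preceq> \<theta>"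
    unfolding min_ext_nonempty_iff .
qed

text \<open>For \<open>K\<close> consisting of a single morphism \<open>\<kappa>\<close> of degree
  \<open>p\<close> this is the set commonly written Ext(\<kappa>;F), the morphisms that extend
  \<open>\<kappa>\<close> minimally to an extension of some element of \<open>F\<close>.\<close>

definition tails :: "(nat \<Rightarrow> nat) \<Rightarrow> 'a set \<Rightarrow> 'a set \<Rightarrow> 'a set" where
  "tails p K F = (\<lambda>\<theta>. fin \<theta> p) ` mce K F"

lemma mce_deg: "\<theta> \<in> mce K F \<Longrightarrow> K \<subseteq> mor_of_deg \<Lambda> p \<Longrightarrow> p \<le> deg \<Lambda> \<theta>"
  by (auto simp: mce_def mor_of_deg_def)

lemma compactin_tails:
  assumes "compactly_aligned k \<Lambda>" "p \<in> Nk k" "K \<subseteq> mor_of_deg \<Lambda> p"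
    and "compactin (mor_top \<Lambda>) K" "compactin (mor_top \<Lambda>) F"
  shows "compactin (mor_top \<Lambda>) (tails p K F)"
  unfolding tails_def using compactin_mce[OF assms] mce_deg assms(3) by (blast intro: compactin_fin_image)

lemma tails_iff:
  assumes "K \<subseteq> mor_of_deg \<Lambda> p"
  shows "\<tau> \<in> tails p K F \<longleftrightarrow> (\<exists>\<kappa>\<in>K. (\<kappa>, \<tau>) \<in> composable \<Lambda> \<and> cmp \<Lambda> \<kappa> \<tau> \<in> mce K F)"
proof
  assume "\<tau> \<in> tails p K F"
  then obtain \<theta> \<kappa> where "\<theta> \<in> mce K F" "\<tau> = fin \<theta> p" "\<kappa> \<in> K" "\<kappa> \<preceq> \<theta>"
    by (auto simp: tails_def mce_def)
  moreover from this have "deg \<Lambda> \<kappa> = p"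
    using assms by (auto simp: mor_of_deg_def)
  ultimately show "\<exists>\<kappa>\<in>K. (\<kappa>, \<tau>) \<in> composable \<Lambda> \<and> cmp \<Lambda> \<kappa> \<tau> \<in> mce K F"
    using cmp_pre_fin pre_fin_composable by metis
next
  assume "\<exists>\<kappa>\<in>K. (\<kappa>, \<tau>) \<in> composable \<Lambda> \<and> cmp \<Lambda> \<kappa> \<tau> \<in> mce K F"
  then obtain \<kappa> where \<kappa>: "\<kappa> \<in> K" "(\<kappa>, \<tau>) \<in> composable \<Lambda>" "cmp \<Lambda> \<kappa> \<tau> \<in> mce K F"
    by blast
  then have "deg \<Lambda> \<kappa> = p"
    using assms by (auto simp: mor_of_deg_def)
  then show "\<tau> \<in> tails p K F"
    using \<kappa> fin_cmp[OF \<kappa>(2)] unfolding tails_def by (metis rev_image_eqI)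
qed

text \<open>The minimal common extension of \<open>\<kappa>\<close> and \<open>\<phi>\<close> is an
  initial segment of their common extension; cancelling \<open>\<kappa>\<close> from both leaves the
  tail.\<close>

lemma tails_I:
  assumes "K \<subseteq> mor_of_deg \<Lambda> p" "\<kappa> \<in> K" "\<phi> \<in> F" "(\<kappa>, \<mu>) \<in> composable \<Lambda>" "\<phi> \<preceq> cmp \<Lambda> \<kappa> \<mu>"
  obtains \<tau> where "\<tau> \<in> tails p K F" "\<tau> \<preceq> \<mu>"
proof -
  obtain \<xi> where \<xi>: "\<xi> \<in> mce K F" "\<kappa> \<preceq> \<xi>" "\<phi> \<preceq> \<xi>" "\<xi> \<preceq> cmp \<Lambda> \<kappa> \<mu>"
    using ini_in_mce[OF assms(2,3) pre_cmp[OF assms(4)] assms(5)] by blast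
  obtain \<tau> where \<tau>: "(\<kappa>, \<tau>) \<in> composable \<Lambda>" "\<xi> = cmp \<Lambda> \<kappa> \<tau>"
    using \<xi>(2) by (auto simp: pre_def)
  show thesis
  proof
    show "\<tau> \<in> tails p K F"
      unfolding tails_iff[OF assms(1)] using \<xi>(1) \<tau> assms(2) by blast
    show "\<tau> \<preceq> \<mu>"
      using \<xi>(4) \<tau> assms(4) pre_cmp_iff by simp
  qed
qed

text \<open>Exhaustive sets can be transported along an initial segment \<open>\<xi>\<close>: the tails of the minimal
  common extensions of \<open>E\<close> with a small compact neighbourhood of \<open>\<xi>\<close> are exhaustive at \<open>s(\<xi>)\<close>.\<close>

lemma meets_CE_if_shift:
  assumes ca: "compactly_aligned k \<Lambda>"
    and x: "x \<in> path_space k \<Lambda>" "starts x \<xi>" "meets_CE (shift k (deg \<Lambda> \<xi>) x)"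
  shows "meets_CE x"
  unfolding meets_CE_def
proof
  fix E assume E: "E \<in> CE \<Lambda> (prng x)"
  let ?p = "deg \<Lambda> \<xi>"
  have \<xi>: "\<xi> \<in> mor \<Lambda>"
    using starts_mor x by blast
  obtain W where W: "openin (obj_top \<Lambda>) W" "prng x \<in> W" "W \<subseteq> rng \<Lambda> ` E"
    using CE_D(2)[OF E] by blast
  obtain U where U: "openin (mor_top \<Lambda>) U" "\<xi> \<in> U" "inj_on (src \<Lambda>) U"
    using src_locally_injective[OF \<xi>] by metis
  \<comment> \<open>Three restrictions: in \<open>U\<close> the source determines the morphism, a
    single degree makes the tails compact, and ranges in \<open>W\<close> let exhaustiveness of
    \<open>E\<close> apply to every \<open>cmp \<Lambda> \<kappa> \<mu>\<close> with
    \<open>\<kappa>\<close> in \<open>K\<close>.\<close>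
  have "openin (mor_top \<Lambda>) (U \<inter> mor_of_deg \<Lambda> ?p \<inter> {\<mu> \<in> mor \<Lambda>. rng \<Lambda> \<mu> \<in> W})"
    using U(1) W(1) openin_mor_of_deg openin_rng_preimage by (intro openin_Int)
  moreover have "\<xi> \<in> U \<inter> mor_of_deg \<Lambda> ?p \<inter> {\<mu> \<in> mor \<Lambda>. rng \<Lambda> \<mu> \<in> W}"
    using U(2) \<xi> W(2) starts_rng[OF x(1,2)] by (simp add: mor_of_deg_def)
  ultimately obtain N K where K: "openin (mor_top \<Lambda>) N" "compactin (mor_top \<Lambda>) K" "\<xi> \<in> N" "N \<subseteq> K"
    "K \<subseteq> U \<inter> mor_of_deg \<Lambda> ?p \<inter> {\<mu> \<in> mor \<Lambda>. rng \<Lambda> \<mu> \<in> W}"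
    by (rule compact_neighbourhood)
  then have KU: "K \<subseteq> U" "K \<subseteq> mor_of_deg \<Lambda> ?p" "\<And>\<kappa>. \<kappa> \<in> K \<Longrightarrow> rng \<Lambda> \<kappa> \<in> W" "K \<subseteq> mor \<Lambda>"
    by auto
  let ?E = "tails ?p K E"
  have tails_ex: "\<exists>\<tau>\<in>?E. \<exists>\<theta>. \<mu> \<preceq> \<theta> \<and> \<tau> \<preceq> \<theta>" if \<kappa>: "\<kappa> \<in> K" "(\<kappa>, \<mu>) \<in> composable \<Lambda>" for \<kappa> \<mu>
  proof -
    have "rng \<Lambda> (cmp \<Lambda> \<kappa> \<mu>) \<in> rng \<Lambda> ` E"
      using KU(3) \<kappa> W(3) rng_cmp by auto
    then obtain \<eta> \<theta> where \<theta>: "\<eta> \<in> E" "cmp \<Lambda> \<kappa> \<mu> \<preceq> \<theta>" "\<eta> \<preceq> \<theta>"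
      using CE_D(3)[OF E cmp_mor[OF \<kappa>(2)]] by blast
    obtain \<alpha> where \<alpha>: "(cmp \<Lambda> \<kappa> \<mu>, \<alpha>) \<in> composable \<Lambda>" "\<theta> = cmp \<Lambda> (cmp \<Lambda> \<kappa> \<mu>) \<alpha>"
      using \<theta>(2) by (auto simp: pre_def)
    have \<mu>\<alpha>: "(\<mu>, \<alpha>) \<in> composable \<Lambda>" "(\<kappa>, cmp \<Lambda> \<mu> \<alpha>) \<in> composable \<Lambda>" "\<theta> = cmp \<Lambda> \<kappa> (cmp \<Lambda> \<mu> \<alpha>)"
      using \<alpha> \<kappa>(2) cmp_composable(2,3) cmp_assoc by metis+
    then obtain \<tau> where "\<tau> \<in> ?E" "\<tau> \<preceq> cmp \<Lambda> \<mu> \<alpha>"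
      using tails_I[OF KU(2) \<kappa>(1) \<theta>(1)] \<theta>(3) by metis
    then show ?thesis
      using pre_cmp[OF \<mu>\<alpha>(1)] by blast
  qed
  \<comment> \<open>Applied to the vertex \<open>src \<Lambda> \<kappa>\<close>,
    \<open>tails_ex\<close> produces a tail with that range. Hence the ranges of the tails include
    the open set of sources of \<open>N\<close>, a neighbourhood of
    \<open>src \<Lambda> \<xi>\<close>.\<close>
  have src_tails: "src \<Lambda> ` K = rng \<Lambda> ` ?E"
  proof (intro equalityI subsetI)
    fix v assume "v \<in> src \<Lambda> ` K"
    then obtain \<kappa> where \<kappa>: "\<kappa> \<in> K" "v = src \<Lambda> \<kappa>"
      by blast
    have v: "v \<in> obj \<Lambda>"
      using \<kappa> KU(4) src_obj by auto
    then have "(\<kappa>, v) \<in> composable \<Lambda>"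
      using \<kappa> KU(4) obj_subset rng_id by (auto intro!: composableI)
    then obtain \<tau> \<theta> where "\<tau> \<in> ?E" "v \<preceq> \<theta>" "\<tau> \<preceq> \<theta>"
      using tails_ex[OF \<kappa>(1)] by blast
    then show "v \<in> rng \<Lambda> ` ?E"
      using pre_rng rng_id[OF v] by (metis imageI)
  next
    fix v assume "v \<in> rng \<Lambda> ` ?E"
    then show "v \<in> src \<Lambda> ` K"
      unfolding image_iff using tails_iff[OF KU(2)] composableD(3) by metis
  qed
  have "?E \<in> CE \<Lambda> (src \<Lambda> \<xi>)"
  proof (rule CE_I)
    show "compactin (mor_top \<Lambda>) ?E"
      using compactin_tails[OF ca deg_in[OF \<xi>] KU(2) K(2) CE_D(1)[OF E]] .
    show "openin (obj_top \<Lambda>) (src \<Lambda> ` N)"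
      using K(1) by (rule open_src)
    show "src \<Lambda> \<xi> \<in> src \<Lambda> ` N" "src \<Lambda> ` N \<subseteq> rng \<Lambda> ` ?E"
      using K src_tails by auto
  next
    fix \<mu> assume "\<mu> \<in> mor \<Lambda>" "rng \<Lambda> \<mu> \<in> rng \<Lambda> ` ?E"
    then obtain \<kappa> where "\<kappa> \<in> K" "(\<kappa>, \<mu>) \<in> composable \<Lambda>"
      using KU(4) unfolding src_tails[symmetric] composable_def by auto
    then show "\<exists>\<eta>\<in>?E. \<exists>\<theta>. \<mu> \<preceq> \<theta> \<and> \<eta> \<preceq> \<theta>"
      by (rule tails_ex)
  qed
  then obtain \<tau> where \<tau>: "\<tau> \<in> ?E" "starts (shift k ?p x) \<tau>"
    using x(3) starts_src[OF x(1,2)] by (auto simp: meets_CE_def)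
  obtain \<kappa> where \<kappa>: "\<kappa> \<in> K" "(\<kappa>, \<tau>) \<in> composable \<Lambda>" "cmp \<Lambda> \<kappa> \<tau> \<in> mce K E"
    using \<tau>(1) tails_iff[OF KU(2)] by blast
  \<comment> \<open>The tail came with some \<open>\<kappa>\<close> in \<open>K\<close>. Both
    \<open>\<kappa>\<close> and \<open>\<xi>\<close> end where the shifted path begins, so
    injectivity of the source on \<open>U\<close> identifies them.\<close>
  have "src \<Lambda> \<kappa> = src \<Lambda> \<xi>"
    using composableD(3)[OF \<kappa>(2)] starts_rng[OF _ \<tau>(2)] starts_src[OF x(1,2)] shift_path[OF x(1)] x(2)
    by (simp add: starts_def)
  then have "\<kappa> = \<xi>"
    using U(2,3) KU(1) \<kappa>(1) by (meson inj_onD subsetD)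
  then have "starts x (cmp \<Lambda> \<kappa> \<tau>)"
    using starts_cmp_iff[OF x(1,2)] \<kappa>(2) \<tau>(2) by simp
  moreover obtain \<eta> where "\<eta> \<in> E" "\<eta> \<preceq> cmp \<Lambda> \<kappa> \<tau>"
    using \<kappa>(3) by (auto simp: mce_def)
  ultimately show "\<exists>\<mu>\<in>E. starts x \<mu>"
    using starts_pre[OF x(1)] by blast
qed

text \<open>A shift of the new path by \<open>m\<close> may still begin inside \<open>\<mu>\<close>.
  Shifting on to \<open>sup m (deg \<Lambda> \<mu>)\<close> reaches a shift of \<open>x\<close>,
  where the condition is known, and \<open>meets_CE_if_shift\<close> carries it back.\<close>

lemma boundary_prepend:
  assumes ca: "compactly_aligned k \<Lambda>"
    and \<mu>: "\<mu> \<in> mor \<Lambda>" and x: "x \<in> boundary_paths k \<Lambda>" "prng x = src \<Lambda> \<mu>"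
  shows "prepend k \<Lambda> \<mu> x \<in> boundary_paths k \<Lambda>"
proof -
  let ?y = "prepend k \<Lambda> \<mu> x" and ?l = "deg \<Lambda> \<mu>"
  have xp: "x \<in> path_space k \<Lambda>" "\<And>m. edeg m \<le> pdeg x \<Longrightarrow> meets_CE (shift k m x)"
    using x(1) by (auto simp: boundary_paths_iff)
  note y = prepend_path[OF \<mu> xp(1) x(2)] shift_prepend[OF \<mu> xp(1) x(2)] pdeg_prepend[OF \<mu> xp(1) x(2)]
  have "meets_CE (shift k m ?y)" if m: "edeg m \<le> pdeg ?y" for m
  proof -
    let ?n = "sup m ?l - ?l" and ?z = "shift k m ?y"
    have n: "edeg ?n \<le> pdeg x"
      using m unfolding y(3) by (rule edeg_sup_diff_le)
    have s: "edeg (sup m ?l) \<le> pdeg ?y"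
      using m y(3) by (intro edeg_sup_le) simp_all
    have z: "?z \<in> path_space k \<Lambda>"
      using m y by (simp add: shift_path)
    let ?\<xi> = "seg ?z 0 (sup m ?l - m)"
    have le: "edeg (sup m ?l - m) \<le> pdeg ?z"
      using s m by (simp add: edeg_le_diff_iff)
    have "shift k (sup m ?l - m) ?z = shift k (sup m ?l) ?y"
      using shift_shift[OF y(1), of m "sup m ?l - m"] s by simp
    also have "\<dots> = shift k ?n (shift k ?l ?y)"
      using shift_shift[OF y(1), of ?l ?n] s by simp
    finally have "shift k (deg \<Lambda> ?\<xi>) ?z = shift k ?n x"
      using y(2) deg_seg0[OF z le] by simp
    then show ?thesis
      using meets_CE_if_shift[OF ca z starts_seg[OF z le]] xp(2)[OF n] by simp
  qed
  then show ?thesis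
    using y(1) by (simp add: boundary_paths_iff)
qed

text \<open>If \<open>x\<close> avoids \<open>F\<close>, then the tails of the minimal common extensions of \<open>F\<close> with a
  neighbourhood of \<open>\<mu>\<close> are not exhaustive at \<open>s(\<mu>)\<close>, so some extension of \<open>\<mu>\<close> is incompatible
  with \<open>F\<close>; by compactness this persists nearby.\<close>

lemma boundary_avoid:
  assumes ca: "compactly_aligned k \<Lambda>"
    and x: "x \<in> boundary_paths k \<Lambda>" "starts x \<mu>" "\<And>\<phi>. \<phi> \<in> F \<Longrightarrow> \<not> starts x \<phi>"
    and U: "openin (mor_top \<Lambda>) U" "\<mu> \<in> U" and F: "compactin (mor_top \<Lambda>) F"
  obtains M where "openin (mor_top \<Lambda>) M" "M \<noteq> {}"
    "\<And>\<nu>. \<nu> \<in> M \<Longrightarrow> \<exists>\<kappa>\<in>U. (\<kappa>, \<nu>) \<in> composable \<Lambda> \<and>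
       (\<forall>\<phi>\<in>F. \<forall>\<theta>. cmp \<Lambda> \<kappa> \<nu> \<preceq> \<theta> \<longrightarrow> \<not> \<phi> \<preceq> \<theta>)"
proof -
  let ?p = "deg \<Lambda> \<mu>"
  have xp: "x \<in> path_space k \<Lambda>" "edeg ?p \<le> pdeg x" "meets_CE (shift k ?p x)"
    using x by (auto simp: boundary_paths_iff starts_def)
  have \<mu>: "\<mu> \<in> mor \<Lambda>"
    using starts_mor x(2) xp(1) by blast
  obtain U' where U': "openin (mor_top \<Lambda>) U'" "\<mu> \<in> U'" "inj_on (src \<Lambda>) U'"
    using src_locally_injective[OF \<mu>] by metis
  have "openin (mor_top \<Lambda>) (U \<inter> U' \<inter> mor_of_deg \<Lambda> ?p)"
    using U U' openin_mor_of_deg by (intro openin_Int)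
  moreover have "\<mu> \<in> U \<inter> U' \<inter> mor_of_deg \<Lambda> ?p"
    using U U' \<mu> by (simp add: mor_of_deg_def)
  ultimately obtain O' K where K: "openin (mor_top \<Lambda>) O'" "compactin (mor_top \<Lambda>) K" "\<mu> \<in> O'" "O' \<subseteq> K"
    "K \<subseteq> U \<inter> U' \<inter> mor_of_deg \<Lambda> ?p"
    by (rule compact_neighbourhood)
  then have KU: "K \<subseteq> mor_of_deg \<Lambda> ?p" "K \<subseteq> mor \<Lambda>" "K \<subseteq> U" "inj_on (src \<Lambda>) K"
    using U'(3) inj_on_subset by (auto simp: mor_of_deg_def)
  define G where "G = tails ?p K F"
  have G: "compactin (mor_top \<Lambda>) G"
    unfolding G_def using compactin_tails[OF ca deg_in[OF \<mu>] KU(1) K(2) F] .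
  have "openin (obj_top \<Lambda>) (src \<Lambda> ` O')" "src \<Lambda> \<mu> \<in> src \<Lambda> ` O'"
    using K open_src by auto
  then obtain W C where C: "openin (obj_top \<Lambda>) W" "compactin (obj_top \<Lambda>) C" "src \<Lambda> \<mu> \<in> W" "W \<subseteq> C"
    "C \<subseteq> src \<Lambda> ` O'"
    by (rule compact_neighbourhood_obj)
  \<comment> \<open>Keeping only ranges in \<open>C\<close>, a compact set of sources of
    \<open>O'\<close>, ensures that whatever witnesses the failure of \<open>E\<close> can be
    preceded by a segment from \<open>O'\<close>.\<close>
  define E where "E = {\<mu> \<in> mor \<Lambda>. rng \<Lambda> \<mu> \<in> C} \<inter> G"
  have "closedin (mor_top \<Lambda>) {\<mu> \<in> mor \<Lambda>. rng \<Lambda> \<mu> \<in> C}"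
    using closedin_continuous_map_preimage[OF continuous_rng compactin_imp_closedin[OF Hausdorff_obj C(2)]]
    by simp
  then have E: "compactin (mor_top \<Lambda>) E"
    unfolding E_def using G by (rule closed_Int_compactin)
  have "\<not> starts (shift k ?p x) \<tau>" if \<tau>E: "\<tau> \<in> E" for \<tau>
  proof
    assume \<tau>: "starts (shift k ?p x) \<tau>"
    obtain \<kappa> where \<kappa>: "\<kappa> \<in> K" "(\<kappa>, \<tau>) \<in> composable \<Lambda>" "cmp \<Lambda> \<kappa> \<tau> \<in> mce K F"
      using \<tau>E tails_iff[OF KU(1)] by (auto simp: E_def G_def)
    have "src \<Lambda> \<kappa> = src \<Lambda> \<mu>"
      using composableD(3)[OF \<kappa>(2)] starts_rng[OF _ \<tau>] starts_src[OF xp(1) x(2)] shift_path[OF xp(1,2)]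
      by simp
    then have "\<kappa> = \<mu>"
      using KU(4) \<kappa>(1) K(3,4) by (meson inj_onD subsetD)
    then have "starts x (cmp \<Lambda> \<kappa> \<tau>)"
      using starts_cmp_iff[OF xp(1) x(2)] \<kappa>(2) \<tau> by simp
    moreover obtain \<phi> where "\<phi> \<in> F" "\<phi> \<preceq> cmp \<Lambda> \<kappa> \<tau>"
      using \<kappa>(3) by (auto simp: mce_def)
    ultimately show False
      using starts_pre[OF xp(1)] x(3) by blast
  qed
  then have "E \<notin> CE \<Lambda> (src \<Lambda> \<mu>)"
    using xp(3) starts_src[OF xp(1) x(2)] by (auto simp: meets_CE_def)
  have E_rng: "rng \<Lambda> \<eta> \<in> C \<longleftrightarrow> \<eta> \<in> E" if "\<eta> \<in> G" for \<eta>
    using that compactin_subset_topspace[OF G] by (auto simp: E_def)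
  obtain \<nu>\<^sub>0 where \<nu>\<^sub>0: "\<nu>\<^sub>0 \<in> mor \<Lambda>" "rng \<Lambda> \<nu>\<^sub>0 \<in> C" "\<And>\<eta> \<theta>. \<eta> \<in> G \<Longrightarrow> \<nu>\<^sub>0 \<preceq> \<theta> \<Longrightarrow> \<not> \<eta> \<preceq> \<theta>"
  \<comment> \<open>There are two ways for \<open>E\<close> not to be in \<open>CE\<close>: some
    morphism with range in \<open>r(E)\<close> is incompatible with all of \<open>E\<close>, or
    \<open>r(E)\<close> misses a vertex of \<open>W\<close>, and then that vertex is itself a
    witness.\<close>
  proof (cases "W \<subseteq> rng \<Lambda> ` E")
    case True
    then obtain \<nu> where \<nu>: "\<nu> \<in> mor \<Lambda>" "rng \<Lambda> \<nu> \<in> rng \<Lambda> ` E" "\<And>\<eta> \<theta>. \<eta> \<in> E \<Longrightarrow> \<nu> \<preceq> \<theta> \<Longrightarrow> \<not> \<eta> \<preceq> \<theta>"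
      using CE_I[OF E C(1,3)] \<open>E \<notin> CE \<Lambda> (src \<Lambda> \<mu>)\<close> by blast
    then have "rng \<Lambda> \<nu> \<in> C"
      by (auto simp: E_def)
    moreover have "\<not> \<eta> \<preceq> \<theta>" if "\<eta> \<in> G" "\<nu> \<preceq> \<theta>" for \<eta> \<theta>
      using that \<nu>(3) E_rng pre_rng \<open>rng \<Lambda> \<nu> \<in> C\<close> by metis
    ultimately show thesis
      using that \<nu>(1) by blast
  next
    case False
    then obtain w where w: "w \<in> W" "w \<notin> rng \<Lambda> ` E"
      by blast
    then have "w \<in> obj \<Lambda>" "w \<in> C"
      using C openin_subset by fastforce+
    moreover have "\<not> \<eta> \<preceq> \<theta>" if "\<eta> \<in> G" "w \<preceq> \<theta>" for \<eta> \<theta>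
      using that w E_rng pre_rng rng_id[OF \<open>w \<in> obj \<Lambda>\<close>] \<open>w \<in> C\<close> by (metis imageI)
    ultimately show thesis
      using that[of w] obj_subset rng_id by auto
  qed
  let ?n = "deg \<Lambda> \<nu>\<^sub>0"
  have "openin (mor_top \<Lambda>) (mor_of_deg \<Lambda> ?n \<inter> {\<nu> \<in> mor \<Lambda>. rng \<Lambda> \<nu> \<in> src \<Lambda> ` O'})"
    using K(1) by (intro openin_Int openin_mor_of_deg openin_rng_preimage open_src)
  moreover have "\<nu>\<^sub>0 \<in> mor_of_deg \<Lambda> ?n \<inter> {\<nu> \<in> mor \<Lambda>. rng \<Lambda> \<nu> \<in> src \<Lambda> ` O'}"
    using \<nu>\<^sub>0 C(5) by (auto simp: mor_of_deg_def)
  ultimately obtain N L where L: "openin (mor_top \<Lambda>) N" "compactin (mor_top \<Lambda>) L" "\<nu>\<^sub>0 \<in> N" "N \<subseteq> L"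
    "L \<subseteq> mor_of_deg \<Lambda> ?n \<inter> {\<nu> \<in> mor \<Lambda>. rng \<Lambda> \<nu> \<in> src \<Lambda> ` O'}"
    by (rule compact_neighbourhood)
  then have Ln: "L \<subseteq> mor_of_deg \<Lambda> ?n"
    by blast
  \<comment> \<open>The elements of \<open>L\<close> having a common extension with
    \<open>G\<close>. They form a compact, hence closed, set that misses the witness, so
    incompatibility with \<open>G\<close> is an open condition near it.\<close>
  define B where "B = (\<lambda>\<theta>. ini \<theta> ?n) ` mce L G"
  have "compactin (mor_top \<Lambda>) B"
    unfolding B_def using compactin_mce[OF ca deg_in[OF \<nu>\<^sub>0(1)] Ln L(2) G] mce_deg[OF _ Ln]
    by (rule compactin_ini_image)
  then have "closedin (mor_top \<Lambda>) B"
    by (rule compactin_imp_closedin[OF Hausdorff_mor])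
  show thesis
  proof
    show "openin (mor_top \<Lambda>) (N - B)"
      using L(1) \<open>closedin (mor_top \<Lambda>) B\<close> by (rule openin_diff)
    have "\<nu>\<^sub>0 \<notin> B"
    proof
      assume "\<nu>\<^sub>0 \<in> B"
      then obtain \<theta> where "\<theta> \<in> mce L G" "\<nu>\<^sub>0 = ini \<theta> ?n"
        unfolding B_def by blast
      moreover from this have "\<nu>\<^sub>0 \<preceq> \<theta>"
        using ini_pre[of \<theta> ?n] mce_deg[OF _ Ln] pre_mor by (auto simp: mce_def)
      ultimately show False
        using \<nu>\<^sub>0(3) by (auto simp: mce_def)
    qed
    then show "N - B \<noteq> {}"
      using L(3) by blast
    fix \<nu> assume \<nu>: "\<nu> \<in> N - B"
    then have "\<nu> \<in> L"
      using L(4) by blast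
    then have \<nu>': "\<nu> \<in> mor \<Lambda>" "deg \<Lambda> \<nu> = ?n" "rng \<Lambda> \<nu> \<in> src \<Lambda> ` O'"
      using L(5) by (auto simp: mor_of_deg_def)
    then obtain \<kappa> where "\<kappa> \<in> O'" "src \<Lambda> \<kappa> = rng \<Lambda> \<nu>"
      by auto
    then have \<kappa>: "\<kappa> \<in> K" "(\<kappa>, \<nu>) \<in> composable \<Lambda>"
      using K(4) KU(2) \<nu>'(1) by (auto simp: composable_def)
    \<comment> \<open>Removing \<open>\<kappa>\<close> from a common extension of
      \<open>cmp \<Lambda> \<kappa> \<nu>\<close> and \<open>\<phi>\<close> leaves a common
      extension of \<open>\<nu>\<close> and a tail in \<open>G\<close>, which would place
      \<open>\<nu>\<close> in \<open>B\<close>.\<close>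
    have False if \<theta>: "\<phi> \<in> F" "cmp \<Lambda> \<kappa> \<nu> \<preceq> \<theta>" "\<phi> \<preceq> \<theta>" for \<phi> \<theta>
    proof -
      obtain \<beta> where \<beta>: "(\<kappa>, \<beta>) \<in> composable \<Lambda>" "\<theta> = cmp \<Lambda> \<kappa> \<beta>"
        using pre_trans[OF pre_cmp[OF \<kappa>(2)] \<theta>(2)] by (auto simp: pre_def)
      have "\<nu> \<preceq> \<beta>"
        using \<theta>(2) \<beta> \<kappa>(2) pre_cmp_iff by simp
      moreover obtain \<tau> where "\<tau> \<in> G" "\<tau> \<preceq> \<beta>"
        using tails_I[OF KU(1) \<kappa>(1) \<theta>(1) \<beta>(1)] \<theta>(3) \<beta>(2) unfolding G_def by blast
      ultimately obtain \<xi> where "\<xi> \<in> mce L G" "\<nu> \<preceq> \<xi>"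
        using ini_in_mce[OF \<open>\<nu> \<in> L\<close>] by metis
      then have "\<nu> \<in> B"
        unfolding B_def using pre_ini \<nu>'(2) by (metis rev_image_eqI)
      then show False
        using \<nu> by blast
    qed
    then show "\<exists>\<kappa>\<in>U. (\<kappa>, \<nu>) \<in> composable \<Lambda> \<and> (\<forall>\<phi>\<in>F. \<forall>\<theta>. cmp \<Lambda> \<kappa> \<nu> \<preceq> \<theta> \<longrightarrow> \<not> \<phi> \<preceq> \<theta>)"
      using \<kappa> KU(3) by blast
  qed
qed


section \<open>Existence of boundary paths\<close>

text \<open>A path is determined by its set of initial segments; the sets that occur are the nonempty
  hereditary directed ones.\<close>

definition path_filter :: "'a set \<Rightarrow> bool" where
  "path_filter S \<longleftrightarrow> S \<subseteq> mor \<Lambda> \<and> S \<noteq> {} \<and> (\<forall>\<theta>\<in>S. \<forall>\<mu>. \<mu> \<preceq> \<theta> \<longrightarrow> \<mu> \<in> S) \<and>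
    (\<forall>\<mu>\<in>S. \<forall>\<nu>\<in>S. \<exists>\<theta>\<in>S. \<mu> \<preceq> \<theta> \<and> \<nu> \<preceq> \<theta>)"

lemma path_filterD:
  assumes "path_filter S"
  shows "S \<subseteq> mor \<Lambda>" "S \<noteq> {}" "\<And>\<mu> \<theta>. \<theta> \<in> S \<Longrightarrow> \<mu> \<preceq> \<theta> \<Longrightarrow> \<mu> \<in> S"
    "\<And>\<mu> \<nu>. \<mu> \<in> S \<Longrightarrow> \<nu> \<in> S \<Longrightarrow> \<exists>\<theta>\<in>S. \<mu> \<preceq> \<theta> \<and> \<nu> \<preceq> \<theta>"
  using assms unfolding path_filter_def by blast+

lemma path_filter_upper_bound:
  assumes S: "path_filter S" and "finite F" "F \<subseteq> S"
  shows "\<exists>u\<in>S. \<forall>\<mu>\<in>F. \<mu> \<preceq> u"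
  using assms(2,3)
proof (induction F)
  case empty
  then show ?case
    using path_filterD(2)[OF S] by blast
next
  case (insert \<mu> F)
  then obtain u where u: "u \<in> S" "\<forall>\<nu>\<in>F. \<nu> \<preceq> u"
    by blast
  moreover obtain w where "w \<in> S" "\<mu> \<preceq> w" "u \<preceq> w"
    using path_filterD(4)[OF S _ u(1), of \<mu>] insert.prems by blast
  ultimately show ?case
    using pre_trans by blast
qed

text \<open>The degree is the coordinatewise supremum. Every finite \<open>q\<close> below it is the
  degree of exactly one member: directedness gives a member of degree at least \<open>q\<close>, to
  be cut back to \<open>q\<close>.\<close>

lemma path_of_filter:
  assumes S: "path_filter S"
  obtains x where "x \<in> path_space k \<Lambda>" "\<And>\<mu>. starts x \<mu> \<longleftrightarrow> \<mu> \<in> S"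
proof -
  note SD = path_filterD[OF S]
  define d where "d i = (SUP \<theta>\<in>S. enat (deg \<Lambda> \<theta> i))" for i
  have d: "d \<in> NInfk k"
    unfolding NInfk_def
  proof (intro CollectI allI impI)
    fix i assume "k \<le> i"
    then have "enat (deg \<Lambda> \<theta> i) = 0" if "\<theta> \<in> S" for \<theta>
      using deg_in[of \<theta>] SD(1) that by (auto simp: Nk_def zero_enat_def)
    then show "d i = 0"
      unfolding d_def using SD(2) by (simp cong: SUP_cong)
  qed
  have le_d: "edeg (deg \<Lambda> \<theta>) \<le> d" if "\<theta> \<in> S" for \<theta>
    unfolding le_fun_def edeg_def d_def using that by (auto intro: SUP_upper)
  have uniq: "\<mu> \<preceq> \<nu>" if "\<mu> \<in> S" "\<nu> \<in> S" "deg \<Lambda> \<mu> \<le> deg \<Lambda> \<nu>" for \<mu> \<nu>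
    using SD(4)[OF that(1,2)] pre_linear that(3) by blast
  have ex: "\<exists>\<mu>\<in>S. deg \<Lambda> \<mu> = q" if q: "edeg q \<le> d" for q
  proof -
    have "\<exists>\<theta>\<in>S. q i \<le> deg \<Lambda> \<theta> i" for i
    proof (rule ccontr)
      assume "\<not> (\<exists>\<theta>\<in>S. q i \<le> deg \<Lambda> \<theta> i)"
      then have lt: "deg \<Lambda> \<theta> i < q i" if "\<theta> \<in> S" for \<theta>
        using that by (meson not_le)
      \<comment> \<open>For natural numbers \<open>< q i\<close> means \<open>\<le> q i - 1\<close>,
        so the supremum stays below \<open>q i\<close>. Positivity of \<open>q i\<close>, from
        \<open>S\<close> being nonempty, keeps the subtraction honest.\<close>
      then have "d i \<le> enat (q i - 1)"
        unfolding d_def by (intro SUP_least) force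
      moreover have "enat (q i) \<le> d i"
        using le_funD[OF q, of i] by (simp add: edeg_def)
      moreover have "q i > 0"
        using lt SD(2) by fastforce
      ultimately have "enat (q i) \<le> enat (q i - 1)"
        by (meson order_trans)
      then show False
        using \<open>q i > 0\<close> by simp
    qed
    then obtain t where t: "\<And>i. t i \<in> S" "\<And>i. q i \<le> deg \<Lambda> (t i) i"
      by metis
    \<comment> \<open>Only the first \<open>k\<close> coordinates of \<open>q\<close> can be
      nonzero, so finitely many of the \<open>t i\<close> need an upper bound.\<close>
    obtain u where u: "u \<in> S" "\<forall>\<mu>\<in>t ` {..<k}. \<mu> \<preceq> u"
      using path_filter_upper_bound[OF S, of "t ` {..<k}"] t(1) by blast
    have "q i \<le> deg \<Lambda> u i" for i
    proof (cases "i < k")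
      case True
      then have "deg \<Lambda> (t i) \<le> deg \<Lambda> u"
        using u(2) pre_deg by blast
      then show ?thesis
        using t(2)[of i] le_funD order_trans by metis
    next
      case False
      then show ?thesis
        using NInfk_edeg_le[OF q d] by (simp add: Nk_def)
    qed
    then have "q \<le> deg \<Lambda> u"
      by (simp add: le_fun_def)
    then show ?thesis
      using SD(1) SD(3)[OF u(1) ini_pre] u(1) deg_ini by blast
  qed
  define h where "h q = (SOME \<mu>. \<mu> \<in> S \<and> deg \<Lambda> \<mu> = q)" for q
  have h: "h q \<in> S" "deg \<Lambda> (h q) = q" if "edeg q \<le> d" for q
    using someI_ex[of "\<lambda>\<mu>. \<mu> \<in> S \<and> deg \<Lambda> \<mu> = q"] ex[OF that] unfolding h_def by blast+
  obtain x where x: "x \<in> path_space k \<Lambda>" "pdeg x = d" "\<And>q. edeg q \<le> d \<Longrightarrow> seg x 0 q = h q"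
  proof (rule path_of_initial_segments[OF d, of h])
    show "h q \<in> mor \<Lambda>" "deg \<Lambda> (h q) = q" if "edeg q \<le> d" for q
      using h[OF that] SD(1) by auto
    show "h p \<preceq> h q" if "p \<le> q" "edeg q \<le> d" for p q
      using h[OF that(2)] h[OF edeg_le_trans[OF that]] that(1) by (intro uniq) simp_all
  qed blast
  have "starts x \<mu> \<longleftrightarrow> \<mu> \<in> S" for \<mu>
  proof
    assume "starts x \<mu>"
    then show "\<mu> \<in> S"
      using h x unfolding starts_def by metis
  next
    assume \<mu>: "\<mu> \<in> S"
    note hm = h[OF le_d[OF \<mu>]]
    have "h (deg \<Lambda> \<mu>) = \<mu>"
      using uniq[OF hm(1) \<mu>] pre_eq[OF _ pre_refl, of "h (deg \<Lambda> \<mu>)" \<mu>] hm(2) \<mu> SD(1) by auto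
    then show "starts x \<mu>"
      using x le_d[OF \<mu>] by (simp add: starts_def)
  qed
  then show thesis
    using that x(1) by blast
qed

text \<open>If \<open>x\<close> avoided \<open>\<kappa>E\<close> with \<open>E\<close> exhaustive at \<open>s(\<kappa>)\<close>, a compatible choice of minimal common
  extensions of the initial segments of \<open>x\<close> with elements of \<open>\<kappa>E\<close> would extend \<open>x\<close>; such a choice
  is a point of an inverse limit of nonempty compact sets.\<close>

lemma maximal_path_boundary:
  assumes ca: "compactly_aligned k \<Lambda>"
    and S: "path_filter S" "\<And>T. path_filter T \<Longrightarrow> S \<subseteq> T \<Longrightarrow> T = S"
    and x: "x \<in> path_space k \<Lambda>" "\<And>\<mu>. starts x \<mu> \<longleftrightarrow> \<mu> \<in> S"
  shows "x \<in> boundary_paths k \<Lambda>"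
  unfolding boundary_paths_iff meets_CE_def
proof (intro conjI allI impI ballI)
  fix m E assume m: "edeg m \<le> pdeg x" and "E \<in> CE \<Lambda> (prng (shift k m x))"
  note SD = path_filterD[OF S(1)]
  define \<kappa> where "\<kappa> = seg x 0 m"
  have \<kappa>: "\<kappa> \<in> S" "\<kappa> \<in> mor \<Lambda>" "deg \<Lambda> \<kappa> = m" "starts x \<kappa>"
    using x m by (auto simp: \<kappa>_def seg0_mor deg_seg0 starts_seg simp flip: x(2))
  have E: "E \<in> CE \<Lambda> (src \<Lambda> \<kappa>)"
    using \<open>E \<in> CE \<Lambda> (prng (shift k m x))\<close> prng_shift[OF x(1) m] by (simp add: \<kappa>_def)
  define D where "D = set_cmp \<Lambda> {\<kappa>} E"
  have D: "compactin (mor_top \<Lambda>) D"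
    unfolding D_def using compactin_cmp_image[OF \<kappa>(2) CE_D(1)[OF E]] .
  define I where "I = {\<nu> \<in> S. \<kappa> \<preceq> \<nu>}"
  have I_bound: "\<exists>u\<in>I. \<forall>\<mu>\<in>F. \<mu> \<preceq> u" if F: "finite F" "F \<subseteq> S" for F
    using path_filter_upper_bound[OF S(1), of "insert \<kappa> F"] F \<kappa>(1) by (auto simp: I_def)
  have D_ex: "\<exists>\<delta>\<in>D. \<exists>\<theta>. \<nu> \<preceq> \<theta> \<and> \<delta> \<preceq> \<theta>" if \<nu>: "\<nu> \<in> I" for \<nu>
  proof -
    obtain \<nu>' where \<nu>': "(\<kappa>, \<nu>') \<in> composable \<Lambda>" "\<nu> = cmp \<Lambda> \<kappa> \<nu>'"
      using \<nu> by (auto simp: I_def pre_def)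
    have "rng \<Lambda> \<nu>' \<in> rng \<Lambda> ` E"
      using CE_D(2)[OF E] composableD(3)[OF \<nu>'(1)] by auto
    then obtain \<eta> \<theta> where \<eta>: "\<eta> \<in> E" "\<nu>' \<preceq> \<theta>" "\<eta> \<preceq> \<theta>"
      using CE_D(3)[OF E composableD(2)[OF \<nu>'(1)]] by blast
    then have c: "(\<kappa>, \<eta>) \<in> composable \<Lambda>" "(\<kappa>, \<theta>) \<in> composable \<Lambda>"
      using \<nu>'(1) pre_rng pre_mor by (auto simp: composable_def)
    then have "cmp \<Lambda> \<kappa> \<eta> \<in> D" "\<nu> \<preceq> cmp \<Lambda> \<kappa> \<theta>" "cmp \<Lambda> \<kappa> \<eta> \<preceq> cmp \<Lambda> \<kappa> \<theta>"
      using \<eta> \<nu>' pre_cmp_iff by (auto simp: D_def set_cmp_def)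
    then show ?thesis
      by blast
  qed
  \<comment> \<open>One degree \<open>e\<close> works for all \<open>\<nu>\<close>: otherwise each
    of the finitely many degrees of \<open>D\<close> fails at some member of \<open>I\<close>, and
    an upper bound of these members would be incompatible with all of \<open>D\<close>.\<close>
  obtain e where e: "\<And>\<nu>. \<nu> \<in> I \<Longrightarrow> \<exists>\<delta>\<in>D. deg \<Lambda> \<delta> = e \<and> (\<exists>\<theta>. \<nu> \<preceq> \<theta> \<and> \<delta> \<preceq> \<theta>)"
  proof (rule ccontr)
    assume "\<not> thesis"
    then have "\<forall>e. \<exists>\<nu>\<in>I. \<forall>\<delta>\<in>D. deg \<Lambda> \<delta> = e \<longrightarrow> \<not> (\<exists>\<theta>. \<nu> \<preceq> \<theta> \<and> \<delta> \<preceq> \<theta>)"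
      using that by meson
    then obtain b where b: "\<And>e. b e \<in> I" "\<And>e \<delta> \<theta>. \<delta> \<in> D \<Longrightarrow> deg \<Lambda> \<delta> = e \<Longrightarrow> b e \<preceq> \<theta> \<Longrightarrow> \<not> \<delta> \<preceq> \<theta>"
      by metis
    have "finite (b ` deg \<Lambda> ` D)" "b ` deg \<Lambda> ` D \<subseteq> S"
      using finite_deg_image[OF D] b(1) by (auto simp: I_def)
    then obtain u where u: "u \<in> I" "\<forall>\<mu>\<in>b ` deg \<Lambda> ` D. \<mu> \<preceq> u"
      using I_bound by meson
    obtain \<delta> \<theta> where "\<delta> \<in> D" "u \<preceq> \<theta>" "\<delta> \<preceq> \<theta>"
      using D_ex[OF u(1)] by blast
    then show False
      using b(2)[of \<delta> "deg \<Lambda> \<delta>" \<theta>] u(2) pre_trans by blast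
  qed
  \<comment> \<open>Since \<open>e\<close> is fixed, all elements of \<open>C \<nu>\<close> have
    degree \<open>sup (deg \<Lambda> \<nu>) e\<close>, and cutting to that degree gives the
    connecting maps of the inverse system.\<close>
  define C where "C \<nu> = mce {\<nu>} (D \<inter> mor_of_deg \<Lambda> e)" for \<nu>
  have C: "\<theta> \<in> C \<nu> \<longleftrightarrow> \<nu> \<preceq> \<theta> \<and> (\<exists>\<delta>\<in>D. deg \<Lambda> \<delta> = e \<and> \<delta> \<preceq> \<theta>) \<and> deg \<Lambda> \<theta> = sup (deg \<Lambda> \<nu>) e" for \<nu> \<theta>
    using pre_mor by (auto simp: C_def mce_def mor_of_deg_def)
  let ?f = "\<lambda>\<nu> \<nu>' \<theta>. ini \<theta> (sup (deg \<Lambda> \<nu>) e)"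
  have f_deg: "sup (deg \<Lambda> \<nu>) e \<le> deg \<Lambda> \<theta>" "\<theta> \<in> mor \<Lambda>" if "\<nu> \<preceq> \<nu>'" "\<theta> \<in> C \<nu>'" for \<nu> \<nu>' \<theta>
    using that pre_deg[OF that(1)] pre_mor C by (auto intro: le_supI1)
  obtain t where t: "\<And>\<nu>. \<nu> \<in> I \<Longrightarrow> t \<nu> \<in> C \<nu>"
    "\<And>\<nu> \<nu>'. \<nu> \<in> I \<Longrightarrow> \<nu>' \<in> I \<Longrightarrow> \<nu> \<preceq> \<nu>' \<Longrightarrow> ini (t \<nu>') (sup (deg \<Lambda> \<nu>) e) = t \<nu>"
  proof (rule inverse_limit_nonempty[where X = "mor_top \<Lambda>" and I = I and le = "(\<preceq>)" and C = C and f = ?f])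
    show "Hausdorff_space (mor_top \<Lambda>)"
      by (rule Hausdorff_mor)
    show "\<exists>u\<in>I. \<forall>i\<in>F. i \<preceq> u" if "finite F" "F \<subseteq> I" for F
      using I_bound that by (auto simp: I_def)
    show "compactin (mor_top \<Lambda>) (C \<nu>)" if "\<nu> \<in> I" for \<nu>
    proof -
      have "\<nu> \<in> mor \<Lambda>"
        using that SD(1) by (auto simp: I_def)
      then show ?thesis
        unfolding C_def using D deg_in
        by (intro compactin_mce[OF ca, of "deg \<Lambda> \<nu>"] compactin_mor_of_deg_Int) (auto simp: mor_of_deg_def)
    qed
    show "C \<nu> \<noteq> {}" if "\<nu> \<in> I" for \<nu>
    proof -
      obtain \<delta> \<theta> where *: "\<delta> \<in> D" "deg \<Lambda> \<delta> = e" "\<nu> \<preceq> \<theta>" "\<delta> \<preceq> \<theta>"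
        using e[OF \<open>\<nu> \<in> I\<close>] by blast
      then have "\<delta> \<in> D \<inter> mor_of_deg \<Lambda> e"
        using pre_mor(1)[OF *(4)] by (simp add: mor_of_deg_def)
      from ini_in_mce[OF singletonI this *(3,4)] show ?thesis
        unfolding C_def by blast
    qed
    show "?f \<nu> \<nu>' \<theta> \<in> C \<nu>" if *: "\<nu> \<in> I" "\<nu>' \<in> I" "\<nu> \<preceq> \<nu>'" "\<theta> \<in> C \<nu>'" for \<nu> \<nu>' \<theta>
    proof -
      note fd = f_deg[OF *(3,4)]
      note i = ini_pre[OF fd(2,1)] deg_ini[OF fd(2,1)]
      obtain \<delta> where \<delta>: "\<delta> \<in> D" "deg \<Lambda> \<delta> = e" "\<delta> \<preceq> \<theta>"
        using *(4) C by blast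
      have "\<nu> \<preceq> \<theta>"
        using *(3,4) C pre_trans by blast
      then have "\<nu> \<preceq> ?f \<nu> \<nu>' \<theta>" "\<delta> \<preceq> ?f \<nu> \<nu>' \<theta>"
        using \<delta> i by (auto intro!: pre_linear[of _ \<theta>])
      then show ?thesis
        using C \<delta> i(2) by blast
    qed
    show "continuous_map (subtopology (mor_top \<Lambda>) (C \<nu>')) (mor_top \<Lambda>) (?f \<nu> \<nu>')" if "\<nu> \<preceq> \<nu>'" for \<nu> \<nu>'
      using continuous_map_from_subtopology_mono[OF continuous_ini] f_deg[OF that] by blast
    show "?f \<nu> \<nu>' (?f \<nu>' u \<theta>) = ?f \<nu> u \<theta>" if "\<nu> \<preceq> \<nu>'" "\<nu>' \<preceq> u" "\<theta> \<in> C u" for \<nu> \<nu>' u \<theta>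
      using f_deg[OF that(2,3)] pre_deg[OF that(1)] by (intro ini_ini sup_mono) auto
  qed blast
  have t_pre: "t \<nu> \<preceq> t \<nu>'" if "\<nu> \<in> I" "\<nu>' \<in> I" "\<nu> \<preceq> \<nu>'" for \<nu> \<nu>'
    using ini_pre[OF f_deg(2,1)[OF that(3) t(1)[OF that(2)]]] t(2)[OF that] by simp
  \<comment> \<open>The initial segments of the coherent choice form a filter containing
    \<open>S\<close>. Maximality makes it equal to \<open>S\<close>, so the element of
    \<open>D\<close> below \<open>t \<kappa>\<close> is already an initial segment of
    \<open>x\<close>.\<close>
  define T where "T = {\<mu>. \<exists>\<nu>\<in>I. \<mu> \<preceq> t \<nu>}"
  have tT: "t \<nu> \<in> T" if "\<nu> \<in> I" for \<nu>
    using that pre_refl pre_mor(2) t(1)[OF that] C unfolding T_def by blast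
  have "\<kappa> \<in> I"
    using \<kappa>(1,2) pre_refl by (simp add: I_def)
  have "path_filter T"
    unfolding path_filter_def
  proof (intro conjI ballI allI impI)
    show "T \<subseteq> mor \<Lambda>"
      using pre_mor by (auto simp: T_def)
    show "T \<noteq> {}"
      using tT \<open>\<kappa> \<in> I\<close> by blast
    show "\<mu> \<in> T" if "\<theta> \<in> T" "\<mu> \<preceq> \<theta>" for \<mu> \<theta>
      using that pre_trans unfolding T_def by blast
    fix \<mu> \<mu>' assume "\<mu> \<in> T" "\<mu>' \<in> T"
    then obtain \<nu> \<nu>' where \<nu>: "\<nu> \<in> I" "\<nu>' \<in> I" "\<mu> \<preceq> t \<nu>" "\<mu>' \<preceq> t \<nu>'"
      by (auto simp: T_def)
    moreover obtain u where u: "u \<in> I" "\<nu> \<preceq> u" "\<nu>' \<preceq> u"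
      using I_bound[of "{\<nu>, \<nu>'}"] \<nu>(1,2) by (auto simp: I_def)
    ultimately show "\<exists>\<theta>\<in>T. \<mu> \<preceq> \<theta> \<and> \<mu>' \<preceq> \<theta>"
      using t_pre tT pre_trans by meson
  qed
  moreover have "S \<subseteq> T"
  proof
    fix \<mu> assume "\<mu> \<in> S"
    then obtain u where "u \<in> I" "\<mu> \<preceq> u"
      using I_bound[of "{\<mu>}"] by auto
    then show "\<mu> \<in> T"
      using t(1) C pre_trans unfolding T_def by blast
  qed
  ultimately have "T = S"
    using S(2) by blast
  obtain \<delta> where "\<delta> \<in> D" "\<delta> \<preceq> t \<kappa>"
    using t(1)[OF \<open>\<kappa> \<in> I\<close>] C by blast
  then have "starts x \<delta>"
    using tT[OF \<open>\<kappa> \<in> I\<close>] \<open>T = S\<close> SD(3) x(2) by blast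
  moreover obtain \<eta> where "\<eta> \<in> E" "(\<kappa>, \<eta>) \<in> composable \<Lambda>" "\<delta> = cmp \<Lambda> \<kappa> \<eta>"
    using \<open>\<delta> \<in> D\<close> by (auto simp: D_def set_cmp_def)
  ultimately show "\<exists>\<mu>\<in>E. starts (shift k m x) \<mu>"
    using starts_cmp_iff[OF x(1) \<kappa>(4)] \<kappa>(3) by auto
qed (rule x)

text \<open>Zorn's lemma for filters containing \<open>v\<close>, beginning with the filter
  consisting of \<open>v\<close> alone. Membership of \<open>v\<close> fixes the range of the
  resulting path.\<close>

lemma boundary_path_exists:
  assumes ca: "compactly_aligned k \<Lambda>" and v: "v \<in> obj \<Lambda>"
  obtains x where "x \<in> boundary_paths k \<Lambda>" "prng x = v"
proof -
  define \<A> where "\<A> = {S. path_filter S \<and> v \<in> S}"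
  have vm: "v \<in> mor \<Lambda>"
    using v obj_subset by blast
  have "\<mu> = v" if "\<mu> \<preceq> v" for \<mu>
    using pre_eq[OF that pre_refl[OF vm]] pre_deg[OF that] deg_id[OF v] by (simp add: le_fun_def fun_eq_iff)
  then have "path_filter {v}"
    using vm pre_refl by (auto simp: path_filter_def)
  then have "\<A> \<noteq> {}"
    by (auto simp: \<A>_def)
  moreover have "\<Union>\<C> \<in> \<A>" if \<C>: "\<C> \<noteq> {}" "subset.chain \<A> \<C>" for \<C>
  proof -
    have f: "path_filter S" "v \<in> S" if "S \<in> \<C>" for S
      using \<C>(2) that by (auto simp: \<A>_def subset.chain_def)
    have "\<exists>\<theta>\<in>\<Union>\<C>. \<mu> \<preceq> \<theta> \<and> \<nu> \<preceq> \<theta>" if \<mu>\<nu>: "\<mu> \<in> \<Union>\<C>" "\<nu> \<in> \<Union>\<C>" for \<mu> \<nu>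
    proof -
      obtain S T where "S \<in> \<C>" "T \<in> \<C>" "\<mu> \<in> S" "\<nu> \<in> T"
        using \<mu>\<nu> by blast
      moreover from this have "S \<subseteq> T \<or> T \<subseteq> S"
        using \<C>(2) by (auto simp: subset_chain_def)
      ultimately obtain R where "R \<in> \<C>" "\<mu> \<in> R" "\<nu> \<in> R"
        by blast
      then show ?thesis
        using path_filterD(4)[OF f(1)] by blast
    qed
    moreover have "\<Union>\<C> \<subseteq> mor \<Lambda>" "\<And>\<theta> \<mu>. \<theta> \<in> \<Union>\<C> \<Longrightarrow> \<mu> \<preceq> \<theta> \<Longrightarrow> \<mu> \<in> \<Union>\<C>"
      using path_filterD[OF f(1)] by blast+
    ultimately show ?thesis
      using f(2) \<C>(1) unfolding \<A>_def path_filter_def by blast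
  qed
  ultimately obtain S where S: "S \<in> \<A>" "\<forall>T\<in>\<A>. S \<subseteq> T \<longrightarrow> T = S"
    using subset_Zorn_nonempty[of \<A>] by blast
  then have f: "path_filter S" "v \<in> S"
    by (auto simp: \<A>_def)
  obtain x where x: "x \<in> path_space k \<Lambda>" "\<And>\<mu>. starts x \<mu> \<longleftrightarrow> \<mu> \<in> S"
    using path_of_filter[OF f(1)] by blast
  have "T = S" if "path_filter T" "S \<subseteq> T" for T
    using S(2) that f(2) by (auto simp: \<A>_def)
  then have "x \<in> boundary_paths k \<Lambda>"
    using maximal_path_boundary[OF ca f(1) _ x] by blast
  moreover have "prng x = v"
    using starts_rng[OF x(1), of v] x(2) f(2) rng_id[OF v] by simp
  ultimately show thesis
    by (rule that)
qed


section \<open>Units and isotropy of the boundary-path groupoid\<close>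

lemma arrow_cases:
  assumes "(\<mu>, \<nu>) \<in> src_pairs \<Lambda>" "y \<in> path_space k \<Lambda>" "prng y = src \<Lambda> \<mu>"
    and "x = prepend k \<Lambda> \<mu> y" "x = prepend k \<Lambda> \<nu> y"
  shows "starts x \<mu>" "starts x \<nu>" "shift k (deg \<Lambda> \<mu>) x = y" "shift k (deg \<Lambda> \<nu>) x = y"
proof -
  have "\<mu> \<in> mor \<Lambda>" "\<nu> \<in> mor \<Lambda>" "prng y = src \<Lambda> \<nu>"
    using assms(1,3) by (auto simp: src_pairs_def)
  then show "starts x \<mu>" "starts x \<nu>" "shift k (deg \<Lambda> \<mu>) x = y" "shift k (deg \<Lambda> \<nu>) x = y"
    using assms starts_prepend shift_prepend by metis+
qed

text \<open>At a unit the degrees of \<open>\<mu>\<close> and \<open>\<nu>\<close> agree, and both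
  are initial segments of the same path, so they coincide. Only the diagonal part of
  \<open>F\<close> is visible on units.\<close>

lemma Zset_unit_iff:
  assumes x: "x \<in> path_space k \<Lambda>" and "F \<subseteq> src_pairs \<Lambda>"
  shows "(x, 0, x) \<in> Zset k \<Lambda> F m \<longleftrightarrow> m = 0 \<and> (\<exists>\<mu>. (\<mu>, \<mu>) \<in> F \<and> starts x \<mu>)"
proof
  assume "(x, 0, x) \<in> Zset k \<Lambda> F m"
  then obtain \<mu> \<nu> y where *: "(\<mu>, \<nu>) \<in> src_pairs \<Lambda>" "y \<in> path_space k \<Lambda>" "prng y = src \<Lambda> \<mu>"
    "x = prepend k \<Lambda> \<mu> y" "x = prepend k \<Lambda> \<nu> y" and F: "(\<mu>, \<nu>) \<in> F"
    and m: "zdeg (deg \<Lambda> \<mu>) - zdeg (deg \<Lambda> \<nu>) = 0" "zdeg (deg \<Lambda> \<mu>) - zdeg (deg \<Lambda> \<nu>) = m"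
    unfolding Zset_def by auto
  have "\<mu> = \<nu>"
    using arrow_cases(1,2)[OF *] m(1) unfolding zdeg_eq_iff starts_def by metis
  then show "m = 0 \<and> (\<exists>\<mu>. (\<mu>, \<mu>) \<in> F \<and> starts x \<mu>)"
    using m F arrow_cases(1)[OF *] by auto
next
  assume "m = 0 \<and> (\<exists>\<mu>. (\<mu>, \<mu>) \<in> F \<and> starts x \<mu>)"
  then obtain \<mu> where \<mu>: "m = 0" "(\<mu>, \<mu>) \<in> F" "starts x \<mu>"
    by blast
  let ?y = "shift k (deg \<Lambda> \<mu>) x"
  have "?y \<in> path_space k \<Lambda>" "prng ?y = src \<Lambda> \<mu>" "prepend k \<Lambda> \<mu> ?y = x" "(\<mu>, \<mu>) \<in> src_pairs \<Lambda>"
    using x \<mu> assms(2) by (auto simp: shift_path starts_src prepend_shift starts_def)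
  moreover have "zdeg (deg \<Lambda> \<mu>) - zdeg (deg \<Lambda> \<mu>) = 0"
    by simp
  ultimately show "(x, 0, x) \<in> Zset k \<Lambda> F m"
    unfolding Zset_def mem_Collect_eq using \<mu>(1,2) by metis
qed

text \<open>Writing \<open>x\<close> both as \<open>\<mu>\<close> followed by \<open>y\<close> and
  as \<open>\<nu>\<close> followed by \<open>y\<close> says that \<open>y\<close> is the shift of
  \<open>x\<close> by either degree. Isotropy thus records coincidences of shifts.\<close>

lemma path_arrows_loop_iff:
  assumes x: "x \<in> path_space k \<Lambda>"
  shows "(x, m, x) \<in> path_arrows k \<Lambda> \<longleftrightarrow>
    (\<exists>p q. edeg p \<le> pdeg x \<and> edeg q \<le> pdeg x \<and> shift k p x = shift k q x \<and> m = zdeg p - zdeg q)"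
proof
  assume "(x, m, x) \<in> path_arrows k \<Lambda>"
  then obtain \<mu> \<nu> y where *: "(\<mu>, \<nu>) \<in> src_pairs \<Lambda>" "y \<in> path_space k \<Lambda>" "prng y = src \<Lambda> \<mu>"
    "x = prepend k \<Lambda> \<mu> y" "x = prepend k \<Lambda> \<nu> y" and m: "m = zdeg (deg \<Lambda> \<mu>) - zdeg (deg \<Lambda> \<nu>)"
    unfolding path_arrows_def by auto
  then show "\<exists>p q. edeg p \<le> pdeg x \<and> edeg q \<le> pdeg x \<and> shift k p x = shift k q x \<and> m = zdeg p - zdeg q"
    using arrow_cases[OF *] unfolding starts_def by metis
next
  assume "\<exists>p q. edeg p \<le> pdeg x \<and> edeg q \<le> pdeg x \<and> shift k p x = shift k q x \<and> m = zdeg p - zdeg q"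
  then obtain p q where pq: "edeg p \<le> pdeg x" "edeg q \<le> pdeg x" "shift k p x = shift k q x"
    and m: "m = zdeg p - zdeg q"
    by blast
  let ?\<mu> = "seg x 0 p" and ?\<nu> = "seg x 0 q" and ?y = "shift k p x"
  have d: "deg \<Lambda> ?\<mu> = p" "deg \<Lambda> ?\<nu> = q"
    using pq deg_seg0[OF x] by auto
  have "prng ?y = src \<Lambda> ?\<mu>" "prng ?y = src \<Lambda> ?\<nu>"
    using prng_shift[OF x pq(1)] prng_shift[OF x pq(2)] pq(3) by auto
  moreover from this have "(?\<mu>, ?\<nu>) \<in> src_pairs \<Lambda>"
    using seg0_mor[OF x] pq by (simp add: src_pairs_def)
  moreover have "prepend k \<Lambda> ?\<mu> ?y = x" "prepend k \<Lambda> ?\<nu> ?y = x"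
    using prepend_shift[OF x starts_seg[OF x]] pq d by metis+
  ultimately show "(x, m, x) \<in> path_arrows k \<Lambda>"
    unfolding path_arrows_def mem_Collect_eq using shift_path[OF x pq(1)] d m by metis
qed

lemma unit_in_path_arrows: "x \<in> path_space k \<Lambda> \<Longrightarrow> (x, 0, x) \<in> path_arrows k \<Lambda>"
  unfolding path_arrows_loop_iff by (intro exI[of _ 0]) simp

lemma units_boundary: "units (boundary_path_groupoid k \<Lambda>) = (\<lambda>x. (x, 0, x)) ` boundary_paths k \<Lambda>"
  and arrows_boundary: "arrows (boundary_path_groupoid k \<Lambda>) =
    {(x, m, y). (x, m, y) \<in> path_arrows k \<Lambda> \<and> x \<in> boundary_paths k \<Lambda> \<and> y \<in> boundary_paths k \<Lambda>}"
proof -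
  show a: "arrows (boundary_path_groupoid k \<Lambda>) =
    {(x, m, y). (x, m, y) \<in> path_arrows k \<Lambda> \<and> x \<in> boundary_paths k \<Lambda> \<and> y \<in> boundary_paths k \<Lambda>}"
    using arrows_path_groupoid
    by (auto simp: boundary_path_groupoid_def reduction_def arrows_def path_groupoid_def)
  have "(x, 0, x) \<in> arrows (boundary_path_groupoid k \<Lambda>)" if "x \<in> boundary_paths k \<Lambda>" for x
    using that unit_in_path_arrows by (simp add: a boundary_paths_iff)
  moreover have "arr_rng (boundary_path_groupoid k \<Lambda>) (x, m, y) = (x, 0, x)" for x m y
    by (simp add: boundary_path_groupoid_def reduction_def path_groupoid_def)
  ultimately show "units (boundary_path_groupoid k \<Lambda>) = (\<lambda>x. (x, 0, x)) ` boundary_paths k \<Lambda>"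
    unfolding units_def by (force simp: a intro: rev_image_eqI)
qed

text \<open>The reduction contains its units, so restricting to it first does not affect the
  relative topology on them.\<close>

lemma unit_top_boundary:
  "unit_top (boundary_path_groupoid k \<Lambda>) =
    subtopology (topology_generated_by (path_groupoid_basis k \<Lambda>)) (units (boundary_path_groupoid k \<Lambda>))"
proof -
  let ?G = "boundary_path_groupoid k \<Lambda>" and ?T = "topology_generated_by (path_groupoid_basis k \<Lambda>)"
  obtain B where B: "arr_top ?G = subtopology ?T B"
    by (simp add: boundary_path_groupoid_def reduction_def path_groupoid_def)
  have "units ?G \<subseteq> arrows ?G"
    using unit_in_path_arrows by (auto simp: units_boundary arrows_boundary boundary_paths_iff)
  then have "units ?G \<subseteq> B"
    by (auto simp: arrows_def B)
  then show ?thesis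
    by (simp add: unit_top_def B subtopology_subtopology Int_absorb1)
qed

lemma isotropy_boundary_trivial_iff:
  assumes x: "x \<in> boundary_paths k \<Lambda>"
  shows "isotropy (boundary_path_groupoid k \<Lambda>) (x, 0, x) = {(x, 0, x)} \<longleftrightarrow> aperiodic k x"
proof -
  have xp: "x \<in> path_space k \<Lambda>"
    using x by (simp add: boundary_paths_iff)
  have iso: "isotropy (boundary_path_groupoid k \<Lambda>) (x, 0, x) = {(x, m, x) | m. (x, m, x) \<in> path_arrows k \<Lambda>}"
    using x by (auto simp: isotropy_def arrows_boundary)
      (auto simp: boundary_path_groupoid_def reduction_def path_groupoid_def)
  have "isotropy (boundary_path_groupoid k \<Lambda>) (x, 0, x) = {(x, 0, x)} \<longleftrightarrow>
    (\<forall>m. (x, m, x) \<in> path_arrows k \<Lambda> \<longrightarrow> m = 0)"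
    unfolding iso using unit_in_path_arrows[OF xp] by blast
  also have "\<dots> \<longleftrightarrow> aperiodic k x"
    unfolding path_arrows_loop_iff[OF xp] aperiodic_def
    using zdeg_eq_iff NInfk_edeg_le pdeg_NInfk[OF xp] by metis
  finally show ?thesis .
qed

section \<open>Neighbourhoods of units\<close>

definition cyl :: "'a set \<Rightarrow> 'a set \<Rightarrow> 'a kpath set" where
  "cyl U F = {x \<in> path_space k \<Lambda>. (\<exists>\<mu>\<in>U. starts x \<mu>) \<and> (\<forall>\<phi>\<in>F. \<not> starts x \<phi>)}"

lemma compactin_diagonal:
  assumes "compactin (prod_topology (mor_top \<Lambda>) (mor_top \<Lambda>)) F"
  shows "compactin (mor_top \<Lambda>) {\<mu>. (\<mu>, \<mu>) \<in> F}"
proof -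
  have "compactin (prod_topology (mor_top \<Lambda>) (mor_top \<Lambda>)) ((\<lambda>\<mu>. (\<mu>, \<mu>)) ` mor \<Lambda> \<inter> F)"
    using closed_Int_compactin[OF _ assms] Hausdorff_mor by (simp add: Hausdorff_space_closedin_diagonal)
  from image_compactin[OF this continuous_map_fst]
  have "compactin (mor_top \<Lambda>) (fst ` ((\<lambda>\<mu>. (\<mu>, \<mu>)) ` mor \<Lambda> \<inter> F))" .
  moreover have "F \<subseteq> mor \<Lambda> \<times> mor \<Lambda>"
    using compactin_subset_topspace[OF assms] by simp
  then have "fst ` ((\<lambda>\<mu>. (\<mu>, \<mu>)) ` mor \<Lambda> \<inter> F) = {\<mu>. (\<mu>, \<mu>) \<in> F}"
    by force
  ultimately show ?thesis
    by simp
qed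

text \<open>Induction over the generated topology. On units a basic set with \<open>m = 0\<close> is
  a cylinder, the diagonal of \<open>F\<close> being compact, so intersections are the case that
  needs an argument.\<close>

lemma cylinder_neighbourhood:
  assumes "generate_topology_on (path_groupoid_basis k \<Lambda>) T" "(x, 0, x) \<in> T" "x \<in> path_space k \<Lambda>"
  obtains U F where "openin (mor_top \<Lambda>) U" "compactin (mor_top \<Lambda>) F" "x \<in> cyl U F"
    "\<And>y. y \<in> cyl U F \<Longrightarrow> (y, 0, y) \<in> T"
proof -
  let ?P = "\<lambda>T U F. openin (mor_top \<Lambda>) U \<and> compactin (mor_top \<Lambda>) F \<and> x \<in> cyl U F \<and>
    (\<forall>y\<in>cyl U F. (y, 0, y) \<in> T)"
  have "\<exists>U F. ?P T U F"
    using assms(1,2)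
  proof (induction)
    case (Int A B)
    then have "\<exists>U F. ?P A U F" "\<exists>V H. ?P B V H"
      by blast+
    then obtain U F V H where P: "?P A U F" "?P B V H"
      by blast
    \<comment> \<open>The initial segments lying in \<open>U\<close> and \<open>V\<close> may have
      different degrees, so \<open>U \<inter> V\<close> would be too small. Their common extensions
      are used instead; these form an open set because composition is open.\<close>
    let ?U = "{\<theta>. \<exists>\<mu>\<in>U. \<mu> \<preceq> \<theta>} \<inter> {\<theta>. \<exists>\<mu>\<in>V. \<mu> \<preceq> \<theta>}"
    have "cyl ?U (F \<union> H) \<subseteq> cyl U F \<inter> cyl V H"
      unfolding cyl_def using starts_pre by blast
    moreover have "x \<in> cyl ?U (F \<union> H)"
    proof -
      obtain \<mu> \<nu> where \<mu>: "\<mu> \<in> U" "\<nu> \<in> V" "starts x \<mu>" "starts x \<nu>"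
        using P by (auto simp: cyl_def)
      obtain \<theta> where "starts x \<theta>" "\<mu> \<preceq> \<theta>" "\<nu> \<preceq> \<theta>"
        using starts_directed[OF assms(3) \<mu>(3,4)] by blast
      then show ?thesis
        using P \<mu>(1,2) by (auto simp: cyl_def)
    qed
    moreover have "openin (mor_top \<Lambda>) ?U"
      using P by (intro openin_Int openin_extensions) auto
    moreover have "compactin (mor_top \<Lambda>) (F \<union> H)"
      using P by (intro compactin_Un) auto
    ultimately have "?P (A \<inter> B) ?U (F \<union> H)"
      using P by blast
    then show ?case
      by blast
  next
    case (UN \<K>)
    then obtain A where "A \<in> \<K>" "(x, 0, x) \<in> A"
      by blast
    then obtain U F where "?P A U F"
      using UN.IH by blast
    then have "?P (\<Union>\<K>) U F"
      using \<open>A \<in> \<K>\<close> by blast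
    then show ?case
      by blast
  next
    case (Basis A)
    then obtain U V F m where A: "A = Zset k \<Lambda> ((U \<times> V) \<inter> src_pairs \<Lambda>) m \<inter> (path_arrows k \<Lambda> - Zset k \<Lambda> F m)"
      and UV: "openin (mor_top \<Lambda>) U" "openin (mor_top \<Lambda>) V"
      and F: "F \<subseteq> src_pairs \<Lambda>" "compactin (prod_topology (mor_top \<Lambda>) (mor_top \<Lambda>)) F"
      unfolding path_groupoid_basis_def by blast
    have mem: "(y, 0, y) \<in> A \<longleftrightarrow> m = 0 \<and> y \<in> cyl (U \<inter> V) {\<mu>. (\<mu>, \<mu>) \<in> F}" if y: "y \<in> path_space k \<Lambda>" for y
    proof -
      have "(\<mu>, \<mu>) \<in> src_pairs \<Lambda>" if "starts y \<mu>" for \<mu>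
        using starts_mor[OF y that] by (simp add: src_pairs_def)
      then show ?thesis
        using Zset_unit_iff[OF y F(1), of m] Zset_unit_iff[OF y, of "(U \<times> V) \<inter> src_pairs \<Lambda>" m]
          unit_in_path_arrows[OF y] y unfolding A cyl_def by auto
    qed
    then have "m = 0" "x \<in> cyl (U \<inter> V) {\<mu>. (\<mu>, \<mu>) \<in> F}"
      using mem[OF assms(3)] Basis.prems by blast+
    moreover have "(y, 0, y) \<in> A" if "y \<in> cyl (U \<inter> V) {\<mu>. (\<mu>, \<mu>) \<in> F}" for y
      using mem[of y] that \<open>m = 0\<close> unfolding cyl_def by blast
    moreover have "openin (mor_top \<Lambda>) (U \<inter> V)"
      using UV by (rule openin_Int)
    ultimately have "?P A (U \<inter> V) {\<mu>. (\<mu>, \<mu>) \<in> F}"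
      using compactin_diagonal[OF F(2)] by blast
    then show ?case
      by blast
  qed simp
  then show thesis
    using that by blast
qed

text \<open>The basic set with \<open>m = 0\<close>, empty \<open>F\<close> and both open sets equal
  to the preimage of \<open>V\<close> under the range map. The vertex \<open>prng x\<close> is an
  initial segment of \<open>x\<close>, which gives membership.\<close>

lemma range_neighbourhood:
  assumes "openin (obj_top \<Lambda>) V"
  obtains T where "openin (topology_generated_by (path_groupoid_basis k \<Lambda>)) T"
    "\<And>x. x \<in> path_space k \<Lambda> \<Longrightarrow> (x, 0, x) \<in> T \<longleftrightarrow> prng x \<in> V"
proof
  let ?U = "{\<mu> \<in> mor \<Lambda>. rng \<Lambda> \<mu> \<in> V}"
  let ?T = "Zset k \<Lambda> ((?U \<times> ?U) \<inter> src_pairs \<Lambda>) 0 \<inter> (path_arrows k \<Lambda> - Zset k \<Lambda> {} 0)"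
  have "?T \<in> path_groupoid_basis k \<Lambda>"
    unfolding path_groupoid_basis_def mem_Collect_eq
    by (rule exI[of _ ?U], rule exI[of _ ?U], rule exI[of _ "{}"], rule exI[of _ 0])
      (simp add: openin_rng_preimage[OF assms] Zk_def)
  then show "openin (topology_generated_by (path_groupoid_basis k \<Lambda>)) ?T"
    by (rule topology_generated_by_Basis)
  fix x assume x: "x \<in> path_space k \<Lambda>"
  have "(\<exists>\<mu>. (\<mu>, \<mu>) \<in> (?U \<times> ?U) \<inter> src_pairs \<Lambda> \<and> starts x \<mu>) \<longleftrightarrow> prng x \<in> V"
  proof
    assume "prng x \<in> V"
    moreover have "starts x (prng x)" "prng x \<in> obj \<Lambda>"
      using starts_prng[OF x] by auto
    ultimately show "\<exists>\<mu>. (\<mu>, \<mu>) \<in> (?U \<times> ?U) \<inter> src_pairs \<Lambda> \<and> starts x \<mu>"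
      using obj_subset rng_id by (intro exI[of _ "prng x"]) (auto simp: src_pairs_def)
  qed (use starts_rng[OF x] in auto)
  then show "(x, 0, x) \<in> ?T \<longleftrightarrow> prng x \<in> V"
    using Zset_unit_iff[OF x, of "(?U \<times> ?U) \<inter> src_pairs \<Lambda>" 0] Zset_unit_iff[OF x, of "{}" 0]
      unit_in_path_arrows[OF x] by simp
qed

text \<open>Density spelled out with open sets of the whole path groupoid, which is possible because
  the unit space carries a relative topology.\<close>

lemma essentially_free_boundary_iff:
  "essentially_free (boundary_path_groupoid k \<Lambda>) \<longleftrightarrow>
    (\<forall>x\<in>boundary_paths k \<Lambda>. \<forall>T. openin (topology_generated_by (path_groupoid_basis k \<Lambda>)) T \<and> (x, 0, x) \<in> T \<longrightarrow>
      (\<exists>y\<in>boundary_paths k \<Lambda>. aperiodic k y \<and> (y, 0, y) \<in> T))"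
proof -
  let ?G = "boundary_path_groupoid k \<Lambda>" and ?T = "topology_generated_by (path_groupoid_basis k \<Lambda>)"
  have "units ?G \<subseteq> topspace ?T"
    using unit_in_path_arrows arrows_path_groupoid
    by (auto simp: units_boundary boundary_paths_iff arrows_def path_groupoid_def)
  then have top: "topspace (unit_top ?G) = units ?G"
    by (simp add: unit_top_boundary Int_absorb1)
  define A where "A = (\<lambda>y. (y, 0 :: nat \<Rightarrow> int, y)) ` {y \<in> boundary_paths k \<Lambda>. aperiodic k y}"
  have A: "{u \<in> units ?G. isotropy ?G u = {u}} = A"
    unfolding units_boundary A_def using isotropy_boundary_trivial_iff by blast
  have "essentially_free ?G \<longleftrightarrow> (\<forall>u\<in>units ?G. u \<in> unit_top ?G closure_of A)"
    unfolding essentially_free_def A using closure_of_subset_topspace[of "unit_top ?G"] top by blast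
  also have "\<dots> \<longleftrightarrow> (\<forall>u\<in>units ?G. \<forall>T. openin ?T T \<and> u \<in> T \<longrightarrow> (\<exists>w\<in>A. w \<in> T))"
  proof (rule ball_cong[OF refl])
    fix u assume u: "u \<in> units ?G"
    have "A \<subseteq> units ?G"
      using A by blast
    then show "u \<in> unit_top ?G closure_of A \<longleftrightarrow> (\<forall>T. openin ?T T \<and> u \<in> T \<longrightarrow> (\<exists>w\<in>A. w \<in> T))"
      unfolding in_closure_of top unfolding unit_top_boundary openin_subtopology using u by blast
  qed
  also have "\<dots> \<longleftrightarrow> (\<forall>x\<in>boundary_paths k \<Lambda>. \<forall>T. openin ?T T \<and> (x, 0, x) \<in> T \<longrightarrow>
      (\<exists>y\<in>boundary_paths k \<Lambda>. aperiodic k y \<and> (y, 0, y) \<in> T))"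
    unfolding units_boundary A_def by blast
  finally show ?thesis .
qed

end

theorem theorem5p2:
  fixes k :: nat and \<Lambda> :: "'a tkgraph"
  assumes "topological_k_graph k \<Lambda>"
    and "compactly_aligned k \<Lambda>"
  shows "essentially_free (boundary_path_groupoid k \<Lambda>) \<longleftrightarrow>
    (\<forall>V. openin (obj_top \<Lambda>) V \<and> V \<noteq> {} \<longrightarrow>
      (\<exists>x\<in>boundary_paths k \<Lambda>. aperiodic k x \<and> prng x \<in> V))"
proof -
  interpret topological_k_graph k \<Lambda>
    by (rule assms)
  show ?thesis
    unfolding essentially_free_boundary_iff
  proof (intro iffI allI impI ballI)
    fix V
    assume free: "\<forall>x\<in>boundary_paths k \<Lambda>. \<forall>T. openin (topology_generated_by (path_groupoid_basis k \<Lambda>)) T \<and>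
        (x, 0, x) \<in> T \<longrightarrow> (\<exists>y\<in>boundary_paths k \<Lambda>. aperiodic k y \<and> (y, 0, y) \<in> T)"
      and V: "openin (obj_top \<Lambda>) V \<and> V \<noteq> {}"
    \<comment> \<open>Density says something about \<open>V\<close> only if the open set over
      \<open>V\<close> contains a unit, so a boundary path with range in \<open>V\<close> has to be
      found first.\<close>
    obtain v where "v \<in> V" "v \<in> obj \<Lambda>"
      using V openin_subset by fastforce
    then obtain x where x: "x \<in> boundary_paths k \<Lambda>" "prng x \<in> V"
      using boundary_path_exists[OF assms(2)] by metis
    obtain T where T: "openin (topology_generated_by (path_groupoid_basis k \<Lambda>)) T"
      "\<And>x. x \<in> path_space k \<Lambda> \<Longrightarrow> (x, 0, x) \<in> T \<longleftrightarrow> prng x \<in> V"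
      using range_neighbourhood V by metis
    have path: "y \<in> path_space k \<Lambda>" if "y \<in> boundary_paths k \<Lambda>" for y
      using that by (simp add: boundary_paths_iff)
    then have "(x, 0, x) \<in> T"
      using T(2) x by simp
    then obtain y where "y \<in> boundary_paths k \<Lambda>" "aperiodic k y" "(y, 0, y) \<in> T"
      using free x(1) T(1) by blast
    then show "\<exists>x\<in>boundary_paths k \<Lambda>. aperiodic k x \<and> prng x \<in> V"
      using T(2) path by blast
  next
    fix x T
    assume ap: "\<forall>V. openin (obj_top \<Lambda>) V \<and> V \<noteq> {} \<longrightarrow> (\<exists>x\<in>boundary_paths k \<Lambda>. aperiodic k x \<and> prng x \<in> V)"
      and x: "x \<in> boundary_paths k \<Lambda>"
      and T: "openin (topology_generated_by (path_groupoid_basis k \<Lambda>)) T \<and> (x, 0, x) \<in> T"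
    have "x \<in> path_space k \<Lambda>"
      using x by (simp add: boundary_paths_iff)
    then obtain U F where U: "openin (mor_top \<Lambda>) U" and F: "compactin (mor_top \<Lambda>) F"
      and xU: "x \<in> cyl U F" and cyl_T: "\<And>y. y \<in> cyl U F \<Longrightarrow> (y, 0, y) \<in> T"
      using cylinder_neighbourhood[of T x] T openin_topology_generated_by by metis
    obtain \<mu> where \<mu>: "\<mu> \<in> U" "starts x \<mu>"
      using xU by (auto simp: cyl_def)
    have "\<not> starts x \<phi>" if "\<phi> \<in> F" for \<phi>
      using xU that by (auto simp: cyl_def)
    then obtain M where M: "openin (mor_top \<Lambda>) M" "M \<noteq> {}"
      "\<And>\<nu>. \<nu> \<in> M \<Longrightarrow> \<exists>\<kappa>\<in>U. (\<kappa>, \<nu>) \<in> composable \<Lambda> \<and>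
         (\<forall>\<phi>\<in>F. \<forall>\<theta>. cmp \<Lambda> \<kappa> \<nu> \<preceq> \<theta> \<longrightarrow> \<not> \<phi> \<preceq> \<theta>)"
      using boundary_avoid[OF assms(2) x \<mu>(2) _ U \<mu>(1) F] by metis
    \<comment> \<open>The source map is open, so the sources of \<open>M\<close> are a nonempty open
      set of vertices, to which the condition applies.\<close>
    obtain z where z: "z \<in> boundary_paths k \<Lambda>" "aperiodic k z" "prng z \<in> src \<Lambda> ` M"
      using ap open_src[OF M(1)] M(2) by blast
    then obtain \<nu> where \<nu>: "\<nu> \<in> M" "prng z = src \<Lambda> \<nu>"
      by blast
    obtain \<kappa> where \<kappa>: "\<kappa> \<in> U" "(\<kappa>, \<nu>) \<in> composable \<Lambda>"
      "\<And>\<phi> \<theta>. \<phi> \<in> F \<Longrightarrow> cmp \<Lambda> \<kappa> \<nu> \<preceq> \<theta> \<Longrightarrow> \<not> \<phi> \<preceq> \<theta>"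
      using M(3)[OF \<nu>(1)] by blast
    let ?\<theta> = "cmp \<Lambda> \<kappa> \<nu>"
    let ?y = "prepend k \<Lambda> ?\<theta> z"
    have \<theta>: "?\<theta> \<in> mor \<Lambda>" "prng z = src \<Lambda> ?\<theta>" "z \<in> path_space k \<Lambda>"
      using cmp_mor[OF \<kappa>(2)] src_cmp[OF \<kappa>(2)] \<nu>(2) z(1) by (auto simp: boundary_paths_iff)
    have y: "?y \<in> path_space k \<Lambda>" "starts ?y ?\<theta>"
      using prepend_path[OF \<theta>(1,3,2)] starts_prepend[OF \<theta>(1,3,2)] by auto
    have "starts ?y \<kappa>"
      using starts_pre[OF y pre_cmp[OF \<kappa>(2)]] .
    \<comment> \<open>Two initial segments of one path have a common extension, and the choice of
      \<open>M\<close> rules this out for \<open>?\<theta>\<close> and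
      \<open>\<phi>\<close>.\<close>
    moreover have "\<not> starts ?y \<phi>" if "\<phi> \<in> F" for \<phi>
      using starts_directed[OF y(1) y(2), of \<phi>] \<kappa>(3)[OF that] by metis
    ultimately have "?y \<in> cyl U F"
      using y(1) \<kappa>(1) by (auto simp: cyl_def)
    then show "\<exists>y\<in>boundary_paths k \<Lambda>. aperiodic k y \<and> (y, 0, y) \<in> T"
      using cyl_T boundary_prepend[OF assms(2) \<theta>(1) z(1) \<theta>(2)] aperiodic_prepend[OF \<theta>(1,3,2) z(2)] by blast
  qed
qed

end
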